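(* Let $\mathcal{H}$ be a cocommutative Hopf algebra over $k$. Then for every $n\ge0$, $$HC^+_n(\mathcal{H};1,\varepsilon)=\bigoplus_{i\ge0}H_{n-4i}(\mathcal{H},k),\qquad HC^-_n(\mathcal{H};1,\varepsilon)=\bigoplus_{i\ge0}H_{n-4i-2}(\mathcal{H},k).$$
   Context: $k$ is a field of characteristic $0$. $H_\bullet(\mathcal{H},k)=\mathrm{Tor}^{\mathcal{H}}_\bullet(k,k)$ (with $H_m=0$ for $m<0$). $HC^\pm_\bullet(\mathcal{H};1,\varepsilon)$ is the dihedral homology (homology of the $\pm1$-eigenspaces of the involution on the cyclic complex) of the dihedral module $\mathrm{CC}_n(\mathcal{H};1,\varepsilon)=\mathcal{H}^{\otimes n}$ with faces $\partial_0(h^1\otimes\cdots\otimes h^n)=\varepsilon(h^1)h^2\otimes\cdots\otimes h^n$, $\partial_i=h^1\otimes\cdots\otimes h^ih^{i+1}\otimes\cdots\otimes h^n$ ($1\le i\le n-1$), $\partial_n=\varepsilon(h^n)h^1\otimes\cdots\otimes h^{n-1}$, degeneracies inserting $1$, cyclic operators $\tau_n(h^1\otimes\cdots\otimes h^n)=\varepsilon(h^n_{(2)})S(h^1_{(1)}\cdots h^n_{(1)})\otimes h^1_{(2)}\otimes\cdots\otimes h^{n-1}_{(2)}$, and involutions $\omega_n(h^1\otimes\cdots\otimes h^n)=S^{-1}(h^n)\otimes\cdots\otimes S^{-1}(h^1)$. *)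

theory Defs
  imports Main
begin

text \<open>A Hopf algebra over the field 'k: the underlying additive group is the type 'h,
  with scalar multiplication, multiplication, unit, counit, comultiplication and antipode.
  The comultiplication of h is given by a (Sweedler) list of pairs representing the
  element of H tensor H that is the sum of the x tensor y; all identities in tensor
  powers are imposed modulo the multilinearity relations (see tensor_rel).\<close>

record ('k,'h) hopf_data =
  hscale :: "'k \<Rightarrow> 'h \<Rightarrow> 'h"
  hmult :: "'h \<Rightarrow> 'h \<Rightarrow> 'h"
  hone :: 'h
  heps :: "'h \<Rightarrow> 'k"
  hDelta :: "'h \<Rightarrow> ('h \<times> 'h) list"
  hS :: "'h \<Rightarrow> 'h"

definition gen :: "'h list \<Rightarrow> 'h list \<Rightarrow> 'k::zero_neq_one" where
  "gen w = (\<lambda>x. if x = w then 1 else 0)"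

definition sc :: "'k::times \<Rightarrow> ('a \<Rightarrow> 'k) \<Rightarrow> 'a \<Rightarrow> 'k" where
  "sc c f = (\<lambda>x. c * f x)"

definition FS :: "nat \<Rightarrow> ('h list \<Rightarrow> 'k::zero) set" where
  "FS n = {f. finite {x. f x \<noteq> 0} \<and> (\<forall>x. f x \<noteq> 0 \<longrightarrow> length x = n)}"

definition lext :: "('h list \<Rightarrow> 'b \<Rightarrow> 'k) \<Rightarrow> ('h list \<Rightarrow> 'k::comm_ring_1) \<Rightarrow> 'b \<Rightarrow> 'k" where
  "lext F f = (\<lambda>x. \<Sum>w\<in>{w. f w \<noteq> 0}. f w * F w x)"

definition fspan :: "('a \<Rightarrow> 'k::comm_ring_1) set \<Rightarrow> ('a \<Rightarrow> 'k) set" where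
  "fspan A = {f. \<exists>S c. finite S \<and> S \<subseteq> A \<and> f = (\<lambda>x. \<Sum>a\<in>S. c a * a x)}"

text \<open>Multilinearity relations; H^{\<otimes>n} is FS n modulo tensor_rel H n.\<close>
definition tensor_rel :: "('k::comm_ring_1, 'h::plus) hopf_data \<Rightarrow> nat \<Rightarrow> ('h list \<Rightarrow> 'k) set" where
  "tensor_rel H n = fspan
     ({\<lambda>x. gen (u @ [a + b] @ v) x - gen (u @ [a] @ v) x - gen (u @ [b] @ v) x
        | u v a b. length u + length v + 1 = n}
    \<union> {\<lambda>x. gen (u @ [hscale H c a] @ v) x - c * gen (u @ [a] @ v) x
        | u v a c. length u + length v + 1 = n})"

definition teq :: "('k::comm_ring_1, 'h::plus) hopf_data \<Rightarrow> nat \<Rightarrow> ('h list \<Rightarrow> 'k) \<Rightarrow> ('h list \<Rightarrow> 'k) \<Rightarrow> bool" where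
  "teq H n f g \<longleftrightarrow> (\<lambda>x. f x - g x) \<in> tensor_rel H n"

definition tens2 :: "('h \<times> 'h) list \<Rightarrow> 'h list \<Rightarrow> 'k::comm_ring_1" where
  "tens2 L = (\<lambda>x. \<Sum>p\<leftarrow>L. gen [fst p, snd p] x)"

definition cocomm_hopf_algebra :: "('k::field, 'h::ab_group_add) hopf_data \<Rightarrow> bool" where
  "cocomm_hopf_algebra H \<longleftrightarrow>
    \<comment> \<open>vector space\<close>
    (\<forall>a x y. hscale H a (x + y) = hscale H a x + hscale H a y) \<and>
    (\<forall>a b x. hscale H (a + b) x = hscale H a x + hscale H b x) \<and>
    (\<forall>a b x. hscale H a (hscale H b x) = hscale H (a * b) x) \<and>
    (\<forall>x. hscale H 1 x = x) \<and>
    \<comment> \<open>unital associative algebra\<close>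
    (\<forall>a b c. hmult H (a + b) c = hmult H a c + hmult H b c) \<and>
    (\<forall>a b c. hmult H a (b + c) = hmult H a b + hmult H a c) \<and>
    (\<forall>r a b. hmult H (hscale H r a) b = hscale H r (hmult H a b)) \<and>
    (\<forall>r a b. hmult H a (hscale H r b) = hscale H r (hmult H a b)) \<and>
    (\<forall>a b c. hmult H (hmult H a b) c = hmult H a (hmult H b c)) \<and>
    (\<forall>a. hmult H (hone H) a = a \<and> hmult H a (hone H) = a) \<and>
    \<comment> \<open>counit: linear algebra map\<close>
    (\<forall>a b. heps H (a + b) = heps H a + heps H b) \<and>
    (\<forall>r a. heps H (hscale H r a) = r * heps H a) \<and>
    (\<forall>a b. heps H (hmult H a b) = heps H a * heps H b) \<and>
    heps H (hone H) = 1 \<and>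
    \<comment> \<open>comultiplication: linear, coassociative, counital, algebra map\<close>
    (\<forall>a b. teq H 2 (tens2 (hDelta H (a + b)))
                    (\<lambda>x. tens2 (hDelta H a) x + tens2 (hDelta H b) x)) \<and>
    (\<forall>r a. teq H 2 (tens2 (hDelta H (hscale H r a))) (sc r (tens2 (hDelta H a)))) \<and>
    (\<forall>h. teq H 3
       (\<lambda>x. \<Sum>p\<leftarrow>hDelta H h. \<Sum>q\<leftarrow>hDelta H (fst p). gen [fst q, snd q, snd p] x)
       (\<lambda>x. \<Sum>p\<leftarrow>hDelta H h. \<Sum>q\<leftarrow>hDelta H (snd p). gen [fst p, fst q, snd q] x)) \<and>
    (\<forall>h. (\<Sum>p\<leftarrow>hDelta H h. hscale H (heps H (fst p)) (snd p)) = h) \<and>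
    (\<forall>h. (\<Sum>p\<leftarrow>hDelta H h. hscale H (heps H (snd p)) (fst p)) = h) \<and>
    (\<forall>a b. teq H 2 (tens2 (hDelta H (hmult H a b)))
       (\<lambda>x. \<Sum>p\<leftarrow>hDelta H a. \<Sum>q\<leftarrow>hDelta H b.
              gen [hmult H (fst p) (fst q), hmult H (snd p) (snd q)] x)) \<and>
    teq H 2 (tens2 (hDelta H (hone H))) (gen [hone H, hone H]) \<and>
    \<comment> \<open>antipode\<close>
    (\<forall>a b. hS H (a + b) = hS H a + hS H b) \<and>
    (\<forall>r a. hS H (hscale H r a) = hscale H r (hS H a)) \<and>
    (\<forall>h. (\<Sum>p\<leftarrow>hDelta H h. hmult H (hS H (fst p)) (snd p)) = hscale H (heps H h) (hone H)) \<and>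
    (\<forall>h. (\<Sum>p\<leftarrow>hDelta H h. hmult H (fst p) (hS H (snd p))) = hscale H (heps H h) (hone H)) \<and>
    \<comment> \<open>cocommutativity\<close>
    (\<forall>h. teq H 2 (tens2 (hDelta H h)) (tens2 (map (\<lambda>p. (snd p, fst p)) (hDelta H h))))"

definition face :: "('k::comm_ring_1, 'h) hopf_data \<Rightarrow> nat \<Rightarrow> 'h list \<Rightarrow> 'h list \<Rightarrow> 'k" where
  "face H i w =
     (if i = 0 then sc (heps H (hd w)) (gen (tl w))
      else if i = length w then sc (heps H (last w)) (gen (butlast w))
      else gen (take (i - 1) w @ [hmult H (w ! (i - 1)) (w ! i)] @ drop (i + 1) w))"

definition bgen :: "('k::comm_ring_1, 'h) hopf_data \<Rightarrow> 'h list \<Rightarrow> 'h list \<Rightarrow> 'k" where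
  "bgen H w = (if w = [] then (\<lambda>_. 0)
               else (\<lambda>x. \<Sum>i = 0..length w. (-1) ^ i * face H i w x))"

definition bnd :: "('k::comm_ring_1, 'h) hopf_data \<Rightarrow> ('h list \<Rightarrow> 'k) \<Rightarrow> 'h list \<Rightarrow> 'k" where
  "bnd H f = lext (bgen H) f"

fun choices :: "'a list list \<Rightarrow> 'a list list" where
  "choices [] = [[]]"
| "choices (l # ls) = concat (map (\<lambda>x. map (\<lambda>r. x # r) (choices ls)) l)"

text \<open>Cyclic operator tau_n (Sweedler sums expanded over all choices of summands).\<close>
definition taugen :: "('k::comm_ring_1, 'h) hopf_data \<Rightarrow> 'h list \<Rightarrow> 'h list \<Rightarrow> 'k" where
  "taugen H w = (if w = [] then gen []
     else (\<lambda>x. \<Sum>p\<leftarrow>choices (map (hDelta H) w).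
        heps H (snd (last p)) *
        gen (hS H (foldr (hmult H) (map fst p) (hone H)) # map snd (butlast p)) x))"

definition tgen :: "('k::comm_ring_1, 'h) hopf_data \<Rightarrow> 'h list \<Rightarrow> 'h list \<Rightarrow> 'k" where
  "tgen H w = (\<lambda>x. (-1) ^ length w * taugen H w x)"

definition omegagen :: "('k::comm_ring_1, 'h) hopf_data \<Rightarrow> 'h list \<Rightarrow> 'h list \<Rightarrow> 'k" where
  "omegagen H w = gen (rev (map (inv (hS H)) w))"

definition ygen :: "('k::comm_ring_1, 'h) hopf_data \<Rightarrow> 'h list \<Rightarrow> 'h list \<Rightarrow> 'k" where
  "ygen H w = (\<lambda>x. (-1) ^ (length w * (length w + 1) div 2) * omegagen H w x)"

text \<open>Connes' complex C^lambda_n = H^{\<otimes>n} / im(1 - t_n), represented as FS n modulo cyc_rel.\<close>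
definition cyc_rel :: "('k::comm_ring_1, 'h::plus) hopf_data \<Rightarrow> nat \<Rightarrow> ('h list \<Rightarrow> 'k) set" where
  "cyc_rel H n = {\<lambda>x. r x + lext (\<lambda>w y. gen w y - tgen H w y) f x
                   | r f. r \<in> tensor_rel H n \<and> f \<in> FS n}"

text \<open>Preimage in FS n of the s-eigenspace (s = 1 or -1) of the involution on C^lambda_n.\<close>
definition eigen :: "('k::comm_ring_1, 'h::plus) hopf_data \<Rightarrow> 'k \<Rightarrow> nat \<Rightarrow> ('h list \<Rightarrow> 'k) set" where
  "eigen H s n = {f \<in> FS n. (\<lambda>x. lext (ygen H) f x - s * f x) \<in> cyc_rel H n}"

text \<open>Cycles and boundaries of the dihedral complex (C^lambda)^{s}; HC^{s}_n = dcyc / dbnd.\<close>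
definition dcyc :: "('k::comm_ring_1, 'h::plus) hopf_data \<Rightarrow> 'k \<Rightarrow> nat \<Rightarrow> ('h list \<Rightarrow> 'k) set" where
  "dcyc H s n = {f \<in> eigen H s n. n = 0 \<or> bnd H f \<in> cyc_rel H (n - 1)}"

definition dbnd :: "('k::comm_ring_1, 'h::plus) hopf_data \<Rightarrow> 'k \<Rightarrow> nat \<Rightarrow> ('h list \<Rightarrow> 'k) set" where
  "dbnd H s n = {\<lambda>x. bnd H g x + q x | g q. g \<in> eigen H s (Suc n) \<and> q \<in> cyc_rel H n}"

text \<open>H_m(H,k) = Tor^H_m(k,k), computed by the bar complex k \<otimes>_H B(H):
  chains H^{\<otimes>m}, boundary b as above.  H_m = hcyc / hbnd.\<close>
definition hcyc :: "('k::comm_ring_1, 'h::plus) hopf_data \<Rightarrow> nat \<Rightarrow> ('h list \<Rightarrow> 'k) set" where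
  "hcyc H m = {f \<in> FS m. m = 0 \<or> bnd H f \<in> tensor_rel H (m - 1)}"

definition hbnd :: "('k::comm_ring_1, 'h::plus) hopf_data \<Rightarrow> nat \<Rightarrow> ('h list \<Rightarrow> 'k) set" where
  "hbnd H m = {\<lambda>x. bnd H g x + q x | g q. g \<in> FS (Suc m) \<and> q \<in> tensor_rel H m}"

text \<open>subquot_iso Z B I Zs Bs: the k-vector space Z/B is isomorphic to the direct sum
  over i \<in> I of Zs i / Bs i (via a linear map Z \<rightarrow> \<Oplus> Zs i inducing a bijection).\<close>
definition subquot_iso ::
  "('a \<Rightarrow> 'k::comm_ring_1) set \<Rightarrow> ('a \<Rightarrow> 'k) set \<Rightarrow> nat set
   \<Rightarrow> (nat \<Rightarrow> ('b \<Rightarrow> 'k) set) \<Rightarrow> (nat \<Rightarrow> ('b \<Rightarrow> 'k) set) \<Rightarrow> bool" where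
  "subquot_iso Z B I Zs Bs \<longleftrightarrow>
    (\<exists>\<phi> :: ('a \<Rightarrow> 'k) \<Rightarrow> nat \<Rightarrow> 'b \<Rightarrow> 'k.
      (\<forall>x\<in>Z. \<forall>y\<in>Z. \<forall>c d. \<phi> (\<lambda>t. c * x t + d * y t) = (\<lambda>i t. c * \<phi> x i t + d * \<phi> y i t)) \<and>
      (\<forall>x\<in>Z. \<forall>i. (i \<in> I \<longrightarrow> \<phi> x i \<in> Zs i) \<and> (i \<notin> I \<longrightarrow> \<phi> x i = (\<lambda>_. 0))) \<and>
      (\<forall>z. (\<forall>i\<in>I. z i \<in> Zs i) \<longrightarrow> (\<exists>x\<in>Z. \<forall>i\<in>I. (\<lambda>t. z i t - \<phi> x i t) \<in> Bs i)) \<and>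
      (\<forall>x\<in>Z. x \<in> B \<longleftrightarrow> (\<forall>i\<in>I. \<phi> x i \<in> Bs i)))"

end

theory Submission
  imports Defs Complex_Main "HOL-Library.Poly_Mapping" "HOL-Library.Function_Algebras"
begin

text \<open>
  A cocommutative Hopf algebra is a group object in cocommutative coalgebras. Hence every map f from
  {0..m} to {0..n} induces an operator from the n-th to the m-th tensor power, in the notation of groups
  \<open>(h\<^sub>1, \<dots>, h\<^sub>n) \<mapsto> (x\<^bsub>f(j-1)\<^esub>\<inverse> x\<^bsub>f(j)\<^esub>)\<^bsub>1 \<le> j \<le> m\<^esub>\<close> with the partial products \<open>x\<^sub>j = h\<^sub>1 \<cdots> h\<^sub>j\<close>. Faces, cyclic operators and
  involutions come from cofaces, rotations and order reversals. So natural chain maps and homotopies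
  may be constructed on universal elements, that is, in the ordered chain complexes of simplices.

  After averaging over the dihedral groups, these complexes stay exact except for one class in the
  degrees 4i (for the sign 1) or 4i + 2 (for the sign -1), which the augmentation detects: inserting a
  fixed vertex in all positions is a contraction up to the operator that counts the letters different
  from that vertex. By acyclic models there are natural maps in both directions between the dihedral
  complex and the sum of the bar complexes shifted by 4i (or 4i + 2), and they are mutually inverse up
  to natural homotopy.
\<close>

section \<open>Natural operators\<close>

text \<open>In the tensor powers every identity holds only modulo multilinearity, and a coproduct is
  known only through one of its Sweedler representatives. This shapes the proof: all homological
  algebra takes place among formal sums of words, where equations are strict, and the words act on
  tensors only at the end. A natural operator out of degree \<open>n\<close> is its value on the
  identity word, so a natural homotopy is a single unknown in \<open>Op\<close> for each degree and
  naturality imposes no further equation. Maps between coinvariants are operators with two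
  invariance conditions. Precomposing with the averaged identity word makes an operator factor
  through the coinvariants of the source; applying the average to its words places its values in
  those of the target. In characteristic 0 both are idempotent, and the source condition can be
  imposed after an equation has been solved, because composition on the source side commutes with
  everything that happens to the words. Cocommutativity serves to make the antipode and convolution
  products coalgebra morphisms, which is what lets maps of vertices act at all.\<close>

abbreviation "lookup \<equiv> Poly_Mapping.lookup"
abbreviation "keys \<equiv> Poly_Mapping.keys"

type_synonym 'k chain = "nat list \<Rightarrow>\<^sub>0 'k"

section \<open>Free modules, their linear maps and the augmentation\<close>

definition pscale :: "'k::comm_ring_1 \<Rightarrow> ('a \<Rightarrow>\<^sub>0 'k) \<Rightarrow> 'a \<Rightarrow>\<^sub>0 'k" where
  "pscale c f = Poly_Mapping.map ((*) c) f"

lemma lookup_pscale [simp]: "lookup (pscale c f) x = c * lookup f x"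
  by (simp add: pscale_def map.rep_eq when_def)

interpretation pscale: module pscale
  by standard (auto intro!: poly_mapping_eqI simp: lookup_add algebra_simps)

abbreviation bas :: "'a \<Rightarrow> 'a \<Rightarrow>\<^sub>0 'k::comm_ring_1" where
  "bas x \<equiv> Poly_Mapping.single x 1"

definition supp :: "'a set \<Rightarrow> ('a \<Rightarrow>\<^sub>0 'k::comm_ring_1) set" where
  "supp A = {u. keys u \<subseteq> A}"

lemma supp_iff: "u \<in> supp A \<longleftrightarrow> (\<forall>x. lookup u x \<noteq> 0 \<longrightarrow> x \<in> A)"
  by (auto simp: supp_def in_keys_iff)

lemma supp_0 [simp]: "0 \<in> supp A"
  by (simp add: supp_def)

lemma supp_add [intro]: "u \<in> supp A \<Longrightarrow> v \<in> supp A \<Longrightarrow> u + v \<in> supp A"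
  unfolding supp_iff lookup_add by (metis add_0)

lemma supp_pscale [intro]: "u \<in> supp A \<Longrightarrow> pscale c u \<in> supp A"
  unfolding supp_iff lookup_pscale by (metis mult_zero_right)

lemma supp_diff [intro]: "u \<in> supp A \<Longrightarrow> v \<in> supp A \<Longrightarrow> u - v \<in> supp A"
  unfolding supp_iff lookup_minus by (metis diff_zero)

lemma supp_bas [intro]: "x \<in> A \<Longrightarrow> bas x \<in> supp A"
  by (auto simp: supp_iff lookup_single when_def split: if_splits)

lemma supp_mono: "A \<subseteq> B \<Longrightarrow> u \<in> supp A \<Longrightarrow> u \<in> supp B"
  by (auto simp: supp_def)

lemma supp_sum [intro]: "(\<And>i. i \<in> I \<Longrightarrow> f i \<in> supp A) \<Longrightarrow> sum f I \<in> supp A"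
  by (induction I rule: infinite_finite_induct) auto

lemma expand: "u = (\<Sum>x\<in>keys u. pscale (lookup u x) (bas x))"
  by (rule poly_mapping_eqI)
     (simp add: lookup_sum lookup_single when_def in_keys_iff if_distrib cong: if_cong)

text \<open>The scalar multiplication \<open>s\<close> is a parameter because linear extensions take
  values in chains, in scalars and in functions on words.\<close>

definition pext :: "('k::comm_ring_1 \<Rightarrow> 'v \<Rightarrow> 'v) \<Rightarrow> ('a \<Rightarrow> 'v::ab_group_add) \<Rightarrow> ('a \<Rightarrow>\<^sub>0 'k) \<Rightarrow> 'v" where
  "pext s F u = (\<Sum>x\<in>keys u. s (lookup u x) (F x))"

lemma pext_superset:
  assumes "module s" "finite A" "keys u \<subseteq> A"
  shows "pext s F u = (\<Sum>x\<in>A. s (lookup u x) (F x))"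
proof -
  interpret module s by fact
  show ?thesis unfolding pext_def
    by (rule sum.mono_neutral_left) (use assms in \<open>auto simp: in_keys_iff\<close>)
qed

lemma module_hom_pext:
  fixes F :: "'a \<Rightarrow> 'v::ab_group_add" and s :: "'k::comm_ring_1 \<Rightarrow> 'v \<Rightarrow> 'v"
  assumes "module s" shows "module_hom pscale s (pext s F)"
proof -
  interpret s: module s by fact
  interpret module_pair pscale s by unfold_locales
  show ?thesis
  proof unfold_locales
    fix u v :: "'a \<Rightarrow>\<^sub>0 'k"
    have "keys (u + v) \<subseteq> keys u \<union> keys v" by (rule Poly_Mapping.keys_add)
    then show "pext s F (u + v) = pext s F u + pext s F v"
      by (simp add: pext_superset[OF assms, of "keys u \<union> keys v"] lookup_add s.scale_left_distrib sum.distrib)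
  next
    fix c and u :: "'a \<Rightarrow>\<^sub>0 'k"
    have "keys (pscale c u) \<subseteq> keys u" by (auto simp: in_keys_iff)
    then show "pext s F (pscale c u) = s c (pext s F u)"
      by (simp add: pext_superset[OF assms, of "keys u"] s.scale_sum_right)
  qed
qed

lemma pext_bas [simp]: "module s \<Longrightarrow> pext s F (bas x) = F x"
  by (simp add: pext_superset[where A = "{x}"] module.scale_one)

lemma hom_eqI:
  assumes "module_hom pscale s f" "module_hom pscale s g" "u \<in> supp A"
    and "\<And>x. x \<in> A \<Longrightarrow> f (bas x) = g (bas x)"
  shows "f u = g u"
proof -
  interpret f: module_hom pscale s f by fact
  interpret g: module_hom pscale s g by fact
  have "f (\<Sum>x\<in>keys u. pscale (lookup u x) (bas x)) = g (\<Sum>x\<in>keys u. pscale (lookup u x) (bas x))"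
    unfolding f.sum g.sum f.scale g.scale
    using assms(3,4) by (intro sum.cong) (auto simp: supp_def)
  then show ?thesis by (simp add: expand[symmetric])
qed

lemma hom_supp:
  assumes "module_hom pscale pscale f" "u \<in> supp A" "\<And>x. x \<in> A \<Longrightarrow> f (bas x) \<in> supp B"
  shows "f u \<in> supp B"
proof -
  interpret f: module_hom pscale pscale f by fact
  have "f (\<Sum>x\<in>keys u. pscale (lookup u x) (bas x)) \<in> supp B"
    unfolding f.sum f.scale using assms(2,3) by (auto simp: supp_def[of A])
  then show ?thesis by (simp add: expand[symmetric])
qed

abbreviation lmap :: "(('a \<Rightarrow>\<^sub>0 'k::comm_ring_1) \<Rightarrow> ('b \<Rightarrow>\<^sub>0 'k)) \<Rightarrow> bool" where
  "lmap \<equiv> module_hom pscale pscale"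

lemma lmapD: assumes "lmap f"
  shows "f (u + v) = f u + f v" "f (u - v) = f u - f v" "f (- u) = - f u" "f 0 = 0"
    "f (pscale c u) = pscale c (f u)" "f (sum g I) = (\<Sum>i\<in>I. f (g i))"
  using module_hom.add[OF assms] module_hom.diff[OF assms] module_hom.neg[OF assms]
    module_hom.zero[OF assms] module_hom.scale[OF assms] module_hom.sum[OF assms] by auto

lemma lmap_intro:
  assumes "\<And>u v. f (u + v) = f u + f v" "\<And>c u. f (pscale c u) = pscale c (f u)"
  shows "lmap f"
  using assms by unfold_locales auto

lemma lmap_id: "lmap (\<lambda>u. u)" by (rule lmap_intro) auto
lemma lmap_comp: "lmap f \<Longrightarrow> lmap g \<Longrightarrow> lmap (\<lambda>u. f (g u))"
  by (rule lmap_intro) (auto simp: lmapD)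
lemma lmap_add: "lmap f \<Longrightarrow> lmap g \<Longrightarrow> lmap (\<lambda>u. f u + g u)"
  by (rule lmap_intro) (auto simp: lmapD pscale.scale_right_distrib)
lemma lmap_diff: "lmap f \<Longrightarrow> lmap g \<Longrightarrow> lmap (\<lambda>u. f u - g u)"
  by (rule lmap_intro) (auto simp: lmapD pscale.scale_right_diff_distrib)
lemma lmap_pscale: "lmap f \<Longrightarrow> lmap (\<lambda>u. pscale c (f u))"
  by (rule lmap_intro) (auto simp: lmapD pscale.scale_right_distrib mult.commute)
lemma lmap_sum: "(\<And>i. lmap (f i)) \<Longrightarrow> lmap (\<lambda>u. \<Sum>i\<in>I. f i u)"
  by (rule lmap_intro) (auto simp: lmapD sum.distrib pscale.scale_sum_right)
lemma lmap_funpow: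
  fixes f :: "('a \<Rightarrow>\<^sub>0 'k::comm_ring_1) \<Rightarrow> ('a \<Rightarrow>\<^sub>0 'k)"
  shows "lmap f \<Longrightarrow> lmap (f ^^ j)"
proof (induction j)
  case 0
  have "f ^^ 0 = (\<lambda>u. u)" by auto
  then show ?case by (simp only: lmap_id)
next
  case (Suc j)
  have "f ^^ Suc j = (\<lambda>u. f ((f ^^ j) u))" by auto
  then show ?case using lmap_comp[OF Suc.prems Suc.IH[OF Suc.prems]] by (simp only:)
qed

abbreviation plin :: "('a \<Rightarrow> ('b \<Rightarrow>\<^sub>0 'k::comm_ring_1)) \<Rightarrow> ('a \<Rightarrow>\<^sub>0 'k) \<Rightarrow> ('b \<Rightarrow>\<^sub>0 'k)" where
  "plin \<equiv> pext pscale"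

lemma lmap_plin: "lmap (plin F)"
  by (rule module_hom_pext) (rule pscale.module_axioms)

lemma plin_bas [simp]: "plin F (bas x) = F x"
  by (rule pext_bas) (rule pscale.module_axioms)

lemmas plinD [simp] = lmapD[OF lmap_plin]

text \<open>On chains this is the augmentation, used in all degrees and not only in degree 0: it is
  the invariant that detects where exactness fails after averaging.\<close>

definition eps :: "('a \<Rightarrow>\<^sub>0 'k::comm_ring_1) \<Rightarrow> 'k" where
  "eps = pext (*) (\<lambda>_. 1)"

lemma module_times: "module ((*) :: 'k::comm_ring_1 \<Rightarrow> _)"
  by standard (auto simp: algebra_simps)

lemma hom_eps: "module_hom pscale (*) eps"
  unfolding eps_def by (rule module_hom_pext) (rule module_times)

lemma eps_simps [simp]: "eps (u + v) = eps u + eps v" "eps (u - v) = eps u - eps v"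
   "eps (- u) = - eps u" "eps 0 = 0" "eps (pscale c u) = c * eps u" "eps (sum g I) = (\<Sum>i\<in>I. eps (g i))"
  using module_hom.add[OF hom_eps] module_hom.diff[OF hom_eps] module_hom.neg[OF hom_eps]
    module_hom.zero[OF hom_eps] module_hom.scale[OF hom_eps] module_hom.sum[OF hom_eps] by auto

lemma eps_bas [simp]: "eps (bas x) = 1"
  unfolding eps_def by (rule pext_bas) (rule module_times)

lemma hom_eps_comp: assumes "lmap f" shows "module_hom pscale (*) (\<lambda>u. eps (f u) :: 'k::comm_ring_1)"
  unfolding module_hom_iff
  by (simp add: pscale.module_axioms module_times lmapD(1)[OF assms] lmapD(5)[OF assms])

lemma hom_eps_scaled: "module_hom pscale (*) (\<lambda>u. eps u * c :: 'k::comm_ring_1)"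
  by (simp add: module_hom_iff pscale.module_axioms module_times algebra_simps)

section \<open>Words as maps between simplices, and their composition\<close>

definition pmap :: "('a \<Rightarrow> 'b) \<Rightarrow> ('a list \<Rightarrow>\<^sub>0 'k::comm_ring_1) \<Rightarrow> ('b list \<Rightarrow>\<^sub>0 'k)" where
  "pmap f = plin (\<lambda>x. bas (map f x))"

definition cmp :: "('a list \<Rightarrow>\<^sub>0 'k::comm_ring_1) \<Rightarrow> 'k chain \<Rightarrow> ('a list \<Rightarrow>\<^sub>0 'k)" where
  "cmp u w = plin (\<lambda>x. pmap ((!) x) w) u"

definition consp :: "'a \<Rightarrow> ('a list \<Rightarrow>\<^sub>0 'k::comm_ring_1) \<Rightarrow> ('a list \<Rightarrow>\<^sub>0 'k)" where
  "consp a = plin (\<lambda>x. bas (a # x))"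

definition snocp :: "'a \<Rightarrow> ('a list \<Rightarrow>\<^sub>0 'k::comm_ring_1) \<Rightarrow> ('a list \<Rightarrow>\<^sub>0 'k)" where
  "snocp a = plin (\<lambda>x. bas (x @ [a]))"

lemma lmap_pmap: "lmap (pmap f)"
  unfolding pmap_def by (rule lmap_plin)

lemma lmap_basic: "lmap (pmap f)" "lmap (consp a)" "lmap (snocp a)" "lmap (cmp u)" "lmap (\<lambda>u. cmp u w)"
proof -
  show "lmap (pmap f)" "lmap (consp a)" "lmap (snocp a)" "lmap (\<lambda>u. cmp u w)"
    unfolding pmap_def consp_def snocp_def cmp_def by (rule lmap_plin)+
  show "lmap (cmp u)"
  proof (rule lmap_intro)
    fix v w c
    show "cmp u (v + w) = cmp u v + cmp u w"
      by (simp add: cmp_def pext_def[of _ _ u] lmapD[OF lmap_pmap] pscale.scale_right_distrib sum.distrib)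
    show "cmp u (pscale c w) = pscale c (cmp u w)"
      by (simp add: cmp_def pext_def[of _ _ u] lmapD[OF lmap_pmap] pscale.scale_sum_right mult.commute)
  qed
qed

lemmas basicD [simp] = lmapD[OF lmap_basic(1)] lmapD[OF lmap_basic(2)] lmapD[OF lmap_basic(3)]
  lmapD[OF lmap_basic(4)] lmapD[OF lmap_basic(5)]

lemma basic_bas [simp]: "pmap f (bas x) = bas (map f x)" "consp a (bas x) = bas (a # x)"
  "snocp a (bas x) = bas (x @ [a])" "cmp (bas x) w = pmap ((!) x) w"
  by (simp_all add: pmap_def consp_def snocp_def cmp_def)

text \<open>Natural operators from degree n to degree m: a word f of length m + 1 with letters at most n stands
  for the operator induced by the map f from {0..m} to {0..n}. The composite of u followed by w is
  \<open>cmp u w\<close>.\<close>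
definition Op :: "nat \<Rightarrow> nat \<Rightarrow> ('k::comm_ring_1) chain set" where
  "Op n m = supp {x. length x = Suc m \<and> set x \<subseteq> {..n}}"

definition idop :: "nat \<Rightarrow> ('k::comm_ring_1) chain" where
  "idop n = bas [0..<Suc n]"

lemma Op_closed [intro]: "0 \<in> Op n m" "u \<in> Op n m \<Longrightarrow> v \<in> Op n m \<Longrightarrow> u + v \<in> Op n m"
  "u \<in> Op n m \<Longrightarrow> v \<in> Op n m \<Longrightarrow> u - v \<in> Op n m" "u \<in> Op n m \<Longrightarrow> pscale c u \<in> Op n m"
  "(\<And>i. i \<in> I \<Longrightarrow> f i \<in> Op n m) \<Longrightarrow> sum f I \<in> Op n m"
  unfolding Op_def by auto

lemma idop_Op [intro]: "idop n \<in> Op n n"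
  unfolding Op_def idop_def by (rule supp_bas) auto

lemma cmp_Op [intro]:
  assumes "u \<in> Op n m" "w \<in> Op m l" shows "cmp u w \<in> Op n l"
  unfolding Op_def
proof (rule hom_supp[OF lmap_basic(5) assms(1)[unfolded Op_def]])
  fix x assume x: "x \<in> {x. length x = Suc m \<and> set x \<subseteq> {..n}}"
  show "cmp (bas x) w \<in> supp {x. length x = Suc l \<and> set x \<subseteq> {..n}}"
    unfolding basic_bas
  proof (rule hom_supp[OF lmap_basic(1) assms(2)[unfolded Op_def]])
    fix y assume y: "y \<in> {x. length x = Suc l \<and> set x \<subseteq> {..m}}"
    then have "x ! j \<le> n" if "j \<in> set y" for j
      using x that nth_mem[of j x] by fastforce
    then show "pmap ((!) x) (bas y) \<in> supp {x. length x = Suc l \<and> set x \<subseteq> {..n}}"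
      using x y by (auto intro!: supp_bas)
  qed
qed

lemma cmp_idop_right: assumes "w \<in> Op n m" shows "cmp w (idop m) = w"
  by (rule hom_eqI[OF lmap_basic(5) lmap_id assms[unfolded Op_def]])
     (auto simp: idop_def map_nth simp del: upt_Suc intro!: arg_cong[where f = bas] nth_equalityI)

lemma cmp_idop_left: assumes "w \<in> Op n m" shows "cmp (idop n) w = w"
  by (rule hom_eqI[OF lmap_basic(4) lmap_id assms[unfolded Op_def]])
     (auto simp: idop_def simp del: upt_Suc intro!: arg_cong[where f = bas] map_idI)

text \<open>Composition of maps is associative; the degree hypotheses keep all letters within the
  range in which \<open>nth\<close> is determined.\<close>

lemma cmp_assoc: assumes "u \<in> Op n m" "v \<in> Op m l" "w \<in> Op l k"
  shows "cmp (cmp u v) w = cmp u (cmp v w)"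
proof (rule hom_eqI[OF _ _ assms(1)[unfolded Op_def]])
  show "lmap (\<lambda>u. cmp (cmp u v) w)" "lmap (\<lambda>u. cmp u (cmp v w))"
    by (intro lmap_comp[OF lmap_basic(5)] lmap_basic)+
  fix x assume "x \<in> {x. length x = Suc m \<and> set x \<subseteq> {..n}}"
  have "cmp (pmap ((!) x) v) w = pmap ((!) x) (cmp v w)"
  proof (rule hom_eqI[OF _ _ assms(2)[unfolded Op_def]])
    show "lmap (\<lambda>v. cmp (pmap ((!) x) v) w)" "lmap (\<lambda>v. pmap ((!) x) (cmp v w))"
      by (intro lmap_comp[OF lmap_basic(5)] lmap_comp[OF lmap_basic(1)] lmap_basic)+
    fix y assume y: "y \<in> {x. length x = Suc l \<and> set x \<subseteq> {..m}}"
    have "pmap ((!) (map ((!) x) y)) w = pmap ((!) x) (pmap ((!) y) w)"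
    proof (rule hom_eqI[OF _ _ assms(3)[unfolded Op_def]])
      show "lmap (pmap ((!) (map ((!) x) y)))" "lmap (\<lambda>w. pmap ((!) x) (pmap ((!) y) w))"
        by (intro lmap_comp[OF lmap_basic(1)] lmap_basic)+
      fix z assume z: "z \<in> {x. length x = Suc k \<and> set x \<subseteq> {..l}}"
      then have "map ((!) (map ((!) x) y)) z = map ((!) x) (map ((!) y) z)"
        using y by fastforce
      then show "pmap ((!) (map ((!) x) y)) (bas z) = pmap ((!) x) (pmap ((!) y) (bas z))"
        by (simp only: basic_bas)
    qed
    then show "cmp (pmap ((!) x) (bas y)) w = pmap ((!) x) (cmp (bas y) w)" by simp
  qed
  then show "cmp (cmp (bas x) v) w = cmp (bas x) (cmp v w)" by simp
qed

lemma eps_pmap [simp]: "eps (pmap f w) = eps w"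
  by (rule hom_eqI[OF hom_eps_comp[OF lmap_basic(1)] hom_eps, where A = UNIV]) (auto simp: supp_def)

lemma eps_cmp [simp]: "eps (cmp u w) = eps u * eps w"
  by (rule hom_eqI[OF hom_eps_comp[OF lmap_basic(5)] hom_eps_scaled, where A = UNIV]) (auto simp: supp_def)

lemma eps_consp [simp]: "eps (consp a w) = eps w"
  by (rule hom_eqI[OF hom_eps_comp[OF lmap_basic(2)] hom_eps, where A = UNIV]) (auto simp: supp_def)

section \<open>Natural endomorphisms of the complexes of words\<close>

definition natural_op :: "(('k::comm_ring_1) chain \<Rightarrow> 'k chain) \<Rightarrow> bool" where
  "natural_op T \<longleftrightarrow> lmap T \<and> (\<forall>f u. T (pmap f u) = pmap f (T u))"

lemma natural_op_lmap: "natural_op T \<Longrightarrow> lmap T" by (simp add: natural_op_def)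

text \<open>Substitution of letters is composition on the source side, and \<open>T\<close> commutes
  with it. For \<open>w = idop m\<close> this exhibits \<open>T u\<close> as \<open>u\<close>
  followed by the fixed operator \<open>T (idop m)\<close>, the form in which boundaries and
  averages are used later.\<close>

lemma natural_op_cmp: assumes "natural_op T" shows "cmp u (T w) = T (cmp u w)"
proof (rule hom_eqI[where f = "\<lambda>u. cmp u (T w)" and g = "\<lambda>u. T (cmp u w)" and A = UNIV])
  show "lmap (\<lambda>u. cmp u (T w))" by (rule lmap_basic)
  show "lmap (\<lambda>u. T (cmp u w))"
    by (rule lmap_comp[OF natural_op_lmap[OF assms] lmap_basic(5)])
  show "u \<in> supp UNIV" by (simp add: supp_def)
  show "cmp (bas x) (T w) = T (cmp (bas x) w)" for x using assms by (simp add: natural_op_def)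
qed

lemma natural_op_comp: "natural_op S \<Longrightarrow> natural_op T \<Longrightarrow> natural_op (\<lambda>u. S (T u))"
  unfolding natural_op_def using lmap_comp[of S T] by auto
lemma natural_op_add: "natural_op S \<Longrightarrow> natural_op T \<Longrightarrow> natural_op (\<lambda>u. S u + T u)"
  unfolding natural_op_def using lmap_add[of S T] by auto
lemma natural_op_pscale: "natural_op T \<Longrightarrow> natural_op (\<lambda>u. pscale c (T u))"
  unfolding natural_op_def using lmap_pscale[of T] by auto
lemma natural_op_sum: "(\<And>i. natural_op (T i)) \<Longrightarrow> natural_op (\<lambda>u. \<Sum>i\<in>I. T i u)"
  unfolding natural_op_def using lmap_sum[of T] by auto
lemma natural_op_id: "natural_op (\<lambda>u. u)"
  unfolding natural_op_def using lmap_id by auto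
lemma natural_op_funpow:
  fixes T :: "('k::comm_ring_1) chain \<Rightarrow> 'k chain"
  shows "natural_op T \<Longrightarrow> natural_op (T ^^ j)"
proof (induction j)
  case 0
  have "T ^^ 0 = (\<lambda>u. u)" by auto
  then show ?case by (simp only: natural_op_id)
next
  case (Suc j)
  have "T ^^ Suc j = (\<lambda>u. T ((T ^^ j) u))" by auto
  then show ?case using natural_op_comp[OF Suc.prems Suc.IH[OF Suc.prems]] by (simp only:)
qed

lemma natural_op_plin: assumes "\<And>f x. F (map f x) = pmap f (F x)"
  shows "natural_op (plin F)"
  unfolding natural_op_def
proof (intro conjI allI lmap_plin)
  fix f :: "nat \<Rightarrow> nat" and u :: "'a chain"
  show "plin F (pmap f u) = pmap f (plin F u)"
    by (rule hom_eqI[where A = UNIV and u = u, OF lmap_comp[OF lmap_plin lmap_basic(1)] lmap_comp[OF lmap_basic(1) lmap_plin]])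
       (auto simp: supp_def assms)
qed

section \<open>Boundary, rotation and reversal of words\<close>

text \<open>\<open>bdry_word\<close> is the boundary of the augmented ordered chain complex; \<open>bdry\<close> drops the augmentation.\<close>
primrec bdry_word :: "nat list \<Rightarrow> ('k::comm_ring_1) chain" where
  "bdry_word [] = 0"
| "bdry_word (a # x) = bas x - consp a (bdry_word x)"

definition bdry_aug :: "('k::comm_ring_1) chain \<Rightarrow> 'k chain" where
  "bdry_aug = plin bdry_word"

definition bdry :: "('k::comm_ring_1) chain \<Rightarrow> 'k chain" where
  "bdry = plin (\<lambda>x. if length x \<le> 1 then 0 else bdry_word x)"

text \<open>\<open>rot\<close> is the inverse of the cyclic operator.\<close>
definition rot :: "('k::comm_ring_1) chain \<Rightarrow> 'k chain" where
  "rot = plin (\<lambda>x. pscale ((-1) ^ (length x - 1)) (bas (rotate1 x)))"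

definition flip :: "('k::comm_ring_1) chain \<Rightarrow> 'k chain" where
  "flip = plin (\<lambda>x. pscale ((-1) ^ ((length x - 1) * length x div 2)) (bas (rev x)))"

text \<open>Inserts the vertex 0 in all positions but the last. On words this is the odd derivation with
  \<open>v \<mapsto> 0 v\<close>, so its graded commutator with the boundary is a derivation of degree 0, namely the one
  that replaces a letter \<open>v\<close> by the difference of \<open>v\<close> and \<open>0\<close>.\<close>
primrec ins_word :: "nat list \<Rightarrow> ('k::comm_ring_1) chain" where
  "ins_word [] = 0"
| "ins_word (a # x) = bas (0 # a # x) - consp a (ins_word x)"

definition ins :: "('k::comm_ring_1) chain \<Rightarrow> 'k chain" where
  "ins = plin ins_word"

primrec count_word :: "nat list \<Rightarrow> ('k::comm_ring_1) chain" where
  "count_word [] = 0"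
| "count_word (a # x) = bas (a # x) - bas (0 # x) + consp a (count_word x)"

lemma lmap_ops: "lmap bdry_aug" "lmap bdry" "lmap rot" "lmap flip" "lmap ins"
  unfolding bdry_aug_def bdry_def rot_def flip_def ins_def by (rule lmap_plin)+

lemmas opsD [simp] = lmapD[OF lmap_ops(1)] lmapD[OF lmap_ops(2)] lmapD[OF lmap_ops(3)]
  lmapD[OF lmap_ops(4)] lmapD[OF lmap_ops(5)]

lemma ops_bas:
  "bdry_aug (bas x) = bdry_word x" "bdry (bas x) = (if length x \<le> 1 then 0 else bdry_word x)"
  "rot (bas x) = pscale ((-1) ^ (length x - 1)) (bas (rotate1 x))"
  "flip (bas x) = pscale ((-1) ^ ((length x - 1) * length x div 2)) (bas (rev x))"
  "ins (bas x) = ins_word x"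
  by (simp_all add: bdry_aug_def bdry_def rot_def flip_def ins_def)

definition Len :: "nat \<Rightarrow> ('k::comm_ring_1) chain set" where
  "Len l = supp {x. length x = l}"

lemma Op_Len: "u \<in> Op n m \<Longrightarrow> u \<in> Len (Suc m)"
  unfolding Op_def Len_def by (rule supp_mono[rotated]) auto

lemma consp_supp: "u \<in> supp A \<Longrightarrow> (\<And>x. x \<in> A \<Longrightarrow> a # x \<in> B) \<Longrightarrow> consp a u \<in> supp B"
  by (rule hom_supp[OF lmap_basic(2)]) auto

lemma bdry_word_supp: "(bdry_word x :: ('k::comm_ring_1) chain) \<in> supp {y. Suc (length y) = length x \<and> set y \<subseteq> set x}"
proof (induction x)
  case (Cons a x)
  have "(consp a (bdry_word x) :: 'k chain) \<in> supp {y. Suc (length y) = length (a # x) \<and> set y \<subseteq> set (a # x)}"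
    by (rule consp_supp[OF Cons]) auto
  then show ?case by (auto intro!: supp_diff supp_bas)
qed auto

lemma ins_word_supp: "(ins_word x :: ('k::comm_ring_1) chain) \<in> supp {y. length y = Suc (length x) \<and> set y \<subseteq> insert 0 (set x)}"
proof (induction x)
  case (Cons a x)
  have "(consp a (ins_word x) :: 'k chain) \<in> supp {y. length y = Suc (length (a # x)) \<and> set y \<subseteq> insert 0 (set (a # x))}"
    by (rule consp_supp[OF Cons]) auto
  then show ?case by (auto intro!: supp_diff supp_bas)
qed auto

lemma bdry_Op: fixes u :: "('k::comm_ring_1) chain" assumes "u \<in> Op n (Suc m)" shows "bdry u \<in> Op n m"
  unfolding Op_def
proof (rule hom_supp[OF lmap_ops(2) assms[unfolded Op_def]])
  fix x assume "x \<in> {x. length x = Suc (Suc m) \<and> set x \<subseteq> {..n}}"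
  then show "bdry (bas x :: 'k chain) \<in> supp {x. length x = Suc m \<and> set x \<subseteq> {..n}}"
    using bdry_word_supp[of x, where 'k = 'k] by (fastforce simp: ops_bas supp_def)
qed

lemma bdry_Op0: assumes "u \<in> Len (Suc 0)" shows "bdry u = 0"
proof -
  have "lmap (\<lambda>_. 0)" by (rule lmap_intro) auto
  then show ?thesis
    by (rule hom_eqI[OF lmap_ops(2) _ assms[unfolded Len_def]]) (auto simp: ops_bas)
qed

lemma bdry_bdry_aug: assumes "u \<in> Len (Suc (Suc m))" shows "bdry u = bdry_aug u"
  by (rule hom_eqI[OF lmap_ops(2,1) assms[unfolded Len_def]]) (auto simp: ops_bas)

lemma ins_Op: fixes u :: "('k::comm_ring_1) chain" assumes "u \<in> Op n m" shows "ins u \<in> Op n (Suc m)"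
  unfolding Op_def
proof (rule hom_supp[OF lmap_ops(5) assms[unfolded Op_def]])
  fix x assume "x \<in> {x. length x = Suc m \<and> set x \<subseteq> {..n}}"
  then show "ins (bas x :: 'k chain) \<in> supp {x. length x = Suc (Suc m) \<and> set x \<subseteq> {..n}}"
    using ins_word_supp[of x, where 'k = 'k] by (fastforce simp: ops_bas supp_def)
qed

lemma rot_Op: assumes "u \<in> Op n m" shows "rot u \<in> Op n m"
  unfolding Op_def
  by (rule hom_supp[OF lmap_ops(3) assms[unfolded Op_def]]) (auto simp: ops_bas intro!: supp_pscale supp_bas)

lemma flip_Op: assumes "u \<in> Op n m" shows "flip u \<in> Op n m"
  unfolding Op_def
  by (rule hom_supp[OF lmap_ops(4) assms[unfolded Op_def]]) (auto simp: ops_bas intro!: supp_pscale supp_bas)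

lemma rot_Len: assumes "u \<in> Len m" shows "rot u \<in> Len m"
  unfolding Len_def
  by (rule hom_supp[OF lmap_ops(3) assms[unfolded Len_def]]) (auto simp: ops_bas intro!: supp_pscale supp_bas)

lemma flip_Len: assumes "u \<in> Len m" shows "flip u \<in> Len m"
  unfolding Len_def
  by (rule hom_supp[OF lmap_ops(4) assms[unfolded Len_def]]) (auto simp: ops_bas intro!: supp_pscale supp_bas)

lemma Len_closed [intro]: "0 \<in> Len n" "u \<in> Len n \<Longrightarrow> v \<in> Len n \<Longrightarrow> u + v \<in> Len n"
  "u \<in> Len n \<Longrightarrow> v \<in> Len n \<Longrightarrow> u - v \<in> Len n" "u \<in> Len n \<Longrightarrow> pscale c u \<in> Len n"
  "(\<And>i. i \<in> I \<Longrightarrow> f i \<in> Len n) \<Longrightarrow> sum f I \<in> Len n"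
  unfolding Len_def by auto

lemma bas_Len [intro]: "length x = l \<Longrightarrow> bas x \<in> Len l"
  unfolding Len_def by auto

lemma funpow_in: "(\<And>u. u \<in> A \<Longrightarrow> f u \<in> A) \<Longrightarrow> u \<in> A \<Longrightarrow> (f ^^ j) u \<in> A"
  by (induction j) auto

lemma bdry_word_map: "bdry_word (map f x) = pmap f (bdry_word x)"
proof (induction x)
  case (Cons a x)
  have "consp (f a) (pmap f w) = pmap f (consp a w)" for w :: "'a chain"
    by (rule hom_eqI[where A = UNIV and u = w, OF lmap_comp[OF lmap_basic(2) lmap_basic(1)] lmap_comp[OF lmap_basic(1) lmap_basic(2)]])
       (auto simp: supp_def)
  then show ?case using Cons by simp
qed simp

lemma natural_op_ops: "natural_op bdry" "natural_op rot" "natural_op flip"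
  unfolding bdry_def rot_def flip_def
  by (rule natural_op_plin; simp add: bdry_word_map rotate1_map rev_map)+

lemma bdry_aug_consp: "bdry_aug (consp a u) = u - consp a (bdry_aug u)"
  by (rule hom_eqI[where A = UNIV, OF lmap_comp[OF lmap_ops(1) lmap_basic(2)] lmap_diff[OF lmap_id lmap_comp[OF lmap_basic(2) lmap_ops(1)]]])
     (auto simp: supp_def ops_bas)

lemma bdry_aug_bdry_word: fixes x :: "nat list" shows "bdry_aug (bdry_word x) = 0"
  by (induction x) (simp_all add: bdry_aug_consp ops_bas)

lemma bdry_bdry: fixes u :: "('k::comm_ring_1) chain" assumes "u \<in> Len (Suc m)" shows "bdry (bdry u) = 0"
proof -
  have l0: "lmap (\<lambda>_. 0)" by (rule lmap_intro) auto
  show ?thesis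
  proof (rule hom_eqI[OF lmap_comp[OF lmap_ops(2) lmap_ops(2)] l0 assms[unfolded Len_def]])
    fix x :: "nat list" assume x: "x \<in> {x. length x = Suc m}"
    have 1: "(bdry_word x :: 'k chain) \<in> Len m" unfolding Len_def by (rule supp_mono[OF _ bdry_word_supp]) (use x in auto)
    show "bdry (bdry (bas x)) = (0 :: 'k chain)"
    proof (cases "m \<le> 1")
      case True
      then show ?thesis using x 1 by (auto simp: ops_bas le_Suc_eq bdry_Op0)
    next
      case False
      then obtain k where "m = Suc (Suc k)" using that[of "m - 2"] by simp
      then show ?thesis using x 1 by (simp add: ops_bas bdry_bdry_aug bdry_aug_bdry_word)
    qed
  qed
qed

lemma ins_consp: assumes "u \<in> Len m" shows "ins (consp a u) = consp 0 (consp a u) - consp a (ins u)"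
  by (rule hom_eqI[OF lmap_comp[OF lmap_ops(5) lmap_basic(2)]
      lmap_diff[OF lmap_comp[OF lmap_basic(2) lmap_basic(2)] lmap_comp[OF lmap_basic(2) lmap_ops(5)]] assms[unfolded Len_def]])
     (auto simp: ops_bas)

lemma bdry_word_Len: "bdry_word x \<in> Len (length x - 1)"
  unfolding Len_def by (rule supp_mono[OF _ bdry_word_supp]) auto

lemma ins_word_Len: "ins_word x \<in> Len (Suc (length x))"
  unfolding Len_def by (rule supp_mono[OF _ ins_word_supp]) auto

text \<open>Both operations are odd, so the terms that act once on the first letter and once on the
  rest cancel. What remains is \<open>a x - 0 x\<close> together with \<open>a\<close> times the
  same expression for \<open>x\<close>.\<close>

lemma homotopy_list: fixes x :: "nat list" shows "bdry_aug (ins_word x) + ins (bdry_word x) = count_word x"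
proof (induction x)
  case (Cons a x)
  show ?case
    by (simp add: bdry_aug_consp ins_consp[OF bdry_word_Len] ops_bas Cons[symmetric])
qed simp

text \<open>The recursion read from the last letter, where a rotation puts the first one.\<close>

lemma snoc_bdry_word: "bdry_word (x @ [a]) = snocp a (bdry_word x) + pscale ((-1) ^ length x) (bas x)"
proof (induction x)
  case (Cons b x)
  have "consp b (snocp a w) = snocp a (consp b w)" for w :: "'a chain"
    by (rule hom_eqI[where A = UNIV and u = w, OF lmap_comp[OF lmap_basic(2) lmap_basic(3)] lmap_comp[OF lmap_basic(3) lmap_basic(2)]])
       (auto simp: supp_def)
  then show ?case using Cons by simp
qed (simp add: ops_bas)

lemma snoc_ins_word: "ins_word (x @ [a]) = snocp a (ins_word x) + pscale ((-1) ^ length x) (bas (x @ [0, a]))"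
proof (induction x)
  case (Cons b x)
  have "consp b (snocp a w) = snocp a (consp b w)" for w :: "'a chain"
    by (rule hom_eqI[where A = UNIV and u = w, OF lmap_comp[OF lmap_basic(2) lmap_basic(3)] lmap_comp[OF lmap_basic(3) lmap_basic(2)]])
       (auto simp: supp_def)
  then show ?case using Cons by simp
qed (simp add: ops_bas)

lemma rot_consp: assumes "u \<in> Len l" shows "rot (consp a u) = pscale ((-1) ^ l) (snocp a u)"
  by (rule hom_eqI[OF lmap_comp[OF lmap_ops(3) lmap_basic(2)] lmap_pscale[OF lmap_basic(3)] assms[unfolded Len_def]])
     (auto simp: ops_bas)

lemma consp_Len: "u \<in> Len l \<Longrightarrow> consp a u \<in> Len (Suc l)"
  unfolding Len_def by (rule consp_supp) auto

lemma flip_flip: "flip (flip u) = u"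
  by (rule hom_eqI[where A = UNIV, OF lmap_comp[OF lmap_ops(4) lmap_ops(4)] lmap_id])
     (auto simp: supp_def ops_bas power_mult_distrib[symmetric])

text \<open>The dihedral relation: the two rotations contribute the sign (-1)^(2l) = 1, so it holds
  for the signed operators as for the unsigned ones.\<close>

lemma rot_flip_rot: fixes u :: "('k::comm_ring_1) chain" assumes "u \<in> Len (Suc l)" shows "rot (flip (rot u)) = flip u"
proof (rule hom_eqI[OF lmap_comp[OF lmap_ops(3) lmap_comp[OF lmap_ops(4) lmap_ops(3)]] lmap_ops(4) assms[unfolded Len_def]])
  fix x assume "x \<in> {x::nat list. length x = Suc l}"
  then obtain a z where x: "x = a # z" "length z = l" by (cases x) auto
  show "rot (flip (rot (bas x))) = flip (bas x :: 'k chain)"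
    using x by (simp add: ops_bas, simp add: minus_one_power_iff)
qed

lemma rot_pow_bas: "length x = Suc m \<Longrightarrow> (rot ^^ j) (bas x) = pscale (((-1) ^ m) ^ j) (bas (rotate j x))"
  by (induction j) (auto simp: ops_bas mult.commute)

lemma rot_pow: assumes "u \<in> Len (Suc m)" shows "(rot ^^ Suc m) u = u"
proof -
  \<comment> \<open>One of \<open>m\<close> and \<open>m + 1\<close> is even, so a full turn has no
    sign.\<close>
  have "((- 1) ^ m) ^ Suc m = (1::'a)"
    by (cases "even m") simp_all
  then show ?thesis
    by (intro hom_eqI[OF lmap_funpow[OF lmap_ops(3)] lmap_id assms[unfolded Len_def]])
       (auto simp: rot_pow_bas rotate_id simp del: funpow.simps rotate_Suc)
qed

lemma bdry_aug_rev: "bdry_word (rev x) = pscale (- ((-1) ^ length x)) (plin (\<lambda>x. bas (rev x)) (bdry_word x))"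
proof (induction x)
  case (Cons a x)
  have 1: "plin (\<lambda>x. bas (rev x)) (consp a w) = snocp a (plin (\<lambda>x. bas (rev x)) w)" for w :: "'a chain"
    by (rule hom_eqI[where A = UNIV and u = w, OF lmap_comp[OF lmap_plin lmap_basic(2)] lmap_comp[OF lmap_basic(3) lmap_plin]])
       (auto simp: supp_def)
  show ?case by (simp add: snoc_bdry_word Cons 1 pscale.scale_right_diff_distrib)
qed simp

lemma flip_rev: assumes "u \<in> Len l" shows "flip u = pscale ((-1) ^ ((l - 1) * l div 2)) (plin (\<lambda>x. bas (rev x)) u)"
  by (rule hom_eqI[OF lmap_ops(4) lmap_pscale[OF lmap_plin] assms[unfolded Len_def]]) (auto simp: ops_bas)

lemma bdry_flip: fixes u :: "('k::comm_ring_1) chain" assumes "u \<in> Len (Suc l)" shows "bdry (flip u) = flip (bdry u)"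
proof (rule hom_eqI[OF lmap_comp[OF lmap_ops(2) lmap_ops(4)] lmap_comp[OF lmap_ops(4) lmap_ops(2)] assms[unfolded Len_def]])
  fix x :: "nat list" assume "x \<in> {x. length x = Suc l}"
  then have x: "length x = Suc l" by simp
  have d: "(bdry_word x :: 'k chain) \<in> Len l" using bdry_word_Len[of x] x by simp
  show "bdry (flip (bas x)) = flip (bdry (bas x :: 'k chain))"
  proof (cases l)
    case 0 then show ?thesis using x by (simp add: ops_bas)
  next
    case (Suc k)
    \<comment> \<open>Consecutive triangular numbers differ by \<open>l\<close>, which accounts for
      the sign (-1)^l in \<open>bdry_aug_rev\<close>. This is the origin of the triangular sign in
      \<open>flip\<close>.\<close>
    have "l * Suc l div 2 = (l - 1) * l div 2 + l" using Suc by simp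
    then have "(-1::'k) ^ (l * Suc l div 2) * - ((-1) ^ Suc l) = (-1) ^ ((l - 1) * l div 2)"
      by (simp add: power_add mult.assoc power_mult_distrib[symmetric])
    then show ?thesis using x Suc by (simp add: ops_bas bdry_aug_rev flip_rev[OF d])
  qed
qed

lemma eps_ops: "eps (rot u) = (-1) ^ m * eps u" "eps (flip u) = (-1) ^ (m * Suc m div 2) * eps u"
  "eps (bdry u) = (if m > 0 \<and> even m then eps u else 0)" if "u \<in> Len (Suc m)"
proof -
  have h: "module_hom pscale (*) (\<lambda>u. c * eps u :: 'a)" for c
    using hom_eps_scaled[of c] by (simp add: mult.commute)
  show "eps (rot u) = (-1) ^ m * eps u"
    by (rule hom_eqI[OF hom_eps_comp[OF lmap_ops(3)] h that[unfolded Len_def]]) (auto simp: ops_bas)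
  show "eps (flip u) = (-1) ^ (m * Suc m div 2) * eps u"
    by (rule hom_eqI[OF hom_eps_comp[OF lmap_ops(4)] h that[unfolded Len_def]]) (auto simp: ops_bas)
  have e: "eps (bdry_word x) = (if odd (length x) then 1 else 0 :: 'a)" for x
    by (induction x) auto
  have "eps (bdry u) = (if m > 0 \<and> even m then 1 else 0) * eps u"
    by (rule hom_eqI[OF hom_eps_comp[OF lmap_ops(2)] h that[unfolded Len_def]]) (auto simp: ops_bas e)
  then show "eps (bdry u) = (if m > 0 \<and> even m then eps u else 0)" by simp
qed

section \<open>Dihedral averages\<close>

definition cyc_avg :: "nat \<Rightarrow> ('k::field_char_0) chain \<Rightarrow> 'k chain" where
  "cyc_avg m u = pscale (1 / of_nat (Suc m)) (\<Sum>j<Suc m. (rot ^^ j) u)"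

text \<open>For \<open>s * s = 1\<close> this projects to the rotation invariants on which the
  signed reversal acts by \<open>s\<close>.\<close>

definition dih_avg :: "'k \<Rightarrow> nat \<Rightarrow> ('k::field_char_0) chain \<Rightarrow> 'k chain" where
  "dih_avg s m u = pscale (1 / 2) (cyc_avg m u + pscale s (flip (cyc_avg m u)))"

lemma natural_op_cyc_avg: "natural_op (cyc_avg m)"
  unfolding cyc_avg_def by (intro natural_op_pscale natural_op_sum natural_op_funpow natural_op_ops)

lemma natural_op_dih_avg: "natural_op (dih_avg s m)"
  unfolding dih_avg_def by (intro natural_op_pscale natural_op_add natural_op_cyc_avg natural_op_comp[OF natural_op_ops(3) natural_op_cyc_avg])

lemmas avgD [simp] = lmapD[OF natural_op_lmap[OF natural_op_cyc_avg]] lmapD[OF natural_op_lmap[OF natural_op_dih_avg]]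

lemma cyc_avg_Op: "u \<in> Op n m \<Longrightarrow> cyc_avg m u \<in> Op n m"
  unfolding cyc_avg_def by (intro Op_closed funpow_in rot_Op)

lemma cyc_avg_Len: "u \<in> Len l \<Longrightarrow> cyc_avg m u \<in> Len l"
  unfolding cyc_avg_def by (intro Len_closed funpow_in rot_Len)

lemma dih_avg_Op: "u \<in> Op n m \<Longrightarrow> dih_avg s m u \<in> Op n m"
  unfolding dih_avg_def by (intro Op_closed cyc_avg_Op flip_Op)

lemma dih_avg_Len: "u \<in> Len l \<Longrightarrow> dih_avg s m u \<in> Len l"
  unfolding dih_avg_def by (intro Len_closed cyc_avg_Len flip_Len)

lemma bdry_Len: assumes "u \<in> Len (Suc (Suc m))" shows "bdry u \<in> Len (Suc m)"
  unfolding Len_def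
  by (rule hom_supp[OF lmap_ops(2) assms[unfolded Len_def]])
     (use bdry_word_supp in \<open>fastforce simp: ops_bas supp_def\<close>)

lemma ins_Len: assumes "u \<in> Len l" shows "ins u \<in> Len (Suc l)"
  unfolding Len_def
  by (rule hom_supp[OF lmap_ops(5) assms[unfolded Len_def]])
     (use ins_word_supp in \<open>fastforce simp: ops_bas supp_def\<close>)

lemma rot_shift: assumes "u \<in> Len (Suc m)"
  shows "(\<Sum>j<Suc m. (rot ^^ Suc j) u) = (\<Sum>j<Suc m. (rot ^^ j) u)"
proof -
  have "(rot ^^ 0) u + (\<Sum>j<Suc m. (rot ^^ Suc j) u) = (\<Sum>j<Suc (Suc m). (rot ^^ j) u)"
    by (subst (2) sum.lessThan_Suc_shift) simp
  also have "\<dots> = (\<Sum>j<Suc m. (rot ^^ j) u) + u"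
    using rot_pow[OF assms] by (simp only: sum.lessThan_Suc[of _ "Suc m"])
  finally show ?thesis by (simp add: add.commute)
qed

lemma cyc_avg_rot: assumes "u \<in> Len (Suc m)" shows "cyc_avg m (rot u) = cyc_avg m u"
  unfolding cyc_avg_def rot_shift[OF assms, symmetric] by (simp add: funpow_swap1)

lemma rot_cyc_avg: assumes "u \<in> Len (Suc m)" shows "rot (cyc_avg m u) = cyc_avg m u"
proof -
  have "rot (cyc_avg m u) = pscale (1 / of_nat (Suc m)) (\<Sum>j<Suc m. (rot ^^ Suc j) u)"
    unfolding cyc_avg_def by simp
  then show ?thesis unfolding rot_shift[OF assms] cyc_avg_def .
qed

lemma cyc_avg_invariant: assumes "rot u = u" shows "cyc_avg m u = u"
proof -
  have "(rot ^^ j) u = u" for j by (induction j) (auto simp: assms)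
  then have "cyc_avg m u = pscale (1 / of_nat (Suc m)) (\<Sum>j<Suc m. pscale 1 u)" by (simp add: cyc_avg_def)
  also have "\<dots> = u"
    unfolding pscale.scale_sum_left[symmetric] by (simp del: of_nat_Suc)
  finally show ?thesis .
qed

text \<open>All rotations of \<open>u\<close> have the same value, and the coefficients of the
  average add up to 1. In this way maps are shown to descend to the cyclic coinvariants.\<close>

lemma avg_invariant:
  fixes \<Phi> :: "('k::field_char_0) chain \<Rightarrow> 'k chain"
  assumes "lmap \<Phi>" "u \<in> Len (Suc m)" "\<And>w. w \<in> Len (Suc m) \<Longrightarrow> \<Phi> (rot w) = \<Phi> w"
  shows "\<Phi> (cyc_avg m u) = \<Phi> u"
proof -
  have "\<Phi> ((rot ^^ j) u) = \<Phi> u" for j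
  proof (induction j)
    case (Suc j)
    have "(rot ^^ j) u \<in> Len (Suc m)" by (intro funpow_in rot_Len assms)
    then show ?case using Suc assms(3) by simp
  qed simp
  then have "\<Phi> (cyc_avg m u) = pscale (1 / of_nat (Suc m)) (\<Sum>j<Suc m. pscale 1 (\<Phi> u))"
    by (simp add: cyc_avg_def lmapD[OF assms(1)] del: sum.lessThan_Suc)
  also have "\<dots> = \<Phi> u"
    unfolding pscale.scale_sum_left[symmetric] by (simp del: of_nat_Suc)
  finally show ?thesis .
qed

lemma cyc_avg_cyc_avg: assumes "u \<in> Len (Suc m)" shows "cyc_avg m (cyc_avg m u) = cyc_avg m u"
  by (rule cyc_avg_invariant) (rule rot_cyc_avg[OF assms])

lemma cyc_avg_flip: assumes "u \<in> Len (Suc m)" shows "cyc_avg m (flip u) = flip (cyc_avg m u)"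
proof -
  note N = cyc_avg_Len[OF assms]
  have 1: "cyc_avg m (flip (rot w)) = cyc_avg m (flip w)" if "w \<in> Len (Suc m)" for w
    using cyc_avg_rot[OF flip_Len[OF rot_Len[OF that]]] rot_flip_rot[OF that] by simp
  have "cyc_avg m (flip u) = cyc_avg m (flip (cyc_avg m u))"
    by (rule avg_invariant[symmetric, OF lmap_comp[OF natural_op_lmap[OF natural_op_cyc_avg] lmap_ops(4)] assms 1])
  also have "\<dots> = flip (cyc_avg m u)"
    by (rule cyc_avg_invariant) (rule rot_flip_rot[OF N[of m], unfolded rot_cyc_avg[OF assms]])
  finally show ?thesis .
qed

text \<open>For \<open>x = a z\<close> the boundary is \<open>z - a (bdry z)\<close>, while the
  rotated word has boundary \<open>z\<close> plus a signed \<open>(bdry z) a\<close>. The second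
  terms are rotations of each other with matching signs.\<close>

lemma cyc_avg_bdry_rot: assumes "u \<in> Len (Suc (Suc m))" shows "cyc_avg m (bdry (rot u)) = cyc_avg m (bdry u)"
proof (rule hom_eqI[OF lmap_comp[OF natural_op_lmap[OF natural_op_cyc_avg] lmap_comp[OF lmap_ops(2) lmap_ops(3)]]
      lmap_comp[OF natural_op_lmap[OF natural_op_cyc_avg] lmap_ops(2)] assms[unfolded Len_def]])
  fix x :: "nat list" assume "x \<in> {x. length x = Suc (Suc m)}"
  then obtain a z where x: "x = a # z" "length z = Suc m" by (cases x) auto
  define w :: "'a chain" where "w = bdry_word z"
  have w: "w \<in> Len m" using bdry_word_Len[of z] x by (simp add: w_def)
  have "cyc_avg m (snocp a w) = pscale ((-1) ^ m) (cyc_avg m (consp a w))"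
    using cyc_avg_rot[OF consp_Len[OF w], of a] rot_consp[OF w, of a]
    by (metis avgD(5) minus_one_mult_self pscale.scale_one pscale.scale_scale)
  then show "cyc_avg m (bdry (rot (bas x))) = cyc_avg m (bdry (bas x :: 'a chain))"
    using x by (simp add: ops_bas snoc_bdry_word w_def[symmetric] pscale.scale_right_distrib pscale.scale_right_diff_distrib)
qed

text \<open>On a cyclic word the gap after the last letter is the gap before the first one. Omitting
  the last position therefore makes \<open>ins\<close> hit every cyclic gap exactly once.\<close>

lemma cyc_avg_ins_rot: assumes "u \<in> Len (Suc m)" shows "cyc_avg (Suc m) (ins (rot u)) = cyc_avg (Suc m) (ins u)"
proof (rule hom_eqI[OF lmap_comp[OF natural_op_lmap[OF natural_op_cyc_avg] lmap_comp[OF lmap_ops(5) lmap_ops(3)]]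
      lmap_comp[OF natural_op_lmap[OF natural_op_cyc_avg] lmap_ops(5)] assms[unfolded Len_def]])
  fix x :: "nat list" assume "x \<in> {x. length x = Suc m}"
  then obtain a z where x: "x = a # z" "length z = m" by (cases x) auto
  define w :: "'a chain" where "w = ins_word z"
  have w: "w \<in> Len (Suc m)" using ins_word_Len[of z] x by (simp add: w_def)
  have 1: "cyc_avg (Suc m) (snocp a w) = pscale ((-1) ^ Suc m) (cyc_avg (Suc m) (consp a w))"
    using cyc_avg_rot[OF consp_Len[OF w], of a] rot_consp[OF w, of a]
    by (metis avgD(5) minus_one_mult_self pscale.scale_one pscale.scale_scale)
  have l: "(bas (0 # a # z) :: 'a chain) \<in> Len (Suc (Suc m))" using x by auto
  \<comment> \<open>Inserting before the moved letter \<open>a\<close> gives \<open>z 0 a\<close>,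
    which is two rotations away from \<open>0 a z\<close>, and two rotations have no sign.\<close>
  have "rot (rot (bas (0 # a # z))) = (bas (z @ [0, a]) :: 'a chain)"
    using x by (simp add: ops_bas)
  then have "cyc_avg (Suc m) (bas (z @ [0, a])) = cyc_avg (Suc m) (bas (0 # a # z) :: 'a chain)"
    using cyc_avg_rot[OF l] cyc_avg_rot[OF rot_Len[OF l]] by simp
  then show "cyc_avg (Suc m) (ins (rot (bas x))) = cyc_avg (Suc m) (ins (bas x :: 'a chain))"
    using x 1 by (simp add: ops_bas snoc_ins_word w_def[symmetric] pscale.scale_right_distrib pscale.scale_right_diff_distrib)
qed

text \<open>Projections onto models of coinvariants. The last clause says that the boundary
  preserves their kernels; the boundary itself need not commute with the projections, so the
  differential on the images is \<open>bdry\<close> followed by \<open>\<Phi> m\<close>.\<close>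

definition projsys :: "(nat \<Rightarrow> ('k::field_char_0) chain \<Rightarrow> 'k chain) \<Rightarrow> bool" where
  "projsys \<Phi> \<longleftrightarrow> (\<forall>m. natural_op (\<Phi> m)) \<and> (\<forall>n m. \<forall>u\<in>Op n m. \<Phi> m u \<in> Op n m)
     \<and> (\<forall>m. \<forall>u\<in>Len (Suc m). \<Phi> m (\<Phi> m u) = \<Phi> m u)
     \<and> (\<forall>m. \<forall>u\<in>Len (Suc (Suc m)). \<Phi> m (bdry (\<Phi> (Suc m) u)) = \<Phi> m (bdry u))"

lemma projsysD:
  assumes "projsys \<Phi>"
  shows "natural_op (\<Phi> m)" "u \<in> Op n m \<Longrightarrow> \<Phi> m u \<in> Op n m"
    "u \<in> Op n m \<Longrightarrow> \<Phi> m (\<Phi> m u) = \<Phi> m u"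
    "u \<in> Op n (Suc m) \<Longrightarrow> \<Phi> m (bdry (\<Phi> (Suc m) u)) = \<Phi> m (bdry u)"
  using assms unfolding projsys_def by (auto dest: Op_Len)

lemma projsys_id: "projsys (\<lambda>m u. u)"
  by (simp add: projsys_def natural_op_id)

lemma cyc_avg_bdry_cyc_avg: "u \<in> Len (Suc (Suc m)) \<Longrightarrow> cyc_avg m (bdry (cyc_avg (Suc m) u)) = cyc_avg m (bdry u)"
  by (rule avg_invariant[OF lmap_comp[OF natural_op_lmap[OF natural_op_cyc_avg] lmap_ops(2)] _ cyc_avg_bdry_rot])

lemma projsys_cyc_avg: "projsys cyc_avg"
  unfolding projsys_def using natural_op_cyc_avg cyc_avg_Op cyc_avg_cyc_avg cyc_avg_bdry_cyc_avg by blast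

lemma projsys_dih_avg: assumes "s * s = 1" shows "projsys (dih_avg s)"
  unfolding projsys_def
proof (intro conjI allI ballI natural_op_dih_avg dih_avg_Op)
  fix m and u :: "'a chain" assume u: "u \<in> Len (Suc m)"
  have N: "cyc_avg m u \<in> Len (Suc m)" by (rule cyc_avg_Len[OF u])
  have "dih_avg s m (dih_avg s m u) = pscale (1/4) (pscale 2 (cyc_avg m u) + pscale (2 * s) (flip (cyc_avg m u)))"
    using assms by (simp add: dih_avg_def cyc_avg_cyc_avg[OF u] cyc_avg_flip[OF N] flip_flip pscale.scale_right_distrib pscale.scale_left_distrib[of 1 1, simplified]
        pscale.scale_left_distrib[symmetric] algebra_simps)
  then show "dih_avg s m (dih_avg s m u) = dih_avg s m u"
    by (simp add: dih_avg_def pscale.scale_right_distrib)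
next
  fix m and u :: "'a chain" assume u: "u \<in> Len (Suc (Suc m))"
  have N: "cyc_avg (Suc m) u \<in> Len (Suc (Suc m))" by (rule cyc_avg_Len[OF u])
  have 1: "cyc_avg m (bdry (dih_avg s (Suc m) u)) = pscale (1/2) (cyc_avg m (bdry u) + pscale s (flip (cyc_avg m (bdry u))))"
    by (simp add: dih_avg_def cyc_avg_bdry_cyc_avg[OF u] bdry_flip[OF N] cyc_avg_flip[OF bdry_Len[OF N]])
  have B: "cyc_avg m (bdry u) \<in> Len (Suc m)" by (intro cyc_avg_Len bdry_Len u)
  show "dih_avg s m (bdry (dih_avg s (Suc m) u)) = dih_avg s m (bdry u)"
    using assms unfolding dih_avg_def[of s m] 1
    by (simp add: flip_flip pscale.scale_right_distrib pscale.scale_left_distrib[symmetric] algebra_simps)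
qed

section \<open>Exactness of the coinvariants\<close>

definition count_op :: "('k::comm_ring_1) chain \<Rightarrow> 'k chain" where
  "count_op = plin count_word"

lemma lmap_count_op: "lmap count_op" unfolding count_op_def by (rule lmap_plin)

lemmas count_opD [simp] = lmapD[OF lmap_count_op]

definition Weight :: "nat \<Rightarrow> ('k::comm_ring_1) chain set" where
  "Weight r = supp {x. length (filter (\<lambda>a. a \<noteq> 0) x) \<le> r}"

definition zero_word :: "nat \<Rightarrow> ('k::comm_ring_1) chain" where
  "zero_word m = bas (replicate (Suc m) 0)"

lemma zero_word_Op [intro]: "zero_word m \<in> Op n m"
  unfolding Op_def zero_word_def by (rule supp_bas) auto

lemma eps_zero_word [simp]: "eps (zero_word m) = 1" by (simp add: zero_word_def)

lemma homotopy: assumes "w \<in> Op n m"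
  shows "count_op w = bdry (ins w) + (if m = 0 then 0 else ins (bdry w))"
proof -
  have l: "w \<in> Len (Suc m)" by (rule Op_Len[OF assms])
  have "count_op w = bdry_aug (ins w) + ins (bdry_aug w)"
    by (rule hom_eqI[where A = UNIV, OF lmap_count_op lmap_add[OF lmap_comp[OF lmap_ops(1,5)] lmap_comp[OF lmap_ops(5,1)]]])
       (auto simp: supp_def count_op_def ops_bas homotopy_list)
  moreover have "bdry_aug (ins w) = bdry (ins w)" using bdry_bdry_aug[OF ins_Len[OF l]] by simp
  moreover have "ins (bdry_aug w) = (if m = 0 then 0 else ins (bdry w))"
  proof (cases m)
    case 0
    have l0: "lmap (\<lambda>_. 0)" by (rule lmap_intro) auto
    have "ins (bdry_aug w) = 0"
      by (rule hom_eqI[OF lmap_comp[OF lmap_ops(5,1)] l0 l[unfolded Len_def]])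
         (auto simp: 0 length_Suc_conv ops_bas)
    then show ?thesis using 0 by simp
  next
    case (Suc k)
    then show ?thesis using bdry_bdry_aug[of w k] l by simp
  qed
  ultimately show ?thesis by simp
qed

lemma eps_count_op: "eps (count_op w) = 0"
proof -
  have E: "eps (count_word x) = (0::'a)" for x by (induction x) simp_all
  have H: "module_hom pscale (*) (\<lambda>_::'a chain. 0 :: 'a)"
    unfolding module_hom_iff by (simp add: pscale.module_axioms module_times)
  show ?thesis
    by (rule hom_eqI[where A = UNIV, OF hom_eps_comp[OF lmap_count_op] H]) (simp_all add: E supp_def count_op_def)
qed

text \<open>Each nonzero letter contributes \<open>x\<close> minus the word with that letter set to
  0, and zero letters contribute nothing. Up to words with one nonzero letter fewer,
  \<open>x\<close> is thus an eigenvector whose eigenvalue is its number of nonzero letters.\<close>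

lemma count_word_count:
  fixes x :: "nat list"
  shows "pscale (of_nat (length (filter (\<lambda>a. a \<noteq> 0) x))) (bas x) - (count_word x :: ('k::comm_ring_1) chain)
    \<in> supp {y. length y = length x \<and> set y \<subseteq> insert 0 (set x)
         \<and> Suc (length (filter (\<lambda>a. a \<noteq> 0) y)) = length (filter (\<lambda>a. a \<noteq> 0) x)}"
proof (induction x)
  case (Cons a x)
  have "consp a (pscale (of_nat (length (filter (\<lambda>a. a \<noteq> 0) x))) (bas x) - (count_word x :: 'k chain)) \<in>
    supp {y. length y = length (a # x) \<and> set y \<subseteq> insert 0 (set (a # x))
         \<and> Suc (length (filter (\<lambda>a. a \<noteq> 0) y)) = length (filter (\<lambda>a. a \<noteq> 0) (a # x))}" (is "_ \<in> supp ?S")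
    by (rule consp_supp[OF Cons]) auto
  moreover have "a \<noteq> 0 \<Longrightarrow> (bas (0 # x) :: 'k chain) \<in> supp ?S"
    by (rule supp_bas) auto
  moreover have "pscale (of_nat (length (filter (\<lambda>a. a \<noteq> 0) (a # x)))) (bas (a # x)) - count_word (a # x) =
    consp a (pscale (of_nat (length (filter (\<lambda>a. a \<noteq> 0) x))) (bas x) - (count_word x :: 'k chain))
    + (if a = 0 then 0 else bas (0 # x))"
    by (simp add: pscale.scale_left_distrib)
  ultimately show ?case by (simp only:) (rule supp_add, simp_all)
qed simp

text \<open>The coefficient cancels the words with exactly \<open>r + 1\<close> nonzero letters; a
  word with fewer contributes a multiple of itself and words with fewer still. The division uses
  characteristic 0.\<close>

lemma count_op_reduce:
  fixes w :: "('k::field_char_0) chain"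
  assumes "w \<in> Op n m" "w \<in> Weight (Suc r)"
  shows "w - pscale (1 / of_nat (Suc r)) (count_op w) \<in> Op n m \<inter> Weight r"
proof -
  let ?c = "of_nat (Suc r) :: 'k"
  let ?A = "{x::nat list. (length x = Suc m \<and> set x \<subseteq> {..n}) \<and> length (filter (\<lambda>a. a \<noteq> 0) x) \<le> Suc r}"
  let ?B = "{x::nat list. (length x = Suc m \<and> set x \<subseteq> {..n}) \<and> length (filter (\<lambda>a. a \<noteq> 0) x) \<le> r}"
  have w: "w \<in> supp ?A" using assms by (auto simp: Op_def Weight_def supp_def)
  have "w - pscale (1 / ?c) (count_op w) \<in> supp ?B"
  proof (rule hom_supp[OF lmap_diff[OF lmap_id lmap_pscale[OF lmap_count_op]] w])
    fix x assume x: "x \<in> ?A"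
    define l where "l = length (filter (\<lambda>a. a \<noteq> 0) x)"
    have "pscale (of_nat l) (bas x) - (count_word x :: 'k chain) \<in> supp ?B" (is "?u \<in> _")
      by (rule supp_mono[OF _ count_word_count[of x, folded l_def]]) (use x in \<open>auto simp: l_def\<close>)
    then have 1: "pscale (1 / ?c) ?u \<in> supp ?B" by (rule supp_pscale)
    have 2: "pscale (1 - of_nat l / ?c) (bas x :: 'k chain) \<in> supp ?B"
    proof (cases "l = Suc r")
      case False
      then show ?thesis using x by (intro supp_pscale supp_bas) (auto simp: l_def)
    next
      case True
      then show ?thesis by (simp del: of_nat_Suc)
    qed
    have "bas x - pscale (1 / ?c) (count_op (bas x)) = pscale (1 / ?c) ?u + pscale (1 - of_nat l / ?c) (bas x)"
      by (simp add: count_op_def pscale.scale_right_diff_distrib pscale.scale_left_diff_distrib)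
    then show "bas x - pscale (1 / ?c) (count_op (bas x)) \<in> supp ?B" using 1 2 by (simp add: supp_add)
  qed
  then show ?thesis by (auto simp: Op_def Weight_def supp_def)
qed

lemma Weight_0: assumes "w \<in> Op n m" "w \<in> Weight 0" shows "w = pscale (eps w) (zero_word m)"
proof -
  have w: "w \<in> supp {replicate (Suc m) 0}"
  proof -
    have "x = replicate (Suc m) 0" if "length x = Suc m" "length (filter (\<lambda>a. a \<noteq> 0) x) \<le> 0" for x :: "nat list"
      using that by (metis (mono_tags, lifting) filter_empty_conv le_zero_eq length_0_conv replicate_eqI)
    then show ?thesis using assms by (fastforce simp: Op_def Weight_def supp_def)
  qed
  have "lmap (\<lambda>w. pscale (eps w) (zero_word m))"
    by (rule lmap_intro) (auto simp: pscale.scale_left_distrib)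
  then show ?thesis
    by (rule hom_eqI[OF lmap_id _ w]) (auto simp: zero_word_def)
qed

text \<open>Insertion descends to the coinvariants. It is checked for the trivial and the cyclic
  projections; exactness in the dihedral case is deduced from the cyclic one.\<close>

definition projsys_ins :: "(nat \<Rightarrow> ('k::field_char_0) chain \<Rightarrow> 'k chain) \<Rightarrow> bool" where
  "projsys_ins \<Phi> \<longleftrightarrow> (\<forall>m. \<forall>u\<in>Len (Suc m). \<Phi> (Suc m) (ins (\<Phi> m u)) = \<Phi> (Suc m) (ins u))"

lemma projsys_ins_id: "projsys_ins (\<lambda>m u. u)" by (simp add: projsys_ins_def)

lemma projsys_ins_cyc_avg: "projsys_ins cyc_avg"
  unfolding projsys_ins_def
  by (auto intro!: avg_invariant[OF lmap_comp[OF natural_op_lmap[OF natural_op_cyc_avg] lmap_ops(5)] _ cyc_avg_ins_rot])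

text \<open>Induction on the number of nonzero letters. On a cycle the homotopy formula turns
  \<open>count_op w\<close> into a boundary after projection, and subtracting a multiple of it
  lowers the weight while keeping the cycle condition and the augmentation. At weight 0 only a
  multiple of the constant word is left.\<close>

lemma exact_core:
  fixes w :: "('k::field_char_0) chain"
  assumes projsys: "projsys \<Phi>" "projsys_ins \<Phi>"
  shows "w \<in> Op n m \<Longrightarrow> w \<in> Weight r \<Longrightarrow> (m > 0 \<Longrightarrow> \<Phi> (m - 1) (bdry w) = 0) \<Longrightarrow>
    \<exists>v\<in>Op n (Suc m). \<Phi> m w = pscale (eps w) (\<Phi> m (zero_word m)) + \<Phi> m (bdry v)"
proof (induction r arbitrary: w)
  note L = lmapD[OF natural_op_lmap[OF projsysD(1)[OF projsys(1)]]]
  case 0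
  have "\<Phi> m w = pscale (eps w) (\<Phi> m (zero_word m)) + \<Phi> m (bdry 0)"
    using Weight_0[OF 0(1,2)] by (metis L(4,5) add.right_neutral opsD(10))
  then show ?case by (blast intro: Op_closed)
next
  note L = lmapD[OF natural_op_lmap[OF projsysD(1)[OF projsys(1)]]]
  case (Suc r)
  define c where "c = 1 / (of_nat (Suc r) :: 'k)"
  define w' where "w' = w - pscale c (count_op w)"
  have w': "w' \<in> Op n m" "w' \<in> Weight r"
    using count_op_reduce[OF Suc.prems(1,2)] by (auto simp: w'_def c_def)
  \<comment> \<open>After projection \<open>ins\<close> depends only on the projection of its
    argument, so it is enough that \<open>bdry w\<close> vanishes after projection.\<close>
  have D0: "\<Phi> m (if m = 0 then 0 else ins (bdry w)) = 0"
  proof (cases m)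
    case (Suc k)
    have "bdry w \<in> Op n k" using Suc.prems(1) Suc by (intro bdry_Op) simp
    then have "\<Phi> m (ins (bdry w)) = \<Phi> m (ins (\<Phi> k (bdry w)))"
      using projsys(2) Suc by (auto simp: projsys_ins_def dest: Op_Len)
    then show ?thesis using Suc Suc.prems(3) by (simp add: L)
  qed (simp add: L)
  have NCw: "\<Phi> m (count_op w) = \<Phi> m (bdry (ins w))"
    using D0 by (simp add: homotopy[OF Suc.prems(1)] L)
  have "\<Phi> (m - 1) (bdry w') = 0" if m: "m > 0"
  proof -
    obtain k where k: "m = Suc k" using m by (cases m) auto
    have D: "ins w \<in> Op n (Suc m)" by (rule ins_Op[OF Suc.prems(1)])
    have N: "count_op w \<in> Op n m"
      unfolding homotopy[OF Suc.prems(1)] using k Suc.prems(1)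
      by (auto intro!: Op_closed bdry_Op D ins_Op)
    have "\<Phi> k (bdry (count_op w)) = \<Phi> k (bdry (\<Phi> m (count_op w)))"
      using projsysD(4)[OF projsys(1), of "count_op w" n k] N k by simp
    also have "\<dots> = \<Phi> k (bdry (\<Phi> m (bdry (ins w))))" by (simp add: NCw)
    also have "\<dots> = \<Phi> k (bdry (bdry (ins w)))"
      using projsysD(4)[OF projsys(1), of "bdry (ins w)" n k] bdry_Op[OF D] k by simp
    also have "\<dots> = 0" using bdry_bdry[OF Op_Len[OF D]] by (simp add: L)
    finally show ?thesis using Suc.prems(3)[OF m] k by (simp add: w'_def L)
  qed
  from Suc.IH[OF w' this] obtain v where v: "v \<in> Op n (Suc m)"
    "\<Phi> m w' = pscale (eps w') (\<Phi> m (zero_word m)) + \<Phi> m (bdry v)" by blast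
  have "eps w' = eps w" by (simp add: w'_def eps_count_op)
  have "w = w' + pscale c (count_op w)" by (simp add: w'_def)
  then have "\<Phi> m w = \<Phi> m w' + pscale c (\<Phi> m (count_op w))" using L(1,5) by metis
  also have "\<dots> = pscale (eps w) (\<Phi> m (zero_word m)) + \<Phi> m (bdry (v + pscale c (ins w)))"
    by (simp add: v(2) \<open>eps w' = eps w\<close> NCw L add.assoc)
  finally show ?case using v(1) ins_Op[OF Suc.prems(1)] by (blast intro: Op_closed)
qed

lemma exact_core':
  fixes w :: "('k::field_char_0) chain"
  assumes "projsys \<Phi>" "projsys_ins \<Phi>" "w \<in> Op n m" "m > 0 \<Longrightarrow> \<Phi> (m - 1) (bdry w) = 0"
  obtains v where "v \<in> Op n (Suc m)" "\<Phi> m w = pscale (eps w) (\<Phi> m (zero_word m)) + \<Phi> m (bdry v)"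
proof -
  have "w \<in> Weight (Suc m)"
    unfolding Weight_def by (rule supp_mono[OF _ assms(3)[unfolded Op_def]])
      (auto intro: order_trans[OF length_filter_le])
  from exact_core[OF assms(1-3) this assms(4)] that show thesis by blast
qed

text \<open>\<open>crit\<close> marks the degrees in which a class survives; only there must the
  augmentation be assumed to vanish. Cycles and boundaries refer to the projected
  differential.\<close>

definition exact :: "(nat \<Rightarrow> ('k::field_char_0) chain \<Rightarrow> 'k chain) \<Rightarrow> (nat \<Rightarrow> bool) \<Rightarrow> bool" where
  "exact \<Phi> crit \<longleftrightarrow> (\<forall>n m. \<forall>w\<in>Op n m. \<Phi> m w = w \<longrightarrow> (m > 0 \<longrightarrow> \<Phi> (m - 1) (bdry w) = 0) \<longrightarrow>
     (crit m \<longrightarrow> eps w = 0) \<longrightarrow> (\<exists>v\<in>Op n (Suc m). \<Phi> (Suc m) v = v \<and> \<Phi> m (bdry v) = w))"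

lemma bdry_word_replicate: "bdry_word (replicate k 0) = (if odd k then bas (replicate (k - 1) 0) else 0)"
proof (induction k)
  case (Suc k)
  then show ?case by (cases k) auto
qed simp

lemma bdry_zero_word: "bdry (zero_word (Suc m)) = (if even m then 0 else zero_word m)"
  unfolding zero_word_def by (simp only: ops_bas bdry_word_replicate) simp

lemma exact_id: "exact (\<lambda>m u. u) (\<lambda>m. m = 0)"
  unfolding exact_def
proof (intro allI ballI impI)
  fix n m and w :: "'a chain"
  assume w: "w \<in> Op n m" "m > 0 \<longrightarrow> bdry w = 0" "m = 0 \<longrightarrow> eps w = 0"
  obtain v where v: "v \<in> Op n (Suc m)" "w = pscale (eps w) (zero_word m) + bdry v"
    using exact_core'[OF projsys_id projsys_ins_id w(1)] w(2) by blast
  \<comment> \<open>In positive even degrees the boundary has the same augmentation as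
    \<open>w\<close>, so a cycle has augmentation 0; in odd degrees the constant word is itself a
    boundary.\<close>
  show "\<exists>v\<in>Op n (Suc m). v = v \<and> bdry v = w"
  proof (cases "even m")
    case True
    then have "eps w = 0" using w(2,3) eps_ops(3)[OF Op_Len[OF w(1)]] by (cases "m = 0") auto
    then show ?thesis using v by auto
  next
    case False
    then have "bdry (v + pscale (eps w) (zero_word (Suc m))) = pscale (eps w) (zero_word m) + bdry v"
      by (simp add: bdry_zero_word)
    then have "bdry (v + pscale (eps w) (zero_word (Suc m))) = w" using v(2) by (simp only:)
    then show ?thesis using v(1) by (blast intro: Op_closed zero_word_Op)
  qed
qed

text \<open>The augmentation of the averaged identity word, and the origin of the period 4: in odd
  degrees the signs of the rotations cancel, and for \<open>m\<close> even the sign (-1)^(m(m+1)/2)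
  of the reversal is (-1)^(m/2), which either agrees with \<open>s\<close> or cancels the
  identity.\<close>

definition dih_eps :: "'k::field_char_0 \<Rightarrow> nat \<Rightarrow> 'k" where
  "dih_eps s m = (if even m \<and> (-1) ^ (m div 2) = s then 1 else 0)"

lemma eps_cyc_avg: assumes "u \<in> Len (Suc m)" shows "eps (cyc_avg m u) = (if even m then eps u else 0)"
proof -
  have p: "eps ((rot ^^ j) u) = ((-1) ^ m) ^ j * eps u" for j
  proof (induction j)
    case (Suc j)
    have "(rot ^^ j) u \<in> Len (Suc m)" by (intro funpow_in rot_Len assms)
    from eps_ops(1)[OF this] Suc show ?case by simp
  qed simp
  show ?thesis
  proof (cases "even m")
    case True
    then have "eps (cyc_avg m u) = 1 / of_nat (Suc m) * (of_nat (Suc m) * eps u)"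
      by (simp add: cyc_avg_def p del: of_nat_Suc sum.lessThan_Suc)
    then show ?thesis using True by (simp del: of_nat_Suc)
  next
    case False
    have "(\<Sum>j<2 * k. (- 1) ^ j) = (0::'a)" for k by (induction k) auto
    from this[of "Suc m div 2"] False have "(\<Sum>j<Suc m. (- 1) ^ j) = (0::'a)" by simp
    then have "eps (cyc_avg m u) = 0"
      using False by (simp add: cyc_avg_def p sum_distrib_right[symmetric] del: sum.lessThan_Suc)
    then show ?thesis using False by simp
  qed
qed

lemma sq_one: "(s::'k::field_char_0) * s = 1 \<Longrightarrow> s = 1 \<or> s = -1"
  by (metis square_eq_1_iff)

lemma eps_dih_avg: assumes "s * s = 1" "u \<in> Len (Suc m)" shows "eps (dih_avg s m u) = dih_eps s m * eps u"
proof -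
  have "eps (dih_avg s m u) = (if even m then (1 + s * (-1) ^ (m * Suc m div 2)) / 2 * eps u else 0)"
    by (simp add: dih_avg_def eps_cyc_avg assms(2) eps_ops(2)[OF cyc_avg_Len[OF assms(2)]] algebra_simps add_divide_distrib)
  moreover have "(-1) ^ (m * Suc m div 2) = ((-1) ^ (m div 2) :: 'a)" if "even m"
    using that by (auto elim!: evenE simp: minus_one_power_iff)
  ultimately show ?thesis
    using sq_one[OF assms(1)] by (auto simp: dih_eps_def minus_one_power_iff)
qed

lemma dih_avg_cyc_avg: "u \<in> Len (Suc m) \<Longrightarrow> dih_avg s m (cyc_avg m u) = dih_avg s m u"
  by (simp add: dih_avg_def cyc_avg_cyc_avg)

lemma cyc_avg_dih_avg: assumes "u \<in> Len (Suc m)" shows "cyc_avg m (dih_avg s m u) = dih_avg s m u"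
  using assms by (simp add: dih_avg_def cyc_avg_cyc_avg cyc_avg_flip[OF cyc_avg_Len])

text \<open>Reversal commutes with the boundary and with the cyclic average, so the cyclic
  projection of the boundary of an eigenvector is an eigenvector for the same sign, and symmetrizing
  it further changes nothing.\<close>

lemma cyc_avg_bdry_dih_avg: assumes "s * s = 1" "w \<in> Len (Suc (Suc m))" "dih_avg s (Suc m) w = w"
  shows "cyc_avg m (bdry w) = dih_avg s m (bdry w)"
proof -
  note N = cyc_avg_Len[OF assms(2), of "Suc m"]
  have "flip (dih_avg s (Suc m) w) = pscale s (dih_avg s (Suc m) w)"
    using assms(1) by (simp add: dih_avg_def flip_flip pscale.scale_right_distrib add.commute mult.left_commute)
  then have y: "flip w = pscale s w" by (simp add: assms(3))
  have "flip (cyc_avg m (bdry w)) = cyc_avg m (bdry (flip w))"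
    using cyc_avg_flip[OF bdry_Len[OF assms(2)]] bdry_flip[OF assms(2)] by simp
  also have "\<dots> = pscale s (cyc_avg m (bdry w))" by (simp add: y)
  finally show ?thesis
    using assms(1) by (simp add: dih_avg_def pscale.scale_left_distrib[of 1 1, simplified, symmetric]
      mult.assoc pscale.scale_right_distrib pscale.scale_left_distrib[symmetric])
qed

lemma exact_dih_avg: assumes "s * s = 1" shows "exact (dih_avg s) (\<lambda>m. dih_eps s m \<noteq> 0)"
  unfolding exact_def
proof (intro allI ballI impI)
  fix n m w
  assume w: "w \<in> Op n m" "dih_avg s m w = w" "m > 0 \<longrightarrow> dih_avg s (m - 1) (bdry w) = 0" "dih_eps s m \<noteq> 0 \<longrightarrow> eps w = 0"
  note l = Op_Len[OF w(1)]
  \<comment> \<open>In degrees that are not critical an invariant element has augmentation 0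
    automatically, so the exceptional term of the cyclic statement disappears in every
    degree.\<close>
  have e: "eps w = 0" using w(2,4) eps_dih_avg[OF assms l] by auto
  have "cyc_avg (m - 1) (bdry w) = 0" if "m > 0"
    using that w(2,3) cyc_avg_bdry_dih_avg[OF assms, of w "m - 1"] l by simp
  from exact_core'[OF projsys_cyc_avg projsys_ins_cyc_avg w(1) this] obtain v where
    v: "v \<in> Op n (Suc m)" "cyc_avg m w = pscale (eps w) (cyc_avg m (zero_word m)) + cyc_avg m (bdry v)" by blast
  have b: "bdry v \<in> Op n m" by (rule bdry_Op[OF v(1)])
  have "w = dih_avg s m (cyc_avg m w)" using w(2) dih_avg_cyc_avg[OF l] by simp
  also have "\<dots> = dih_avg s m (bdry v)" using v(2) e dih_avg_cyc_avg[OF Op_Len[OF b]] by simp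
  also have "\<dots> = dih_avg s m (bdry (dih_avg s (Suc m) v))" using projsysD(4)[OF projsys_dih_avg[OF assms] v(1)] by simp
  finally have "dih_avg s m (bdry (dih_avg s (Suc m) v)) = w" by simp
  then show "\<exists>v\<in>Op n (Suc m). dih_avg s (Suc m) v = v \<and> dih_avg s m (bdry v) = w"
    using dih_avg_Op[OF v(1)] projsysD(3)[OF projsys_dih_avg[OF assms] v(1)] by blast
qed

section \<open>Acyclic models\<close>

text \<open>\<open>E n (idop n)\<close> is the projection regarded as an operator. An operator fixed
  by composing with it on the left factors through the coinvariants of the source.\<close>

lemma projsys_idem: assumes "projsys E" "w \<in> Op n m"
  shows "cmp (E n (idop n)) (cmp (E n (idop n)) w) = cmp (E n (idop n)) w"
proof -
  have e: "E n (idop n) \<in> Op n n" by (intro projsysD(2)[OF assms(1)] idop_Op)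
  have "cmp (E n (idop n)) (E n (idop n)) = E n (idop n)"
    by (simp add: natural_op_cmp[OF projsysD(1)[OF assms(1)]] cmp_idop_right[OF e] projsysD(3)[OF assms(1) idop_Op])
  then show ?thesis using cmp_assoc[OF e e assms(2)] by simp
qed

lemma bdry_idop: "bdry (idop (Suc n)) \<in> Op (Suc n) n"
  by (intro bdry_Op idop_Op)

lemma bdry_idop_0: "bdry (idop 0) = 0"
  by (rule bdry_Op0[OF Op_Len[OF idop_Op]])

lemma bdry_eq_cmp: "w \<in> Op n (Suc m) \<Longrightarrow> cmp w (bdry (idop (Suc m))) = bdry w"
  by (simp add: natural_op_cmp[OF natural_op_ops(1)] cmp_idop_right)

lemma cmp_bdry_bdry: fixes w :: "('k::comm_ring_1) chain" assumes "w \<in> Op n m"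
  shows "cmp (bdry (idop (Suc (Suc n)))) (cmp (bdry (idop (Suc n))) w) = 0"
proof -
  have "cmp (bdry (idop (Suc (Suc n)))) (bdry (idop (Suc n))) = (0 :: 'k chain)"
    by (simp add: bdry_eq_cmp[OF bdry_idop] bdry_bdry[OF Op_Len[OF idop_Op]])
  then show ?thesis using cmp_assoc[OF bdry_idop bdry_idop assms] by simp
qed

text \<open>Precomposition with the boundary is the differential in the source variable. It respects
  invariance because the boundary descends to the coinvariants, which is the last clause of
  \<open>projsys\<close>.\<close>

lemma projsys_bdry_invariant: assumes "projsys E" "w \<in> Op n m" "cmp (E n (idop n)) w = w"
  shows "cmp (E (Suc n) (idop (Suc n))) (cmp (bdry (idop (Suc n))) w) = cmp (bdry (idop (Suc n))) w"
proof -
  let ?B = "bdry (idop (Suc n))" and ?e = "E n (idop n)" and ?e' = "E (Suc n) (idop (Suc n))"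
  note N = projsysD(1)[OF assms(1)]
  have e: "?e \<in> Op n n" "?e' \<in> Op (Suc n) (Suc n)" by (intro projsysD(2)[OF assms(1)] idop_Op)+
  have Be: "cmp ?B ?e = E n ?B" by (simp add: natural_op_cmp[OF N] cmp_idop_right[OF bdry_idop])
  have EB: "E n ?B \<in> Op (Suc n) n" by (intro projsysD(2)[OF assms(1)] bdry_idop)
  have "cmp ?e' (E n ?B) = E n (bdry ?e')"
    by (simp add: natural_op_cmp[OF N] natural_op_cmp[OF natural_op_ops(1)] cmp_idop_right[OF e(2)])
  also have "\<dots> = E n ?B" by (rule projsysD(4)[OF assms(1) idop_Op])
  finally have 1: "cmp ?e' (E n ?B) = E n ?B" .
  have 2: "cmp (E n ?B) w = cmp ?B w"
    using cmp_assoc[OF bdry_idop e(1) assms(2)] by (simp add: Be assms(3))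
  show ?thesis using cmp_assoc[OF e(2) EB assms(2)] by (simp add: 1 2)
qed

lemma exactD:
  assumes "exact \<Phi> crit" "w \<in> Op n m" "\<Phi> m w = w"
    "m > 0 \<Longrightarrow> \<Phi> (m - 1) (bdry w) = 0" "crit m \<Longrightarrow> eps w = 0"
  obtains v where "v \<in> Op n (Suc m)" "\<Phi> (Suc m) v = v" "\<Phi> m (bdry v) = w"
  using assms unfolding exact_def by blast

text \<open>Any preimage may be averaged on the source side: by naturality this commutes with
  \<open>\<Phi>\<close> and the boundary, and it fixes \<open>w\<close>.\<close>

lemma exact_inv:
  assumes E: "projsys E" and P: "projsys \<Phi>" and ex: "exact \<Phi> crit"
    and w: "w \<in> Op n m" "cmp (E n (idop n)) w = w" "\<Phi> m w = w"
    "m > 0 \<Longrightarrow> \<Phi> (m - 1) (bdry w) = 0" "crit m \<Longrightarrow> eps w = 0"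
  obtains v where "v \<in> Op n (Suc m)" "cmp (E n (idop n)) v = v" "\<Phi> (Suc m) v = v" "\<Phi> m (bdry v) = w"
proof -
  obtain u where u: "u \<in> Op n (Suc m)" "\<Phi> (Suc m) u = u" "\<Phi> m (bdry u) = w"
    by (rule exactD[OF ex w(1,3,4,5)])
  let ?e = "E n (idop n)"
  have e: "?e \<in> Op n n" by (intro projsysD(2)[OF E] idop_Op)
  show thesis
  proof (rule that)
    show "cmp ?e u \<in> Op n (Suc m)" by (rule cmp_Op[OF e u(1)])
    show "cmp ?e (cmp ?e u) = cmp ?e u" by (rule projsys_idem[OF E u(1)])
    show "\<Phi> (Suc m) (cmp ?e u) = cmp ?e u"
      by (simp add: natural_op_cmp[OF projsysD(1)[OF P], symmetric] u(2))
    show "\<Phi> m (bdry (cmp ?e u)) = w"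
      by (simp add: natural_op_cmp[OF projsysD(1)[OF P], symmetric] natural_op_cmp[OF natural_op_ops(1), symmetric] u(3) w(2))
  qed
qed

text \<open>The map \<open>th n\<close> has target degree \<open>n + p - q\<close>; it and the homotopy are absent when
  \<open>n + p < q\<close>.\<close>
lemma acyclic_models:
  assumes E: "projsys E" and P: "projsys \<Phi>" and ex: "exact \<Phi> crit"
    and th: "\<And>n m. n + p = m + q \<Longrightarrow> th n \<in> Op n m"
      "\<And>n m. n + p = m + q \<Longrightarrow> cmp (E n (idop n)) (th n) = th n"
      "\<And>n m. n + p = m + q \<Longrightarrow> \<Phi> m (th n) = th n"
      "\<And>n m. n + p = Suc m + q \<Longrightarrow> \<Phi> m (bdry (th n)) = cmp (bdry (idop n)) (th (n - 1))"
      "\<And>n m. n + p = m + q \<Longrightarrow> crit m \<Longrightarrow> eps (th n) = 0"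
    and c: "\<And>n m. Suc n + p = m + q \<Longrightarrow> crit m \<Longrightarrow> m > 0 \<Longrightarrow> eps (E n (idop n)) = 0"
  shows "\<exists>h. (\<forall>n. n + p < q \<longrightarrow> h n = 0) \<and> (\<forall>n m. n + p = m + q \<longrightarrow> h n \<in> Op n (Suc m)
    \<and> cmp (E n (idop n)) (h n) = h n \<and> \<Phi> (Suc m) (h n) = h n
    \<and> th n = \<Phi> m (bdry (h n)) + cmp (bdry (idop n)) (h (n - 1)))"
proof -
  note L = lmapD[OF natural_op_lmap[OF projsysD(1)[OF P]]]
  \<comment> \<open>\<open>I\<close> describes one component of the homotopy; its equation involving
    the boundary of the identity word ensures that the error in the next degree is a cycle.
    \<open>J\<close> is the homotopy equation between consecutive degrees.\<close>
  define I where "I n x \<longleftrightarrow> (n + p < q \<longrightarrow> x = 0) \<and> (\<forall>m. n + p = m + q \<longrightarrow> x \<in> Op n (Suc m)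
    \<and> cmp (E n (idop n)) x = x \<and> \<Phi> (Suc m) x = x
    \<and> cmp (bdry (idop (Suc n))) (\<Phi> m (bdry x)) = cmp (bdry (idop (Suc n))) (th n)
    \<and> (n = 0 \<longrightarrow> th n = \<Phi> m (bdry x)))" for n x
  define J where "J n x y \<longleftrightarrow> (\<forall>m. Suc n + p = m + q \<longrightarrow> th (Suc n) = \<Phi> m (bdry y) + cmp (bdry (idop (Suc n))) x)" for n x y
  have "\<exists>x. I 0 x"
  proof (cases "p < q")
    case True then show ?thesis by (auto simp: I_def)
  next
    case False
    then obtain m where m: "0 + p = m + q" by (metis add_0 le_Suc_ex add.commute not_less)
    have "\<Phi> (m - 1) (bdry (th 0)) = 0" if "m > 0"
      using th(4)[of 0 "m - 1"] m that by (simp add: bdry_idop_0)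
    from exact_inv[OF E P ex th(1-3)[OF m] this th(5)[OF m]]
    obtain v where "v \<in> Op 0 (Suc m)" "cmp (E 0 (idop 0)) v = v" "\<Phi> (Suc m) v = v" "\<Phi> m (bdry v) = th 0"
      by blast
    then have "I 0 v" using m by (auto simp: I_def)
    then show ?thesis ..
  qed
  moreover have "\<exists>y. I (Suc n) y \<and> J n x y" if x: "I n x" for n x
  proof (cases "Suc n + p < q")
    case True then show ?thesis by (auto simp: I_def J_def)
  next
    case False
    then obtain m where m: "Suc n + p = m + q" by (metis le_Suc_ex add.commute not_less)
    let ?B = "bdry (idop (Suc n))"
    have xO: "x \<in> Op n m" "cmp (E n (idop n)) x = x" "\<Phi> m x = x"
    proof -
      have "x = 0 \<or> (\<exists>m'. m = Suc m' \<and> n + p = m' + q)"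
        using x m unfolding I_def by (cases m) auto
      then have "x \<in> Op n m \<and> cmp (E n (idop n)) x = x \<and> \<Phi> m x = x"
        using x unfolding I_def by (auto simp: L)
      then show "x \<in> Op n m" "cmp (E n (idop n)) x = x" "\<Phi> m x = x" by auto
    qed
    \<comment> \<open>The error left in the next degree. It is a cycle because \<open>th\<close>
      commutes with the differentials and \<open>x\<close> satisfies the boundary equation in
      \<open>I\<close>.\<close>
    define z where "z = th (Suc n) - cmp ?B x"
    have z1: "z \<in> Op (Suc n) m"
      unfolding z_def by (intro Op_closed th(1) m cmp_Op[OF bdry_idop] xO)
    have z2: "cmp (E (Suc n) (idop (Suc n))) z = z"
      unfolding z_def by (simp add: th(2)[OF m] projsys_bdry_invariant[OF E xO(1,2)])
    have z3: "\<Phi> m z = z"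
      unfolding z_def by (simp add: L th(3)[OF m] natural_op_cmp[OF projsysD(1)[OF P], symmetric] xO)
    have z4: "\<Phi> (m - 1) (bdry z) = 0" if pos: "m > 0"
    proof -
      obtain k where k: "m = Suc k" using pos by (cases m) auto
      have nk: "n + p = k + q" using m k by simp
      have "\<Phi> k (bdry z) = cmp ?B (th n) - cmp ?B (\<Phi> k (bdry x))"
        unfolding z_def using th(4)[of "Suc n" k] m k
        by (simp add: L natural_op_cmp[OF projsysD(1)[OF P], symmetric] natural_op_cmp[OF natural_op_ops(1), symmetric])
      also have "\<dots> = 0" using x nk by (simp add: I_def)
      finally show ?thesis using k by simp
    qed
    have z5: "eps z = 0" if "crit m"
    proof (cases "m = 0")
      case True
      then have "x = 0" using x m by (simp add: I_def)
      then show ?thesis using th(5)[OF m that] by (simp add: z_def)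
    next
      case False
      \<comment> \<open>Only the augmentation could obstruct the step in a critical degree. By
        \<open>c\<close> the averaged identity of the preceding source degree has augmentation 0,
        hence so does every operator fixed by it.\<close>
      have "eps (cmp (E n (idop n)) x) = 0" using c[OF m that] False by simp
      then have "eps x = 0" by (simp only: xO(2))
      then show ?thesis using th(5)[OF m that] by (simp add: z_def)
    qed
    obtain y where y: "y \<in> Op (Suc n) (Suc m)" "cmp (E (Suc n) (idop (Suc n))) y = y"
      "\<Phi> (Suc m) y = y" "\<Phi> m (bdry y) = z"
      using exact_inv[OF E P ex z1 z2 z3 z4 z5] by blast
    have "cmp (bdry (idop (Suc (Suc n)))) (\<Phi> m (bdry y)) = cmp (bdry (idop (Suc (Suc n)))) (th (Suc n))"
      by (simp add: y(4) z_def cmp_bdry_bdry[OF xO(1)])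
    then have "I (Suc n) y" using y m by (auto simp: I_def)
    moreover have "J n x y" using m y(4) by (auto simp: J_def z_def)
    ultimately show ?thesis by blast
  qed
  ultimately obtain h where h: "\<And>n. I n (h n)" "\<And>n. J n (h n) (h (Suc n))"
    using dependent_nat_choice[of I J] by metis
  have eq: "th n = \<Phi> m (bdry (h n)) + cmp (bdry (idop n)) (h (n - 1))" if "n + p = m + q" for n m
    using h(1)[of n] h(2)[of "n - 1"] that
    by (cases n) (auto simp: I_def J_def bdry_idop_0)
  show ?thesis
  proof (intro exI conjI allI impI)
    show "h n = 0" if "n + p < q" for n using h(1)[of n] that by (simp add: I_def)
    fix n m assume nm: "n + p = m + q"
    then show "h n \<in> Op n (Suc m)" "cmp (E n (idop n)) (h n) = h n" "\<Phi> (Suc m) (h n) = h n"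
      using h(1)[of n] by (auto simp: I_def)
    show "th n = \<Phi> m (bdry (h n)) + cmp (bdry (idop n)) (h (n - 1))" by (rule eq[OF nm])
  qed
qed

section \<open>Natural chain maps between the dihedral complex and the shifted bar complexes\<close>

lemma eps_idop [simp]: "eps (idop n) = 1" by (simp add: idop_def)

lemma eps_bdry_idop: "eps (bdry (idop n)) = (if n > 0 \<and> even n then 1 else 0)"
  by (simp add: eps_ops(3)[OF Op_Len[OF idop_Op]])

lemma eps_dih_avg_idop: "s * s = 1 \<Longrightarrow> eps (dih_avg s m (idop m)) = dih_eps s m"
  using eps_dih_avg[OF _ Op_Len[OF idop_Op]] by simp

lemma eps_dih_avg_invariant: "s * s = 1 \<Longrightarrow> cmp (dih_avg s n (idop n)) w = w \<Longrightarrow> eps w = dih_eps s n * eps w"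
  by (metis eps_cmp eps_dih_avg_idop)

text \<open>The construction starts in degree \<open>2 * i\<close>, where the sign condition gives
  the averaged operator to degree 0 augmentation 1. Exactness of the complex of words does the rest:
  the only possible obstruction, at \<open>k = 0\<close>, vanishes because the boundary out of the
  odd degree \<open>2 * i + 1\<close> has augmentation 0.\<close>

lemma retraction_exists:
  fixes s :: "'k::field_char_0"
  assumes s: "(-1) ^ i = s"
  shows "\<exists>ph. \<forall>k. ph k \<in> Op (2 * i + k) k \<and> cmp (dih_avg s (2 * i + k) (idop (2 * i + k))) (ph k) = ph k
    \<and> eps (ph k) = (if k = 0 then 1 else 0)
    \<and> bdry (ph (Suc k)) = cmp (bdry (idop (2 * i + Suc k))) (ph k)"
proof -
  have ss: "s * s = 1" using s by (auto simp: minus_one_power_iff split: if_splits)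
  note S = projsys_dih_avg[OF ss]
  let ?E = "\<lambda>n. dih_avg s n (idop n)"
  define I where "I k x \<longleftrightarrow> x \<in> Op (2 * i + k) k \<and> cmp (?E (2 * i + k)) x = x
    \<and> eps x = (if k = 0 then 1 else 0)
    \<and> (k > 0 \<longrightarrow> cmp (bdry (idop (2 * i + Suc k))) (bdry x) = 0)" for k and x :: "'k chain"
  define J where "J k x y \<longleftrightarrow> bdry y = cmp (bdry (idop (2 * i + Suc k))) x" for k and x y :: "'k chain"
  have z: "(bas [0] :: 'k chain) \<in> Op (2 * i) 0" unfolding Op_def by (rule supp_bas) auto
  have "\<exists>x. I 0 x"
  proof
    have c: "dih_eps s (2 * i) = 1" using s by (simp add: dih_eps_def)
    show "I 0 (cmp (?E (2 * i)) (bas [0]))"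
      unfolding I_def using projsys_idem[OF S z] cmp_Op[OF dih_avg_Op[OF idop_Op] z]
      by (simp add: eps_dih_avg_idop[OF ss] c)
  qed
  moreover have "\<exists>y. I (Suc k) y \<and> J k x y" if x: "I k x" for k x
  proof -
    let ?n = "2 * i + k" and ?B = "bdry (idop (Suc (2 * i + k)))"
    define w where "w = cmp ?B x"
    have x': "x \<in> Op ?n k" "cmp (?E ?n) x = x" using x by (auto simp: I_def)
    have w: "w \<in> Op (Suc ?n) k" unfolding w_def by (rule cmp_Op[OF bdry_idop x'(1)])
    have 1: "bdry w = 0" if "k > 0" using x that by (simp add: I_def w_def natural_op_cmp[OF natural_op_ops(1), symmetric])
    have 2: "eps w = 0" using x by (auto simp: w_def I_def eps_bdry_idop)
    obtain y where y: "y \<in> Op (Suc ?n) (Suc k)" "cmp (?E (Suc ?n)) y = y" "bdry y = w"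
      using exact_inv[OF S projsys_id exact_id w projsys_bdry_invariant[OF S x', folded w_def] refl 1 2] by metis
    \<comment> \<open>For \<open>k\<close> even the source degree \<open>2 * i + k + 1\<close> is
      odd, where averaging kills the augmentation; for \<open>k\<close> odd the augmentation of
      \<open>y\<close> equals that of its boundary.\<close>
    have "eps y = 0"
    proof (cases "even k")
      case True
      then show ?thesis using eps_dih_avg_invariant[OF ss y(2)] by (simp add: dih_eps_def)
    next
      case False
      then show ?thesis using eps_ops(3)[OF Op_Len[OF y(1)]] y(3) 2 by simp
    qed
    moreover have "cmp (bdry (idop (Suc (Suc ?n)))) (bdry y) = 0"
      unfolding y(3) w_def by (rule cmp_bdry_bdry[OF x'(1)])
    ultimately have "I (Suc k) y \<and> J k x y" using y by (simp add: I_def J_def w_def)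
    then show ?thesis ..
  qed
  ultimately obtain h where "\<And>n. I n (h n)" "\<And>n. J n (h n) (h (Suc n))"
    using dependent_nat_choice[of I J] by metis
  then show ?thesis unfolding I_def J_def by blast
qed

text \<open>The constant word is the identity word with all vertices collapsed to 0, and collapsing
  remembers only the augmentation.\<close>

lemma dih_avg_zero_word: fixes s :: "'a::field_char_0" assumes "s * s = 1" shows "dih_avg s m (zero_word m) = pscale (dih_eps s m) (zero_word m)"
proof -
  have "pmap (\<lambda>_. 0) u = pscale (eps u) (zero_word m)" if "u \<in> Len (Suc m)" for u :: "'a chain"
  proof -
    have l: "lmap (\<lambda>w. pscale (eps w) (zero_word m))"
      by (rule lmap_intro) (auto simp: pscale.scale_left_distrib)
    show ?thesis
      by (rule hom_eqI[OF lmap_basic(1) l that[unfolded Len_def]]) (auto simp: zero_word_def map_replicate_const)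
  qed
  from this[OF dih_avg_Len[OF Op_Len[OF idop_Op]]]
  have "pmap (\<lambda>_. 0) (dih_avg s m (idop m)) = pscale (dih_eps s m) (zero_word m :: 'a chain)" by (simp add: eps_dih_avg_idop[OF assms])
  moreover have "pmap (\<lambda>_. 0) (dih_avg s m (idop m)) = dih_avg s m (pmap (\<lambda>_. 0) (idop m))"
    using natural_op_dih_avg[of s m] by (simp add: natural_op_def)
  moreover have "pmap (\<lambda>_. 0) (idop m) = (zero_word m :: 'a chain)"
    by (simp add: idop_def zero_word_def map_replicate_const del: upt_Suc)
  ultimately show ?thesis by simp
qed

text \<open>It starts from the constant word of degree \<open>2 * i\<close>, which carries the
  surviving class, and continues by exactness of the dihedral coinvariants. The last clause is the
  chain map equation at the bottom, where the bar complex ends but the dihedral complex does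
  not.\<close>

lemma section_exists:
  fixes s :: "'k::field_char_0"
  assumes s: "(-1) ^ i = s"
  shows "\<exists>ps. \<forall>k. ps k \<in> Op k (k + 2 * i) \<and> dih_avg s (k + 2 * i) (ps k) = ps k
    \<and> eps (ps k) = (if k = 0 then 1 else 0)
    \<and> dih_avg s (k + 2 * i) (bdry (ps (Suc k))) = cmp (bdry (idop (Suc k))) (ps k)
    \<and> (i > 0 \<longrightarrow> dih_avg s (2 * i - 1) (bdry (ps 0)) = 0)"
proof -
  have ss: "s * s = 1" using s by (auto simp: minus_one_power_iff split: if_splits)
  note S = projsys_dih_avg[OF ss]
  define I where "I k x \<longleftrightarrow> x \<in> Op k (k + 2 * i) \<and> dih_avg s (k + 2 * i) x = x
    \<and> eps x = (if k = 0 then 1 else 0)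
    \<and> (k > 0 \<longrightarrow> cmp (bdry (idop (Suc k))) (dih_avg s (k + 2 * i - 1) (bdry x)) = 0)
    \<and> (k = 0 \<longrightarrow> i > 0 \<longrightarrow> dih_avg s (2 * i - 1) (bdry x) = 0)" for k and x :: "'k chain"
  define J where "J k x y \<longleftrightarrow> dih_avg s (k + 2 * i) (bdry y) = cmp (bdry (idop (Suc k))) x" for k and x y :: "'k chain"
  have cs0: "dih_eps s (2 * i) = 1" using s by (simp add: dih_eps_def)
  have "\<exists>x. I 0 x"
  proof
    have "dih_avg s (2 * i - 1) (bdry (zero_word (2 * i))) = 0" if pos: "i > 0"
    proof -
      have "2 * i = Suc (2 * i - 1)" "odd (2 * i - 1)" using pos by auto
      then obtain k where k: "2 * i = Suc k" "odd k" by blast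
      then show ?thesis unfolding k(1) bdry_zero_word by (simp add: dih_avg_zero_word[OF ss] dih_eps_def)
    qed
    then show "I 0 (zero_word (2 * i))" unfolding I_def using dih_avg_zero_word[OF ss, of "2 * i"] cs0 by auto
  qed
  moreover have "\<exists>y. I (Suc k) y \<and> J k x y" if x: "I k x" for k x
  proof -
    let ?m = "k + 2 * i" and ?B = "bdry (idop (Suc k))"
    define w where "w = cmp ?B x"
    have x': "x \<in> Op k ?m" "dih_avg s ?m x = x" using x by (auto simp: I_def)
    have w: "w \<in> Op (Suc k) ?m" unfolding w_def by (rule cmp_Op[OF bdry_idop x'(1)])
    have w2: "dih_avg s ?m w = w" by (simp add: w_def natural_op_cmp[OF natural_op_dih_avg, symmetric] x'(2))
    have w3: "dih_avg s (?m - 1) (bdry w) = 0" if "?m > 0"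
      using x that unfolding w_def I_def
      by (cases k) (simp_all add: natural_op_cmp[OF natural_op_dih_avg, symmetric] natural_op_cmp[OF natural_op_ops(1), symmetric])
    have w4: "eps w = 0" using x by (auto simp: w_def I_def eps_bdry_idop)
    obtain v where v: "v \<in> Op (Suc k) (Suc ?m)" "dih_avg s (Suc ?m) v = v" "dih_avg s ?m (bdry v) = w"
      by (rule exactD[OF exact_dih_avg[OF ss] w w2 w3 w4])
    \<comment> \<open>In a critical degree the augmentation of \<open>v\<close> is not controlled.
      Subtracting a multiple of the constant word makes it 0 without changing the projected
      boundary, since odd degrees are never critical.\<close>
    define y where "y = v - pscale (eps v) (zero_word (Suc ?m))"
    have ev: "eps v = dih_eps s (Suc ?m) * eps v" using eps_dih_avg[OF ss Op_Len[OF v(1)]] v(2) by simp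
    have y1: "y \<in> Op (Suc k) (Suc ?m)" unfolding y_def by (intro Op_closed v zero_word_Op)
    have y2: "dih_avg s (Suc ?m) y = y"
      unfolding y_def avgD dih_avg_zero_word[OF ss] v(2) pscale.scale_scale
      by (simp only: ev[symmetric] mult.commute[of "eps v"])
    have y3: "dih_avg s ?m (bdry y) = w"
    proof (cases "even ?m")
      case True
      then show ?thesis by (simp add: y_def v(3) bdry_zero_word)
    next
      case False
      then show ?thesis by (simp add: y_def v(3) bdry_zero_word dih_avg_zero_word[OF ss] dih_eps_def)
    qed
    have y5: "cmp (bdry (idop (Suc (Suc k)))) (dih_avg s (Suc k + 2 * i - 1) (bdry y)) = 0"
      using y3 cmp_bdry_bdry[OF x'(1)] by (simp add: w_def)
    have "I (Suc k) y \<and> J k x y"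
      using y1 y2 y3 y5 by (simp add: I_def J_def w_def) (simp add: y_def)
    then show ?thesis ..
  qed
  ultimately obtain h where "\<And>n. I n (h n)" "\<And>n. J n (h n) (h (Suc n))"
    using dependent_nat_choice[of I J] by metis
  then show ?thesis unfolding I_def J_def by blast
qed

section \<open>The comparison maps are mutually inverse up to natural homotopy\<close>

definition is_retraction :: "'k::field_char_0 \<Rightarrow> nat \<Rightarrow> (nat \<Rightarrow> 'k chain) \<Rightarrow> bool" where
  "is_retraction s i ph \<longleftrightarrow> (\<forall>k. ph k \<in> Op (2 * i + k) k
    \<and> cmp (dih_avg s (2 * i + k) (idop (2 * i + k))) (ph k) = ph k
    \<and> eps (ph k) = (if k = 0 then 1 else 0)
    \<and> bdry (ph (Suc k)) = cmp (bdry (idop (2 * i + Suc k))) (ph k))"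

definition is_section :: "'k::field_char_0 \<Rightarrow> nat \<Rightarrow> (nat \<Rightarrow> 'k chain) \<Rightarrow> bool" where
  "is_section s i ps \<longleftrightarrow> (\<forall>k. ps k \<in> Op k (k + 2 * i) \<and> dih_avg s (k + 2 * i) (ps k) = ps k
    \<and> eps (ps k) = (if k = 0 then 1 else 0)
    \<and> dih_avg s (k + 2 * i) (bdry (ps (Suc k))) = cmp (bdry (idop (Suc k))) (ps k)
    \<and> (i > 0 \<longrightarrow> dih_avg s (2 * i - 1) (bdry (ps 0)) = 0))"

lemma is_sectionD:
  assumes "is_section s i ps"
  shows "ps k \<in> Op k (k + 2 * i)" "i > 0 \<Longrightarrow> dih_avg s (2 * i - 1) (bdry (ps 0)) = 0"
  using assms unfolding is_section_def by auto

text \<open>Source and target are both bar complexes, so acyclic models apply without projections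
  and only the augmentation in target degree 0 has to be compared. There the composite has
  augmentation 1 exactly if \<open>n = 0\<close>, that is if \<open>i = j\<close>, and then the
  identity cancels it.\<close>

lemma section_retraction_homotopy:
  fixes s :: "'k::field_char_0"
  assumes ss: "s * s = 1" and ps: "is_section s i ps" and ph: "is_retraction s j ph"
  shows "\<exists>h. (\<forall>n. n + 2 * i < 2 * j \<longrightarrow> h n = 0) \<and> (\<forall>n m. n + 2 * i = m + 2 * j \<longrightarrow>
    h n \<in> Op n (Suc m) \<and>
    cmp (ps n) (ph m) - (if i = j then idop n else 0) = bdry (h n) + cmp (bdry (idop n)) (h (n - 1)))"
proof -
  define th where "th n = cmp (ps n) (ph (n + 2 * i - 2 * j)) - (if i = j then idop n else 0)" for n
  have th1: "th n \<in> Op n m" if "n + 2 * i = m + 2 * j" for n m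
  proof -
    have "ps n \<in> Op n (n + 2 * i)" "ph m \<in> Op (n + 2 * i) m"
      using is_sectionD(1)[OF ps] ph that unfolding is_retraction_def by (blast, metis add.commute)
    then show ?thesis using that unfolding th_def by (auto intro!: Op_closed(3) cmp_Op)
  qed
  have th4: "bdry (th n) = cmp (bdry (idop n)) (th (n - 1))" if nm: "n + 2 * i = Suc m + 2 * j" for n m
  proof -
    let ?N = "2 * j + Suc m"
    have N: "n + 2 * i = ?N" using nm by simp
    have psn: "ps n \<in> Op n ?N" using ps unfolding is_section_def N[symmetric] by blast
    have phm: "ph m \<in> Op (2 * j + m) m" "ph (Suc m) \<in> Op ?N (Suc m)"
      "cmp (dih_avg s (2 * j + m) (idop (2 * j + m))) (ph m) = ph m"
      "bdry (ph (Suc m)) = cmp (bdry (idop ?N)) (ph m)"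
      using ph unfolding is_retraction_def by blast+
    have B: "bdry (idop ?N) \<in> Op ?N (2 * j + m)" using bdry_idop[of "2 * j + m"] by simp
    have E: "dih_avg s (2 * j + m) (idop (2 * j + m)) \<in> Op (2 * j + m) (2 * j + m)"
      by (intro dih_avg_Op idop_Op)
    have bp: "bdry (ps n) \<in> Op n (2 * j + m)" using bdry_Op[of "ps n" n "2 * j + m"] psn by simp
    \<comment> \<open>The section is a chain map only after projection, but the retraction absorbs
      the dihedral average on its source side, so the projection can be inserted between the
      two.\<close>
    have 1: "bdry (cmp (ps n) (ph (Suc m))) = cmp (dih_avg s (2 * j + m) (bdry (ps n))) (ph m)"
    proof -
      have "bdry (cmp (ps n) (ph (Suc m))) = cmp (ps n) (cmp (bdry (idop ?N)) (ph m))"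
        by (simp add: natural_op_cmp[OF natural_op_ops(1), symmetric] phm(4))
      also have "\<dots> = cmp (bdry (ps n)) (ph m)"
        using cmp_assoc[OF psn B phm(1)] bdry_eq_cmp[of "ps n" n "2 * j + m"] psn by simp
      also have "\<dots> = cmp (cmp (bdry (ps n)) (dih_avg s (2 * j + m) (idop (2 * j + m)))) (ph m)"
        using cmp_assoc[OF bp E phm(1)] by (simp add: phm(3))
      also have "\<dots> = cmp (dih_avg s (2 * j + m) (bdry (ps n))) (ph m)"
        by (simp add: natural_op_cmp[OF natural_op_dih_avg] cmp_idop_right[OF bp])
      finally show ?thesis .
    qed
    have 2: "cmp (dih_avg s (2 * j + m) (bdry (ps n))) (ph m)
      = cmp (bdry (idop n)) (cmp (ps (n - 1)) (ph m))"
    proof (cases n)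
      case 0
      then have "2 * j + m = 2 * i - 1" "i > 0" using nm by auto
      then have "dih_avg s (2 * j + m) (bdry (ps n)) = 0" using ps 0 unfolding is_section_def by simp
      then show ?thesis by (simp add: 0 bdry_idop_0)
    next
      case (Suc n')
      have m: "2 * j + m = n' + 2 * i" using nm Suc by simp
      have "ps n' \<in> Op n' (2 * j + m)" using ps unfolding is_section_def m by blast
      moreover have "dih_avg s (2 * j + m) (bdry (ps n)) = cmp (bdry (idop n)) (ps n')"
        using ps unfolding is_section_def m Suc by blast
      ultimately show ?thesis using cmp_assoc[OF bdry_idop _ phm(1)] Suc by simp
    qed
    have n1: "n - 1 + 2 * i - 2 * j = m \<or> n = 0" using nm by (cases n) auto
    have n2: "n + 2 * i - 2 * j = Suc m" using nm by simp
    have i1: "bdry (idop n) = cmp (bdry (idop n)) (idop (n - 1) :: 'k chain)"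
      by (cases n) (simp_all add: bdry_idop_0 cmp_idop_right[OF bdry_idop])
    show ?thesis
      using n1 1 2 i1 unfolding th_def n2 by (auto simp: bdry_idop_0)
  qed
  have "eps (th n) = 0" if "n + 2 * i = m + 2 * j" "m = 0" for n m
    using ps ph that unfolding th_def is_section_def is_retraction_def by (auto simp: eps_idop)
  note th5 = this
  have th2: "cmp (idop n) (th n) = th n" if "n + 2 * i = m + 2 * j" for n m
    by (rule cmp_idop_left[OF th1[OF that]])
  have "\<exists>h. (\<forall>n. n + 2 * i < 2 * j \<longrightarrow> h n = 0) \<and> (\<forall>n m. n + 2 * i = m + 2 * j \<longrightarrow> h n \<in> Op n (Suc m)
    \<and> cmp (idop n) (h n) = h n \<and> h n = h n
    \<and> th n = bdry (h n) + cmp (bdry (idop n)) (h (n - 1)))"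
    by (rule acyclic_models[OF projsys_id projsys_id exact_id]) (use th1 th2 th4 th5 in auto)
  then obtain h where h: "\<And>n. n + 2 * i < 2 * j \<Longrightarrow> h n = 0"
    "\<And>n m. n + 2 * i = m + 2 * j \<Longrightarrow> h n \<in> Op n (Suc m)"
    "\<And>n m. n + 2 * i = m + 2 * j \<Longrightarrow> th n = bdry (h n) + cmp (bdry (idop n)) (h (n - 1))"
    by metis
  have "th n = cmp (ps n) (ph m) - (if i = j then idop n else 0)" if "n + 2 * i = m + 2 * j" for n m
    using that by (simp add: th_def)
  then show ?thesis using h by (intro exI[of _ h]) auto
qed

text \<open>Here both sides are dihedral. In a critical degree the averaged identity has
  augmentation 1, and so has exactly one composite, the one that passes through degree 0 of its bar
  complex; the difference thus meets the augmentation condition of acyclic models.\<close>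

lemma retraction_section_homotopy:
  fixes s :: "'k::field_char_0"
  assumes s: "s = (-1) ^ d" "d < 2"
    and ps: "\<And>i. is_section s (2 * i + d) (ps i)" and ph: "\<And>i. is_retraction s (2 * i + d) (ph i)"
  shows "\<exists>h. \<forall>n. h n \<in> Op n (Suc n) \<and> cmp (dih_avg s n (idop n)) (h n) = h n \<and> dih_avg s (Suc n) (h n) = h n
    \<and> dih_avg s n (idop n) - (\<Sum>i | 4 * i + 2 * d \<le> n. cmp (ph i (n - (4 * i + 2 * d))) (ps i (n - (4 * i + 2 * d))))
      = dih_avg s n (bdry (h n)) + cmp (bdry (idop n)) (h (n - 1))"
proof -
  have ss: "s * s = 1" using s(1) by (auto simp: minus_one_power_iff split: if_splits)
  define J where "J n = {i. 4 * i + 2 * d \<le> n}" for n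
  define t where "t n i = cmp (ph i (n - (4 * i + 2 * d))) (ps i (n - (4 * i + 2 * d)))" for n i
  define th where "th n = dih_avg s n (idop n) - (\<Sum>i\<in>J n. t n i)" for n
  have fin: "finite (J n)" for n by (rule finite_subset[of _ "{..n}"]) (auto simp: J_def)
  have P: "ph i k \<in> Op n k" "cmp (dih_avg s n (idop n)) (ph i k) = ph i k"
    "bdry (ph i (Suc k)) = cmp (bdry (idop (Suc n))) (ph i k)"
    "ps i k \<in> Op k n" "dih_avg s n (ps i k) = ps i k"
    if "n = k + (4 * i + 2 * d)" for n i k
  proof -
    have n: "n = 2 * (2 * i + d) + k" "n = k + 2 * (2 * i + d)" "Suc n = 2 * (2 * i + d) + Suc k"
      using that by auto
    show "ph i k \<in> Op n k" "cmp (dih_avg s n (idop n)) (ph i k) = ph i k"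
      using ph[of i] unfolding is_retraction_def n(1) by blast+
    show "bdry (ph i (Suc k)) = cmp (bdry (idop (Suc n))) (ph i k)"
      using ph[of i] unfolding is_retraction_def n(3) by blast
    show "ps i k \<in> Op k n" "dih_avg s n (ps i k) = ps i k"
      using ps[of i] unfolding is_section_def n(2) by blast+
  qed
  have P': "dih_avg s n (bdry (ps i (Suc k))) = cmp (bdry (idop (Suc k))) (ps i k)"
    if "n = k + (4 * i + 2 * d)" for n i k
  proof -
    have n: "n = k + 2 * (2 * i + d)" using that by auto
    show ?thesis using ps[of i] unfolding is_section_def n by blast
  qed
  have P0: "dih_avg s (4 * i + 2 * d - 1) (bdry (ps i 0)) = 0" if "4 * i + 2 * d > 0" for i
  proof -
    have n: "4 * i + 2 * d = 2 * (2 * i + d)" "2 * i + d > 0" using that by auto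
    show ?thesis using is_sectionD(2)[OF ps n(2)] unfolding n(1) .
  qed
  have e: "dih_avg s n (idop n) \<in> Op n n" for n by (intro dih_avg_Op idop_Op)
  have dih_el: "cmp (dih_avg s n (idop n)) (dih_avg s n (idop n)) = dih_avg s n (idop n)" for n
    by (simp add: natural_op_cmp[OF natural_op_dih_avg] cmp_idop_right[OF e] projsysD(3)[OF projsys_dih_avg[OF ss] idop_Op])
  have t: "t n i \<in> Op n n" "cmp (dih_avg s n (idop n)) (t n i) = t n i" "dih_avg s n (t n i) = t n i" if "i \<in> J n" for n i
  proof -
    define k where "k = n - (4 * i + 2 * d)"
    have n: "n = k + (4 * i + 2 * d)" using that by (auto simp: J_def k_def)
    note Q = P[OF n]
    show "t n i \<in> Op n n" unfolding t_def k_def[symmetric] by (rule cmp_Op[OF Q(1,4)])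
    show "cmp (dih_avg s n (idop n)) (t n i) = t n i"
      unfolding t_def k_def[symmetric] using cmp_assoc[OF e Q(1,4)] Q(2) by simp
    show "dih_avg s n (t n i) = t n i"
      unfolding t_def k_def[symmetric] by (simp add: natural_op_cmp[OF natural_op_dih_avg, symmetric] Q(5))
  qed
  have th1: "th n \<in> Op n n" "cmp (dih_avg s n (idop n)) (th n) = th n" "dih_avg s n (th n) = th n" for n
    unfolding th_def using t
    by (auto intro!: Op_closed e simp: dih_el projsysD(3)[OF projsys_dih_avg[OF ss] idop_Op])
  have th4: "dih_avg s m (bdry (th (Suc m))) = cmp (bdry (idop (Suc m))) (th m)" for m
  proof -
    have 1: "dih_avg s m (bdry (dih_avg s (Suc m) (idop (Suc m)))) = cmp (bdry (idop (Suc m))) (dih_avg s m (idop m))"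
      by (simp add: natural_op_cmp[OF natural_op_dih_avg] cmp_idop_right[OF bdry_idop] projsysD(4)[OF projsys_dih_avg[OF ss] idop_Op])
    have 2: "dih_avg s m (bdry (t (Suc m) i)) = cmp (bdry (idop (Suc m))) (t m i)" if "i \<in> J m" for i
    proof -
      define k where "k = m - (4 * i + 2 * d)"
      have m: "m = k + (4 * i + 2 * d)" "Suc m = Suc k + (4 * i + 2 * d)"
        and k: "Suc m - (4 * i + 2 * d) = Suc k"
        using that by (auto simp: J_def k_def)
      note Q = P[OF m(1)] and Q' = P[OF m(2)]
      have "dih_avg s m (bdry (t (Suc m) i)) = cmp (ph i (Suc k)) (cmp (bdry (idop (Suc k))) (ps i k))"
        unfolding t_def k by (simp add: natural_op_cmp[OF natural_op_dih_avg, symmetric] natural_op_cmp[OF natural_op_ops(1), symmetric] P'[OF m(1)])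
      also have "\<dots> = cmp (bdry (ph i (Suc k))) (ps i k)"
        using cmp_assoc[OF Q'(1) bdry_idop Q(4)] bdry_eq_cmp[OF Q'(1)] by simp
      also have "\<dots> = cmp (bdry (idop (Suc m))) (t m i)"
        using cmp_assoc[OF bdry_idop Q(1,4)] unfolding t_def k_def[symmetric] Q(3) by simp
      finally show ?thesis .
    qed
    \<comment> \<open>A summand that first appears in degree \<open>m + 1\<close> ends with the
      bottom of its section, whose projected boundary vanishes, so the changing range of summation
      does no harm.\<close>
    have "dih_avg s m (bdry (t (Suc m) i)) = 0" if i: "i \<in> J (Suc m) - J m" for i
    proof -
      have "4 * i + 2 * d = Suc m" using i by (auto simp: J_def)
      then have "dih_avg s m (bdry (ps i 0)) = 0" "Suc m - (4 * i + 2 * d) = 0"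
        using P0[of i] by simp_all
      then show ?thesis
        unfolding t_def by (simp add: natural_op_cmp[OF natural_op_dih_avg, symmetric] natural_op_cmp[OF natural_op_ops(1), symmetric])
    qed
    then have "(\<Sum>i\<in>J (Suc m). dih_avg s m (bdry (t (Suc m) i))) = (\<Sum>i\<in>J m. dih_avg s m (bdry (t (Suc m) i)))"
      by (intro sum.mono_neutral_right fin) (auto simp: J_def)
    also have "\<dots> = cmp (bdry (idop (Suc m))) (\<Sum>i\<in>J m. t m i)" using 2 by simp
    finally show ?thesis unfolding th_def by (simp add: 1)
  qed
  have th5: "eps (th n) = 0" if "dih_eps s n \<noteq> 0" for n
  proof -
    have n: "even n" "(-1) ^ (n div 2) = s" "dih_eps s n = 1" using that by (auto simp: dih_eps_def split: if_splits)
    define q where "q = n div 2"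
    \<comment> \<open>Half a critical degree has the parity of \<open>d\<close>, which determines
      the summand whose shift is exactly \<open>n\<close>.\<close>
    have "even q \<longleftrightarrow> even d" using n(2) s(1) by (auto simp: q_def minus_one_power_iff split: if_splits)
    then have "q mod 2 = d" using s(2) by presburger
    then obtain i0 where i0: "q = 2 * i0 + d" by (metis mult_div_mod_eq)
    then have n': "n = 4 * i0 + 2 * d" using n(1) by (auto simp: q_def elim!: evenE)
    have "eps (t n i) = (if i = i0 then 1 else 0)" if "i \<in> J n" for i
    proof -
      have "n - (4 * i + 2 * d) = 0 \<longleftrightarrow> i = i0" using that by (auto simp: J_def n')
      then show ?thesis using ps[of i] ph[of i] unfolding t_def is_section_def is_retraction_def by simp
    qed
    then have "(\<Sum>i\<in>J n. eps (t n i)) = 1" using fin by (simp add: J_def n')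
    then show ?thesis unfolding th_def by (simp add: eps_dih_avg_idop[OF ss] n(3))
  qed
  \<comment> \<open>The degree below a critical one is odd.\<close>
  have c: "eps (dih_avg s n (idop n)) = 0" if "dih_eps s (Suc n) \<noteq> 0" for n
    using that by (auto simp: eps_dih_avg_idop[OF ss] dih_eps_def split: if_splits)
  have "\<exists>h. (\<forall>n. n + 0 < 0 \<longrightarrow> h n = 0) \<and> (\<forall>n m. n + 0 = m + 0 \<longrightarrow> h n \<in> Op n (Suc m)
    \<and> cmp (dih_avg s n (idop n)) (h n) = h n \<and> dih_avg s (Suc m) (h n) = h n
    \<and> th n = dih_avg s m (bdry (h n)) + cmp (bdry (idop n)) (h (n - 1)))"
    by (rule acyclic_models[OF projsys_dih_avg[OF ss] projsys_dih_avg[OF ss] exact_dih_avg[OF ss]])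
       (use th1 th4 th5 c in auto)
  then show ?thesis unfolding th_def J_def t_def by auto
qed

section \<open>Symmetric systems\<close>

interpretation sc: module "sc :: 'k::comm_ring_1 \<Rightarrow> ('a \<Rightarrow> 'k) \<Rightarrow> _"
  by standard (auto simp: sc_def plus_fun_def algebra_simps)

text \<open>The vertices n, 0, 1, ..., n-1 have as edges the inverse of the full product and then
  the first n-1 inputs: up to sign this is the cyclic operator.\<close>

definition cyc_op :: "nat \<Rightarrow> ('k::comm_ring_1) chain" where
  "cyc_op n = pscale ((-1) ^ n) (bas (n # [0..<n]))"

lemma cyc_op_Op: "cyc_op n \<in> Op n n"
  unfolding Op_def cyc_op_def by (intro supp_pscale supp_bas) auto

lemma rot_cyc_op: "rot (cyc_op n) = idop n"
  by (simp add: cyc_op_def idop_def ops_bas)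

lemma cmp_rot_cyc_op: assumes "w \<in> Op n m" shows "cmp (rot w) (cyc_op m) = w"
proof -
  have n0: "[0..<Suc m] = 0 # [1..<Suc m]" by (simp add: upt_conv_Cons)
  have m1: "map ((!) (rotate1 [0..<Suc m])) (m # [0..<m]) = [0..<Suc m]"
    unfolding n0 by (rule nth_equalityI) (auto simp: nth_append nth_Cons split: nat.splits)
  have r: "cmp (rot (idop m)) (cyc_op m) = idop m"
    by (simp only: idop_def ops_bas basicD basic_bas cyc_op_def m1) (simp add: power_mult_distrib[symmetric] del: upt_Suc)
  have "rot w = cmp w (rot (idop m))"
    by (simp add: natural_op_cmp[OF natural_op_ops(2)] cmp_idop_right[OF assms])
  then show ?thesis
    using cmp_assoc[OF assms rot_Op[OF idop_Op] cyc_op_Op] by (simp add: r cmp_idop_right[OF assms])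
qed

text \<open>The interface between words and tensors: \<open>F n\<close> are the formal sums,
  \<open>R n\<close> the relations. The action is strictly linear, but it respects composition, and
  agrees with the given boundary, cyclic operator and involution, only modulo \<open>R\<close>,
  because Sweedler sums represent tensors non-uniquely.\<close>

locale symmetric_system =
  fixes F R :: "nat \<Rightarrow> ('a \<Rightarrow> 'k::field_char_0) set"
    and act :: "'k chain \<Rightarrow> ('a \<Rightarrow> 'k) \<Rightarrow> ('a \<Rightarrow> 'k)"
    and bH tH yH :: "('a \<Rightarrow> 'k) \<Rightarrow> ('a \<Rightarrow> 'k)"
  assumes F0: "0 \<in> F n" and F_add: "f \<in> F n \<Longrightarrow> g \<in> F n \<Longrightarrow> f + g \<in> F n"
    and F_sc: "f \<in> F n \<Longrightarrow> sc c f \<in> F n"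
    and R0: "0 \<in> R n" and R_add: "f \<in> R n \<Longrightarrow> g \<in> R n \<Longrightarrow> f + g \<in> R n"
    and R_sc: "f \<in> R n \<Longrightarrow> sc c f \<in> R n" and R_F: "R n \<subseteq> F n"
    and act_F: "u \<in> Op n m \<Longrightarrow> f \<in> F n \<Longrightarrow> act u f \<in> F m"
    and act_R: "u \<in> Op n m \<Longrightarrow> f \<in> R n \<Longrightarrow> act u f \<in> R m"
    and act_add: "f \<in> F n \<Longrightarrow> g \<in> F n \<Longrightarrow> act u (f + g) = act u f + act u g"
    and act_sc: "f \<in> F n \<Longrightarrow> act u (sc c f) = sc c (act u f)"
    and act_uadd: "act (u + v) f = act u f + act v f"
    and act_usc: "act (pscale c u) f = sc c (act u f)"
    and act_cmp: "u \<in> Op n m \<Longrightarrow> v \<in> Op m l \<Longrightarrow> f \<in> F n \<Longrightarrow> act (cmp u v) f - act v (act u f) \<in> R l"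
    and act_idop: "f \<in> F n \<Longrightarrow> act (idop n) f - f \<in> R n"
    and bH: "f \<in> F (Suc n) \<Longrightarrow> bH f - act (bdry (idop (Suc n))) f \<in> R n"
    and tH: "f \<in> F n \<Longrightarrow> tH f - act (cyc_op n) f \<in> R n"
    and yH: "f \<in> F n \<Longrightarrow> yH f - act (flip (idop n)) f \<in> R n"
begin

definition eq :: "nat \<Rightarrow> ('a \<Rightarrow> 'k) \<Rightarrow> ('a \<Rightarrow> 'k) \<Rightarrow> bool" where
  "eq n f g \<longleftrightarrow> f \<in> F n \<and> g \<in> F n \<and> f - g \<in> R n"

lemma sc_m1: "sc (-1) (f :: 'a \<Rightarrow> 'k) = - f" by (simp add: sc_def fun_eq_iff)
lemma F_neg: "f \<in> F n \<Longrightarrow> - f \<in> F n" using F_sc[of f n "-1"] by (simp add: sc_m1)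
lemma R_neg: "f \<in> R n \<Longrightarrow> - f \<in> R n" using R_sc[of f n "-1"] by (simp add: sc_m1)
lemma F_diff: "f \<in> F n \<Longrightarrow> g \<in> F n \<Longrightarrow> f - g \<in> F n"
  using F_add[OF _ F_neg] by (metis diff_conv_add_uminus)
lemma F_sum: "(\<And>i. i \<in> I \<Longrightarrow> f i \<in> F n) \<Longrightarrow> sum f I \<in> F n"
  by (induction I rule: infinite_finite_induct) (auto intro: F0 F_add)

lemma eq_refl: "f \<in> F n \<Longrightarrow> eq n f f" by (simp add: eq_def R0)
lemma eq_sym: "eq n f g \<Longrightarrow> eq n g f"
  using R_neg[of "f - g"] by (auto simp: eq_def)
lemma eq_trans [trans]: "eq n f g \<Longrightarrow> eq n g h \<Longrightarrow> eq n f h"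
  using R_add[of "f - g" n "g - h"] by (auto simp: eq_def)
lemma eq_eq_trans [trans]: "f = g \<Longrightarrow> eq n g h \<Longrightarrow> eq n f h" "eq n f g \<Longrightarrow> g = h \<Longrightarrow> eq n f h"
  by auto
lemma eq_F: "eq n f g \<Longrightarrow> f \<in> F n" "eq n f g \<Longrightarrow> g \<in> F n" by (auto simp: eq_def)
lemma eq_add: "eq n f g \<Longrightarrow> eq n f' g' \<Longrightarrow> eq n (f + f') (g + g')"
  using R_add[of "f - g" n "f' - g'"] by (auto simp: eq_def algebra_simps intro: F_add)
lemma eq_sc: "eq n f g \<Longrightarrow> eq n (sc c f) (sc c g)"
  using R_sc[of "f - g" n c] by (auto simp: eq_def sc.scale_right_diff_distrib intro: F_sc)
lemma eq_diff: "eq n f g \<Longrightarrow> eq n f' g' \<Longrightarrow> eq n (f - f') (g - g')"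
  using eq_add[OF _ eq_sc[of n f' g' "-1"]] by (metis diff_conv_add_uminus sc_m1)
lemma eq_sum: "(\<And>i. i \<in> I \<Longrightarrow> eq n (f i) (g i)) \<Longrightarrow> eq n (sum f I) (sum g I)"
  by (induction I rule: infinite_finite_induct) (auto intro: eq_refl F0 eq_add)
lemma eq_0: "eq n f 0 \<longleftrightarrow> f \<in> R n" using R_F by (auto simp: eq_def F0)
lemma eq_diff_0: "f \<in> F n \<Longrightarrow> g \<in> F n \<Longrightarrow> eq n f g \<longleftrightarrow> f - g \<in> R n" by (auto simp: eq_def)

lemma act_0: "act u 0 = 0" using act_sc[OF F0, of u 0] by simp
lemma act_u0: "act 0 f = 0" using act_usc[of 0 0 f] by simp
lemma act_diff: "f \<in> F n \<Longrightarrow> g \<in> F n \<Longrightarrow> act u (f - g) = act u f - act u g"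
  using act_add[OF _ F_neg, of f n g u] act_sc[of g n u "-1"] by (simp add: sc_m1)
lemma act_udiff: "act (u - v) f = act u f - act v f"
  using act_uadd[of "u - v" v f] by (simp add: algebra_simps)
lemma act_usum: "act (sum u I) f = (\<Sum>i\<in>I. act (u i) f)"
  by (induction I rule: infinite_finite_induct) (auto simp: act_u0 act_uadd)
lemma act_sum: "(\<And>i. i \<in> I \<Longrightarrow> f i \<in> F n) \<Longrightarrow> act u (sum f I) = (\<Sum>i\<in>I. act u (f i))"
  by (induction I rule: infinite_finite_induct) (auto simp: act_0 act_add[where n = n] F_sum)

lemma act_eq: "u \<in> Op n m \<Longrightarrow> eq n f g \<Longrightarrow> eq m (act u f) (act u g)"
  using act_R[of u n m "f - g"] act_F[of u n m] act_diff[of f n g u] by (simp add: eq_def)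

lemma cmp_eq: "u \<in> Op n m \<Longrightarrow> v \<in> Op m l \<Longrightarrow> f \<in> F n \<Longrightarrow> eq l (act v (act u f)) (act (cmp u v) f)"
  by (rule eq_sym) (simp add: eq_def act_cmp act_F[OF _ act_F] act_F[OF cmp_Op])

lemma idop_eq: "f \<in> F n \<Longrightarrow> eq n (act (idop n) f) f"
  by (simp add: eq_def act_idop act_F[OF idop_Op])

lemma bH_eq: assumes "f \<in> F (Suc n)" shows "eq n (bH f) (act (bdry (idop (Suc n))) f)"
proof -
  have "act (bdry (idop (Suc n))) f \<in> F n" by (rule act_F[OF bdry_idop assms])
  moreover from F_add[OF subsetD[OF R_F bH[OF assms]] this] have "bH f \<in> F n" by simp
  ultimately show ?thesis using bH[OF assms] by (simp add: eq_def)
qed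

lemma tH_eq: assumes "f \<in> F n" shows "eq n (tH f) (act (cyc_op n) f)"
proof -
  have "act (cyc_op n) f \<in> F n" by (rule act_F[OF cyc_op_Op assms])
  moreover from F_add[OF subsetD[OF R_F tH[OF assms]] this] have "tH f \<in> F n" by simp
  ultimately show ?thesis using tH[OF assms] by (simp add: eq_def)
qed

lemma yH_eq: assumes "f \<in> F n" shows "eq n (yH f) (act (flip (idop n)) f)"
proof -
  have "act (flip (idop n)) f \<in> F n" by (intro act_F[OF _ assms] flip_Op idop_Op)
  moreover from F_add[OF subsetD[OF R_F yH[OF assms]] this] have "yH f \<in> F n" by simp
  ultimately show ?thesis using yH[OF assms] by (simp add: eq_def)
qed

text \<open>\<open>T u\<close> is \<open>u\<close> followed by \<open>T (idop m)\<close>, so this is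
  compatibility of the action with composition.\<close>

lemma act_natural_op: assumes "natural_op T" "T (idop m) \<in> Op m m'" "u \<in> Op n m" "f \<in> F n"
  shows "eq m' (act (T (idop m)) (act u f)) (act (T u) f)"
  using cmp_eq[OF assms(3,2,4)] by (simp add: natural_op_cmp[OF assms(1)] cmp_idop_right[OF assms(3)])

lemma act_bH: assumes "u \<in> Op n (Suc m)" "f \<in> F n"
  shows "eq m (bH (act u f)) (act (bdry u) f)"
  using eq_trans[OF bH_eq[OF act_F[OF assms]] act_natural_op[OF natural_op_ops(1) bdry_idop assms]] .

lemma bH_act: assumes "u \<in> Op n m" "f \<in> F (Suc n)"
  shows "eq m (act u (bH f)) (act (cmp (bdry (idop (Suc n))) u) f)"
  using eq_trans[OF act_eq[OF assms(1) bH_eq[OF assms(2)]] cmp_eq[OF bdry_idop assms]] .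

abbreviation cyc_el :: "nat \<Rightarrow> 'k chain" where "cyc_el n \<equiv> cyc_avg n (idop n)"

lemma cyc_el_Op: "cyc_el n \<in> Op n n" by (intro cyc_avg_Op idop_Op)

definition cyc where "cyc n = {r + (f - tH f) | r f. r \<in> R n \<and> f \<in> F n}"

lemma cyc_add: assumes "f \<in> cyc n" "g \<in> cyc n" shows "f + g \<in> cyc n"
proof -
  obtain r a r' a' where *: "f = r + (a - tH a)" "g = r' + (a' - tH a')" "r \<in> R n" "r' \<in> R n"
    "a \<in> F n" "a' \<in> F n" using assms by (auto simp: cyc_def)
  have "eq n (tH (a + a')) (act (cyc_op n) (a + a'))" by (intro tH_eq F_add *)
  also have "act (cyc_op n) (a + a') = act (cyc_op n) a + act (cyc_op n) a'" by (rule act_add[OF *(5,6)])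
  also have "eq n \<dots> (tH a + tH a')" by (intro eq_add eq_sym[OF tH_eq] *)
  finally have "tH (a + a') - (tH a + tH a') \<in> R n" by (simp add: eq_def)
  then have "r + r' + (tH (a + a') - (tH a + tH a')) \<in> R n" by (intro R_add *)
  moreover have "f + g = (r + r' + (tH (a + a') - (tH a + tH a'))) + ((a + a') - tH (a + a'))"
    by (simp add: *(1,2) algebra_simps)
  ultimately show ?thesis unfolding cyc_def using F_add[OF *(5,6)] by blast
qed

lemma cyc_sc: assumes "f \<in> cyc n" shows "sc c f \<in> cyc n"
proof -
  obtain r a where *: "f = r + (a - tH a)" "r \<in> R n" "a \<in> F n" using assms by (auto simp: cyc_def)
  have "eq n (tH (sc c a)) (act (cyc_op n) (sc c a))" by (intro tH_eq F_sc *)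
  also have "act (cyc_op n) (sc c a) = sc c (act (cyc_op n) a)" by (rule act_sc[OF *(3)])
  also have "eq n \<dots> (sc c (tH a))" by (intro eq_sc eq_sym[OF tH_eq] *)
  finally have "tH (sc c a) - sc c (tH a) \<in> R n" by (simp add: eq_def)
  then have "sc c r + (tH (sc c a) - sc c (tH a)) \<in> R n" by (intro R_add R_sc *)
  moreover have "sc c f = (sc c r + (tH (sc c a) - sc c (tH a))) + (sc c a - tH (sc c a))"
    by (simp add: *(1) sc.scale_right_diff_distrib sc.scale_right_distrib)
  ultimately show ?thesis unfolding cyc_def using F_sc[OF *(3)] by blast
qed

lemma cyc_R: assumes "f \<in> R n" shows "f \<in> cyc n"
proof -
  have "eq n (tH 0) 0" using tH_eq[OF F0, of n] by (simp add: act_0)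
  then have "tH 0 \<in> R n" by (simp add: eq_0)
  then have "f + tH 0 \<in> R n" by (rule R_add[OF assms])
  then show ?thesis unfolding cyc_def using F0[of n] by force
qed

text \<open>The image of \<open>1 - t\<close> becomes the kernel of an idempotent. The cyclic
  average absorbs \<open>t\<close>; conversely \<open>g\<close> minus its average is a mean of
  differences of \<open>g\<close> and its rotations, and each of them telescopes into elements
  \<open>f - tH f\<close>.\<close>

lemma cyc_iff: "g \<in> cyc n \<longleftrightarrow> g \<in> F n \<and> act (cyc_el n) g \<in> R n"
proof
  assume "g \<in> cyc n"
  then obtain r f where *: "g = r + (f - tH f)" "r \<in> R n" "f \<in> F n" by (auto simp: cyc_def)
  have tf: "tH f \<in> F n" using tH_eq[OF *(3)] by (rule eq_F)
  have "eq n (act (cyc_el n) (tH f)) (act (cyc_el n) (act (cyc_op n) f))" by (intro act_eq[OF cyc_el_Op] tH_eq *)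
  also have "eq n \<dots> (act (cyc_avg n (cyc_op n)) f)" by (rule act_natural_op[OF natural_op_cyc_avg cyc_el_Op cyc_op_Op *(3)])
  also have "cyc_avg n (cyc_op n :: 'k chain) = cyc_el n"
    by (rule cyc_avg_rot[OF Op_Len[OF cyc_op_Op[of n]], unfolded rot_cyc_op, symmetric])
  finally have "eq n (act (cyc_el n) (tH f)) (act (cyc_el n) f)" .
  then have 1: "act (cyc_el n) f - act (cyc_el n) (tH f) \<in> R n" using eq_sym by (auto simp: eq_def)
  have r: "r \<in> F n" using *(2) R_F by auto
  have "act (cyc_el n) g = act (cyc_el n) r + (act (cyc_el n) f - act (cyc_el n) (tH f))"
    unfolding *(1) by (simp add: act_add[OF r F_diff[OF *(3) tf]] act_diff[OF *(3) tf])
  moreover have "act (cyc_el n) r \<in> R n" by (rule act_R[OF cyc_el_Op *(2)])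
  ultimately show "g \<in> F n \<and> act (cyc_el n) g \<in> R n"
    using 1 r tf by (simp add: *(1) R_add F_add F_diff *(3))
next
  assume g: "g \<in> F n \<and> act (cyc_el n) g \<in> R n"
  let ?r = "\<lambda>j. (rot ^^ j) (idop n) :: 'k chain"
  have rO: "?r j \<in> Op n n" for j by (intro funpow_in rot_Op idop_Op)
  have step: "g - act (?r j) g \<in> cyc n" for j
  proof (induction j)
    case 0
    have "g - act (idop n) g \<in> R n" using eq_sym[OF idop_eq] g by (auto simp: eq_def)
    then show ?case unfolding funpow_0 by (rule cyc_R)
  next
    case (Suc j)
    let ?f = "act (?r (Suc j)) g"
    have f: "?f \<in> F n" by (rule act_F[OF rO conjunct1[OF g]])
    have "eq n (tH ?f) (act (cyc_op n) ?f)" by (rule tH_eq[OF f])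
    also have "eq n \<dots> (act (cmp (?r (Suc j)) (cyc_op n)) g)" by (rule cmp_eq[OF rO cyc_op_Op conjunct1[OF g]])
    also have "cmp (?r (Suc j)) (cyc_op n) = ?r j" using cmp_rot_cyc_op[OF rO[of j]] by simp
    finally have t: "tH ?f - act (?r j) g \<in> R n" by (simp add: eq_def)
    have "(tH ?f - act (?r j) g) + (?f - tH ?f) \<in> cyc n"
      unfolding cyc_def using t f by blast
    from cyc_sc[OF this, of "-1"] have "act (?r j) g - ?f \<in> cyc n" by (simp add: sc_m1)
    moreover have "g - ?f = (g - act (?r j) g) + (act (?r j) g - ?f)" by (simp add: fun_eq_iff)
    ultimately show ?case using cyc_add[OF Suc.IH] by (simp only:)
  qed
  have s: "(\<Sum>j\<in>I. g - act (?r j) g) \<in> cyc n" if "finite I" for I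
    using that
  proof (induction I)
    case empty
    show ?case unfolding sum.empty by (rule cyc_R[OF R0])
  next
    case (insert j I)
    show ?case unfolding sum.insert[OF insert.hyps] by (rule cyc_add[OF step insert.IH])
  qed
  have "g - act (cyc_el n) g = sc (1 / of_nat (Suc n)) (\<Sum>j<Suc n. g - act (?r j) g)"
  proof -
    have "sc (1 / of_nat (Suc n)) (\<Sum>j<Suc n. g) = g"
    proof -
      have "(\<Sum>j<Suc n. g) = (\<Sum>j<Suc n. sc 1 g)" by simp
      also have "\<dots> = sc (of_nat (Suc n)) g"
        unfolding sc.scale_sum_left[symmetric] by (simp del: sc.scale_one)
      finally show ?thesis by (simp del: of_nat_Suc)
    qed
    then show ?thesis
      by (simp add: cyc_avg_def act_usc act_usum sum_subtractf sc.scale_right_diff_distrib del: sum.lessThan_Suc of_nat_Suc)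
  qed
  then have "g - act (cyc_el n) g \<in> cyc n" using cyc_sc[OF s] by (metis finite_lessThan)
  from cyc_add[OF this cyc_R[OF conjunct2[OF g]]] show "g \<in> cyc n"
    unfolding diff_add_cancel .
qed

lemma cyc_F: "cyc n \<subseteq> F n" by (auto simp: cyc_iff)

end

section \<open>Homology of the dihedral coinvariants of a symmetric system\<close>

context symmetric_system begin

definition eig where "eig s n = {f \<in> F n. yH f - sc s f \<in> cyc n}"
definition dcy where "dcy s n = {f \<in> eig s n. n = 0 \<or> bH f \<in> cyc (n - 1)}"
definition dbn where "dbn s n = {bH g + q | g q. g \<in> eig s (Suc n) \<and> q \<in> cyc n}"
definition hcy where "hcy n = {f \<in> F n. n = 0 \<or> bH f \<in> R (n - 1)}"
definition hbn where "hbn n = {bH g + q | g q. g \<in> F (Suc n) \<and> q \<in> R n}"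

abbreviation dih_el :: "'k \<Rightarrow> nat \<Rightarrow> 'k chain" where "dih_el s n \<equiv> dih_avg s n (idop n)"
abbreviation bdry_el :: "nat \<Rightarrow> 'k chain" where "bdry_el n \<equiv> bdry (idop n)"

lemma dih_el_Op: "dih_el s n \<in> Op n n" by (intro dih_avg_Op idop_Op)

lemma half: "sc (1/2) (f + f) = (f :: 'a \<Rightarrow> 'k)"
  by (simp add: sc_def fun_eq_iff)

text \<open>With \<open>N\<close> the cyclic average and \<open>y\<close> the reversal, the
  eigenvector condition on coinvariants reads \<open>y N f = s N f\<close>. Since
  \<open>s * s = 1\<close>, it says that \<open>N f\<close> equals half the sum of
  \<open>N f\<close> and \<open>s y N f\<close>.\<close>

lemma eig_iff:
  assumes ss: "s * s = 1"
  shows "f \<in> eig s n \<longleftrightarrow> f \<in> F n \<and> eq n (act (cyc_el n) f) (act (dih_el s n) f)"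
proof (cases "f \<in> F n")
  case False then show ?thesis by (simp add: eig_def)
next
  case f: True
  let ?Y = "act (flip (cyc_el n)) f" and ?N = "act (cyc_el n) f"
  have O: "flip (cyc_el n) \<in> Op n n" by (intro flip_Op cyc_el_Op)
  have YF: "?Y \<in> F n" "?N \<in> F n" by (intro act_F[OF _ f] O cyc_el_Op)+
  have yf: "yH f \<in> F n" using yH_eq[OF f] by (rule eq_F)
  have "eq n (act (cyc_el n) (yH f)) (act (cyc_el n) (act (flip (idop n)) f))"
    by (intro act_eq[OF cyc_el_Op] yH_eq f)
  also have "eq n \<dots> (act (cyc_avg n (flip (idop n))) f)"
    by (rule act_natural_op[OF natural_op_cyc_avg cyc_el_Op flip_Op[OF idop_Op] f])
  also have "cyc_avg n (flip (idop n) :: 'k chain) = flip (cyc_el n)" by (rule cyc_avg_flip[OF Op_Len[OF idop_Op]])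
  finally have 1: "eq n (act (cyc_el n) (yH f)) ?Y" .
  have "eq n (act (cyc_el n) (yH f - sc s f)) (?Y - sc s ?N)"
    unfolding act_diff[OF yf F_sc[OF f]] act_sc[OF f] by (intro eq_diff 1 eq_refl F_sc YF)
  note A = this
  have "f \<in> eig s n \<longleftrightarrow> eq n (act (cyc_el n) (yH f - sc s f)) 0"
    unfolding eig_def cyc_iff eq_0 using f F_diff[OF yf F_sc[OF f]] by blast
  moreover have "eq n (act (cyc_el n) (yH f - sc s f)) 0 \<longleftrightarrow> eq n (?Y - sc s ?N) 0"
    using A by (meson eq_sym eq_trans)
  ultimately have 2: "f \<in> eig s n \<longleftrightarrow> eq n ?Y (sc s ?N)"
    unfolding eq_0 eq_diff_0[OF YF(1) F_sc[OF YF(2)]] by blast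
  have e: "act (dih_el s n) f = sc (1/2) (?N + sc s ?Y)"
    by (simp add: dih_avg_def act_usc act_uadd)
  show ?thesis
  proof
    assume "f \<in> eig s n"
    then have "eq n (sc s ?Y) (sc s (sc s ?N))" using 2 by (intro eq_sc) simp
    then have "eq n (sc s ?Y) ?N" using ss by simp
    then have "eq n (sc (1/2) (?N + sc s ?Y)) (sc (1/2) (?N + ?N))"
      by (intro eq_sc eq_add eq_refl YF)
    then show "f \<in> F n \<and> eq n ?N (act (dih_el s n) f)"
      using f unfolding e half by (auto intro: eq_sym)
  next
    assume "f \<in> F n \<and> eq n ?N (act (dih_el s n) f)"
    then have 3: "eq n ?N (sc (1/2) (?N + sc s ?Y))" by (simp add: e)
    from eq_diff[OF eq_sc[OF 3, of 2] eq_refl[OF YF(2)]]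
    have "eq n (sc 2 ?N - ?N) (?N + sc s ?Y - ?N)" by simp
    moreover have "sc 2 ?N - ?N = ?N" by (simp add: sc_def fun_eq_iff)
    ultimately have "eq n ?N (sc s ?Y)" by simp
    from eq_sc[OF this, of s] have "eq n (sc s ?N) ?Y" using ss by simp
    then show "f \<in> eig s n" using 2 eq_sym by blast
  qed
qed

lemma cyc_avg_bdry_dih_avg': assumes "s * s = 1" shows "cyc_avg n (bdry (dih_el s (Suc n))) = dih_avg s n (bdry_el (Suc n))"
proof -
  have i: "idop (Suc n) \<in> Op (Suc n) (Suc n)" by (rule idop_Op)
  have "cyc_avg n (bdry (dih_el s (Suc n))) = dih_avg s n (bdry (dih_el s (Suc n)))"
    by (rule cyc_avg_bdry_dih_avg[OF assms Op_Len[OF dih_el_Op]]) (rule projsysD(3)[OF projsys_dih_avg[OF assms] i])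
  also have "\<dots> = dih_avg s n (bdry_el (Suc n))" by (rule projsysD(4)[OF projsys_dih_avg[OF assms] i])
  finally show ?thesis .
qed

text \<open>Around the boundary the cyclic averages can be traded for dihedral ones, at the source
  because \<open>f\<close> is an eigenvector and at the target by
  \<open>cyc_avg_bdry_dih_avg'\<close>. This brings the given differential into the form that occurs
  in the homotopies.\<close>

lemma eig_bdry:
  assumes ss: "s * s = 1" and f: "f \<in> eig s (Suc n)"
  shows "eq n (act (cyc_el n) (bH f)) (act (dih_avg s n (bdry_el (Suc n))) f)"
proof -
  have fF: "f \<in> F (Suc n)" and fe: "eq (Suc n) (act (cyc_el (Suc n)) f) (act (dih_el s (Suc n)) f)"
    using f eig_iff[OF ss] by auto
  have NB: "cyc_avg n (bdry_el (Suc n)) \<in> Op (Suc n) n" by (intro cyc_avg_Op bdry_idop)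
  have "eq n (act (cyc_el n) (bH f)) (act (cyc_el n) (act (bdry_el (Suc n)) f))"
    by (intro act_eq[OF cyc_el_Op] bH_eq fF)
  also have "eq n \<dots> (act (cyc_avg n (bdry_el (Suc n))) f)"
    by (rule act_natural_op[OF natural_op_cyc_avg cyc_el_Op bdry_idop fF])
  also have "cyc_avg n (bdry_el (Suc n)) = cyc_avg n (bdry (cyc_el (Suc n)))"
    by (rule cyc_avg_bdry_cyc_avg[OF Op_Len[OF idop_Op], symmetric])
  also have "eq n (act \<dots> f) (act (cyc_avg n (bdry_el (Suc n))) (act (cyc_el (Suc n)) f))"
    by (rule eq_sym[OF act_natural_op[OF natural_op_comp[OF natural_op_cyc_avg natural_op_ops(1)] NB cyc_el_Op fF]])
  also have "eq n \<dots> (act (cyc_avg n (bdry_el (Suc n))) (act (dih_el s (Suc n)) f))"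
    by (rule act_eq[OF NB fe])
  also have "eq n \<dots> (act (cyc_avg n (bdry (dih_el s (Suc n)))) f)"
    by (rule act_natural_op[OF natural_op_comp[OF natural_op_cyc_avg natural_op_ops(1)] NB dih_el_Op fF])
  finally show ?thesis unfolding cyc_avg_bdry_dih_avg'[OF ss] .
qed

lemma eig_bdry': assumes ss: "s * s = 1" and f: "f \<in> eig s (Suc n)"
  shows "bH f \<in> cyc n \<longleftrightarrow> eq n (act (dih_avg s n (bdry_el (Suc n))) f) 0"
proof -
  have fF: "f \<in> F (Suc n)" using f by (simp add: eig_def)
  then have "bH f \<in> F n" using bH_eq eq_F by blast
  then show ?thesis using eig_bdry[OF ss f] unfolding cyc_iff eq_0[symmetric]
    by (metis eq_sym eq_trans)
qed

lemma eq_dih_el_eig: assumes ss: "s * s = 1" and f: "eq n f (act (dih_el s n) g)" "g \<in> F n"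
  shows "f \<in> eig s n"
proof -
  have fF: "f \<in> F n" using f by (auto dest: eq_F)
  have e1: "eq n (act (cyc_el n) f) (act (dih_el s n) g)"
  proof -
    have "eq n (act (cyc_el n) f) (act (cyc_el n) (act (dih_el s n) g))" by (rule act_eq[OF cyc_el_Op f(1)])
    also have "eq n \<dots> (act (cyc_avg n (dih_el s n)) g)" by (rule act_natural_op[OF natural_op_cyc_avg cyc_el_Op dih_el_Op f(2)])
    finally show ?thesis unfolding cyc_avg_dih_avg[OF Op_Len[OF idop_Op]] .
  qed
  have e2: "eq n (act (dih_el s n) f) (act (dih_el s n) g)"
  proof -
    have "eq n (act (dih_el s n) f) (act (dih_el s n) (act (dih_el s n) g))" by (rule act_eq[OF dih_el_Op f(1)])
    also have "eq n \<dots> (act (dih_avg s n (dih_el s n)) g)" by (rule act_natural_op[OF natural_op_dih_avg dih_el_Op dih_el_Op f(2)])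
    finally show ?thesis unfolding projsysD(3)[OF projsys_dih_avg[OF ss] idop_Op] .
  qed
  show ?thesis unfolding eig_iff[OF ss] using fF eq_trans[OF e1 eq_sym[OF e2]] by simp
qed

lemma hbn_iff: "f \<in> hbn n \<longleftrightarrow> (\<exists>g\<in>F (Suc n). eq n f (bH g))"
proof
  assume "f \<in> hbn n"
  then obtain g q where *: "f = bH g + q" "g \<in> F (Suc n)" "q \<in> R n" by (auto simp: hbn_def)
  have "bH g \<in> F n" using bH_eq[OF *(2)] by (rule eq_F)
  then have "eq n f (bH g)" using * R_F by (auto simp: eq_def intro: F_add)
  then show "\<exists>g\<in>F (Suc n). eq n f (bH g)" using *(2) by blast
next
  assume "\<exists>g\<in>F (Suc n). eq n f (bH g)"
  then obtain g where "g \<in> F (Suc n)" "f - bH g \<in> R n" by (auto simp: eq_def)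
  moreover have "f = bH g + (f - bH g)" by simp
  ultimately show "f \<in> hbn n" unfolding hbn_def by blast
qed

lemma cyc_el_to_dih_el: assumes "f \<in> cyc n" shows "eq n (act (dih_el s n) f) 0"
proof -
  have f: "f \<in> F n" "eq n (act (cyc_el n) f) 0" using assms by (auto simp: cyc_iff eq_0)
  have "act (dih_el s n) f = act (dih_avg s n (cyc_el n)) f" by (simp add: dih_avg_cyc_avg[OF Op_Len[OF idop_Op]])
  also have "eq n \<dots> (act (dih_el s n) (act (cyc_el n) f))"
    by (rule eq_sym[OF act_natural_op[OF natural_op_dih_avg dih_el_Op cyc_el_Op f(1)]])
  also have "eq n \<dots> (act (dih_el s n) 0)" by (rule act_eq[OF dih_el_Op f(2)])
  finally show ?thesis by (simp add: act_0)
qed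

lemma dih_el_act:
  assumes "w \<in> Op c l" "dih_avg s l w = w" "f \<in> F c"
  shows "eq l (act (dih_el s l) (act w f)) (act w f)"
  using act_natural_op[OF natural_op_dih_avg dih_el_Op assms(1,3), of s] assms(2) by simp

text \<open>Operators whose words are fixed by the dihedral average have values fixed by it. The
  separate summand leaves room for the homotopy term next to a sum of sections.\<close>

lemma mem_eig:
  assumes ss: "s * s = 1"
    and u: "\<And>i. i \<in> I \<Longrightarrow> u i \<in> Op (k i) l" "\<And>i. i \<in> I \<Longrightarrow> dih_avg s l (u i) = u i"
      "\<And>i. i \<in> I \<Longrightarrow> z i \<in> F (k i)"
    and v: "v \<in> Op l' l" "dih_avg s l v = v" "y \<in> F l'"
  shows "(\<Sum>i\<in>I. act (u i) (z i)) + act v y \<in> F l" "(\<Sum>i\<in>I. act (u i) (z i)) + act v y \<in> eig s l"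
proof -
  let ?x = "(\<Sum>i\<in>I. act (u i) (z i)) + act v y"
  have aF: "act (u i) (z i) \<in> F l" if "i \<in> I" for i by (rule act_F[OF u(1,3)[OF that]])
  have vF: "act v y \<in> F l" by (rule act_F[OF v(1,3)])
  have SF: "(\<Sum>i\<in>I. act (u i) (z i)) \<in> F l" by (rule F_sum[OF aF])
  show xF: "?x \<in> F l" by (rule F_add[OF SF vF])
  have "act (dih_el s l) ?x = (\<Sum>i\<in>I. act (dih_el s l) (act (u i) (z i))) + act (dih_el s l) (act v y)"
    using act_add[OF SF vF] act_sum[where f = "\<lambda>i. act (u i) (z i)", OF aF] by simp
  also have "eq l \<dots> ?x"
    by (intro eq_add eq_sum dih_el_act[OF v] dih_el_act[OF u])
  finally show "?x \<in> eig s l" using eq_dih_el_eig[OF ss eq_sym xF] by blast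
qed

text \<open>The isomorphism applies one retraction for each shift. Injectivity comes from the
  homotopy on the dihedral side, surjectivity from the homotopies between the bar complexes, with
  preimages given by the sections.\<close>

theorem splitting:
  assumes s: "s = (-1) ^ d" "d < 2"
  shows "subquot_iso (dcy s n) (dbn s n) {i. 4 * i + 2 * d \<le> n}
           (\<lambda>i. hcy (n - (4 * i + 2 * d))) (\<lambda>i. hbn (n - (4 * i + 2 * d)))"
proof -
  have ss: "s * s = 1" using s(1) by (auto simp: minus_one_power_iff split: if_splits)
  \<comment> \<open>The half shifts \<open>2 * i + d\<close> are those of the parity that belongs to
    \<open>s\<close>.\<close>
  have si: "(-1) ^ (2 * i + d) = s" for i by (simp add: s(1) power_add)
  have "\<exists>ph. \<forall>i. is_retraction s (2 * i + d) (ph i)"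
    using retraction_exists[OF si] unfolding is_retraction_def by (intro choice) blast
  then obtain ph where ph: "\<And>i. is_retraction s (2 * i + d) (ph i)" by blast
  have "\<exists>ps. \<forall>i. is_section s (2 * i + d) (ps i)"
    using section_exists[OF si] unfolding is_section_def by (intro choice) blast
  then obtain ps where ps: "\<And>i. is_section s (2 * i + d) (ps i)" by blast
  define \<kappa> where "\<kappa> i = 4 * i + 2 * d" for i
  define m where "m i = n - \<kappa> i" for i
  define I where "I = {i. \<kappa> i \<le> n}"
  have fin: "finite I" by (rule finite_subset[of _ "{..n}"]) (auto simp: I_def \<kappa>_def)
  have k2: "\<kappa> i = 2 * (2 * i + d)" for i by (simp add: \<kappa>_def)
  have n: "m i + \<kappa> i = n" if "i \<in> I" for i using that by (simp add: I_def m_def)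
  have phO: "ph i k \<in> Op (k + \<kappa> i) k" and phe: "cmp (dih_el s (k + \<kappa> i)) (ph i k) = ph i k"
    and phb: "bdry (ph i (Suc k)) = cmp (bdry_el (Suc (k + \<kappa> i))) (ph i k)" for i k
    using ph[of i] unfolding is_retraction_def k2 by (simp_all add: add.commute)
  have psO: "ps i k \<in> Op k (k + \<kappa> i)" and pse: "dih_avg s (k + \<kappa> i) (ps i k) = ps i k"
    and psb: "dih_avg s (k + \<kappa> i) (bdry (ps i (Suc k))) = cmp (bdry_el (Suc k)) (ps i k)"
    and ps0: "\<kappa> i > 0 \<Longrightarrow> dih_avg s (\<kappa> i - 1) (bdry (ps i 0)) = 0" for i k
    using ps[of i] unfolding is_section_def k2 by simp_all
  have dih_avg_bH: "eq k (act (dih_el s k) (bH (act u g))) (act (dih_avg s k (bdry u)) g)"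
    if u: "u \<in> Op l (Suc k)" and g: "g \<in> F l" for u k l g
    using eq_trans[OF act_eq[OF dih_el_Op act_bH[OF u g]] act_natural_op[OF natural_op_dih_avg dih_el_Op bdry_Op[OF u] g]] .

  \<comment> \<open>A retraction begins with the dihedral average, which annihilates the cyclic
    relations.\<close>
  have to_cyc: "eq (m i) (act (ph i (m i)) q) 0" if i: "i \<in> I" and q: "q \<in> cyc n" for i q
  proof -
    have O: "ph i (m i) \<in> Op n (m i)" "cmp (dih_el s n) (ph i (m i)) = ph i (m i)"
      using phO[of i "m i"] phe[of "m i" i] n[OF i] by simp_all
    have "eq (m i) (act (cmp (dih_el s n) (ph i (m i))) q) (act (ph i (m i)) (act (dih_el s n) q))"
      by (rule eq_sym[OF cmp_eq[OF dih_el_Op O(1)]]) (use q cyc_F in auto)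
    also have "eq (m i) \<dots> (act (ph i (m i)) 0)" by (rule act_eq[OF O(1) cyc_el_to_dih_el[OF q]])
    finally show ?thesis by (simp add: O act_0)
  qed

  define \<phi> where "\<phi> x i = (if i \<in> I then act (ph i (m i)) x else 0)" for x i
  have dF: "x \<in> F n" if "x \<in> dcy s n" for x using that by (auto simp: dcy_def eig_def)

  have sub1: "\<phi> x i \<in> hcy (m i)" if x: "x \<in> dcy s n" and i: "i \<in> I" for x i
  proof -
    have f: "act (ph i (m i)) x \<in> F (m i)"
      by (rule act_F[OF phO[of i "m i", unfolded n[OF i]] dF[OF x]])
    have "bH (act (ph i (m i)) x) \<in> R (m i - 1)" if mi: "m i \<noteq> 0"
    proof -
      obtain k where k: "m i = Suc k" using mi by (cases "m i") auto
      define l where "l = k + \<kappa> i"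
      have l: "n = Suc l" "l = k + \<kappa> i" using n[OF i] k by (auto simp: l_def)
      have O: "ph i (Suc k) \<in> Op (Suc l) (Suc k)" "ph i k \<in> Op l k"
        using phO[of i "Suc k"] phO[of i k] l by simp_all
      have xe: "x \<in> eig s (Suc l)" "bH x \<in> cyc l" using x l by (auto simp: dcy_def)
      then have x0: "eq l (act (dih_avg s l (bdry_el (Suc l))) x) 0" using eig_bdry'[OF ss] by simp
      have xF: "x \<in> F (Suc l)" using dF[OF x] l by simp
      have eB: "dih_avg s l (bdry_el (Suc l)) \<in> Op (Suc l) l" by (intro dih_avg_Op bdry_idop)
      \<comment> \<open>The average absorbed by \<open>ph\<close> is moved onto the boundary in
        front of it, where the cycle condition on \<open>x\<close> applies.\<close>
      have "bdry (ph i (Suc k)) = cmp (bdry_el (Suc l)) (cmp (dih_el s l) (ph i k))"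
        using phb[of i k] phe[of k i] l by simp
      also have "\<dots> = cmp (cmp (bdry_el (Suc l)) (dih_el s l)) (ph i k)"
        by (rule cmp_assoc[OF bdry_idop dih_el_Op O(2), symmetric])
      also have "cmp (bdry_el (Suc l)) (dih_el s l) = dih_avg s l (bdry_el (Suc l))"
        by (simp add: natural_op_cmp[OF natural_op_dih_avg] cmp_idop_right[OF bdry_idop])
      finally have 1: "bdry (ph i (Suc k)) = cmp (dih_avg s l (bdry_el (Suc l))) (ph i k)" .
      have "eq k (bH (act (ph i (Suc k)) x)) (act (cmp (dih_avg s l (bdry_el (Suc l))) (ph i k)) x)"
        using act_bH[OF O(1) xF] unfolding 1 .
      also have "eq k \<dots> (act (ph i k) (act (dih_avg s l (bdry_el (Suc l))) x))"
        by (rule eq_sym[OF cmp_eq[OF eB O(2) xF]])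
      also have "eq k \<dots> (act (ph i k) 0)" by (rule act_eq[OF O(2) x0])
      finally show ?thesis by (simp add: k act_0 eq_0)
    qed
    then show ?thesis using f i by (auto simp: hcy_def \<phi>_def)
  qed

  have sub2: "\<phi> x i \<in> hbn (m i)" if x: "x \<in> dbn s n" and i: "i \<in> I" for x i
  proof -
    obtain g q where x: "x = bH g + q" "g \<in> eig s (Suc n)" "q \<in> cyc n" using x by (auto simp: dbn_def)
    have g: "g \<in> F (Suc n)" using x(2) by (simp add: eig_def)
    note bg = eq_F(1)[OF bH_eq[OF g]]
    have O: "ph i (m i) \<in> Op n (m i)" "ph i (Suc (m i)) \<in> Op (Suc n) (Suc (m i))"
      using phO[of i "m i"] phO[of i "Suc (m i)"] n[OF i] by simp_all
    have "bdry (ph i (Suc (m i))) = cmp (bdry_el (Suc n)) (ph i (m i))"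
      using phb[of i "m i"] n[OF i] by simp
    with bH_act[OF O(1) g] act_bH[OF O(2) g]
    have "eq (m i) (act (ph i (m i)) (bH g)) (bH (act (ph i (Suc (m i))) g))"
      by (metis eq_sym eq_trans)
    from eq_add[OF this to_cyc[OF i x(3)]]
    have "eq (m i) (act (ph i (m i)) x) (bH (act (ph i (Suc (m i))) g))"
      using act_add[OF bg subsetD[OF cyc_F x(3)]] by (simp add: x(1))
    then show ?thesis using act_F[OF O(2) g] i by (auto simp: \<phi>_def hbn_iff)
  qed

  obtain h where h: "\<And>n. h n \<in> Op n (Suc n)" "\<And>n. cmp (dih_el s n) (h n) = h n" "\<And>n. dih_avg s (Suc n) (h n) = h n"
    "\<And>n. dih_el s n - (\<Sum>i | \<kappa> i \<le> n. cmp (ph i (n - \<kappa> i)) (ps i (n - \<kappa> i))) = dih_avg s n (bdry (h n)) + cmp (bdry_el n) (h (n - 1))"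
    using retraction_section_homotopy[OF s ps ph] unfolding \<kappa>_def by blast

  have inj: "x \<in> dbn s n" if x: "x \<in> dcy s n" and hx: "\<And>i. i \<in> I \<Longrightarrow> \<phi> x i \<in> hbn (m i)" for x
  proof -
    have xF: "x \<in> F n" by (rule dF[OF x])
    have xe: "eq n (act (cyc_el n) x) (act (dih_el s n) x)" using x eig_iff[OF ss] by (auto simp: dcy_def)
    have "\<forall>i\<in>I. \<exists>g. g \<in> F (Suc (m i)) \<and> eq (m i) (act (ph i (m i)) x) (bH g)"
      using hx by (auto simp: \<phi>_def hbn_iff)
    then obtain g where g: "\<And>i. i \<in> I \<Longrightarrow> g i \<in> F (Suc (m i))"
      "\<And>i. i \<in> I \<Longrightarrow> eq (m i) (act (ph i (m i)) x) (bH (g i))" by metis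
    \<comment> \<open>Sections of the chains \<open>g i\<close> that bound the images of
      \<open>x\<close>, plus the homotopy applied to \<open>x\<close>; its boundary is
      \<open>x\<close> modulo cyclic relations.\<close>
    define G where "G = (\<Sum>i\<in>I. act (ps i (Suc (m i))) (g i)) + act (h n) x"
    have pO: "ps i (m i) \<in> Op (m i) n" "ps i (Suc (m i)) \<in> Op (Suc (m i)) (Suc n)"
      "dih_avg s (Suc n) (ps i (Suc (m i))) = ps i (Suc (m i))"
      "dih_avg s n (bdry (ps i (Suc (m i)))) = cmp (bdry_el (Suc (m i))) (ps i (m i))"
      "ph i (m i) \<in> Op n (m i)" if "i \<in> I" for i
      using psO[of i "m i"] psO[of i "Suc (m i)"] pse[of "Suc (m i)" i] psb[of "m i" i] phO[of i "m i"] n[OF that]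
      by simp_all
    note ME = mem_eig[OF ss, where I = I and u = "\<lambda>i. ps i (Suc (m i))" and k = "\<lambda>i. Suc (m i)" and z = g,
        OF pO(2,3) g(1) h(1) h(3) xF]
    have Ge: "G \<in> eig s (Suc n)" and GF: "G \<in> F (Suc n)"
      unfolding G_def by (rule ME(2), assumption+, rule ME(1), assumption+)
    have 1: "eq n (act (cmp (ph i (m i)) (ps i (m i))) x) (act (dih_el s n) (bH (act (ps i (Suc (m i))) (g i))))"
      if i: "i \<in> I" for i
    proof -
      have "eq n (act (cmp (ph i (m i)) (ps i (m i))) x) (act (ps i (m i)) (act (ph i (m i)) x))"
        by (rule eq_sym[OF cmp_eq[OF pO(5,1)[OF i] xF]])
      also have "eq n \<dots> (act (ps i (m i)) (bH (g i)))" by (rule act_eq[OF pO(1)[OF i] g(2)[OF i]])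
      also have "eq n \<dots> (act (cmp (bdry_el (Suc (m i))) (ps i (m i))) (g i))"
        by (rule bH_act[OF pO(1)[OF i] g(1)[OF i]])
      also have "cmp (bdry_el (Suc (m i))) (ps i (m i)) = dih_avg s n (bdry (ps i (Suc (m i))))" using pO(4)[OF i] by simp
      also have "eq n (act \<dots> (g i)) (act (dih_el s n) (bH (act (ps i (Suc (m i))) (g i))))"
        by (rule eq_sym[OF dih_avg_bH[OF pO(2)[OF i] g(1)[OF i]]])
      finally show ?thesis .
    qed
    have 2: "eq n (act (dih_avg s n (bdry (h n))) x) (act (dih_el s n) (bH (act (h n) x)))"
      by (rule eq_sym[OF dih_avg_bH[OF h(1) xF]])
    \<comment> \<open>This part of the homotopy first takes the averaged boundary of
      \<open>x\<close>, which vanishes as \<open>x\<close> is a cycle.\<close>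
    have 3: "eq n (act (cmp (bdry_el n) (h (n - 1))) x) 0"
    proof (cases n)
      case 0
      then show ?thesis by (simp add: bdry_idop_0 act_u0 eq_refl F0)
    next
      case (Suc l)
      have x0: "eq l (act (dih_avg s l (bdry_el (Suc l))) x) 0"
        using x Suc eig_bdry'[OF ss, of x l] by (auto simp: dcy_def)
      have xF': "x \<in> F (Suc l)" using xF Suc by simp
      have hO: "h l \<in> Op l (Suc l)" by (rule h(1))
      have eB: "dih_avg s l (bdry_el (Suc l)) \<in> Op (Suc l) l" by (intro dih_avg_Op bdry_idop)
      have "cmp (bdry_el (Suc l)) (h l) = cmp (cmp (bdry_el (Suc l)) (dih_el s l)) (h l)"
        using cmp_assoc[OF bdry_idop dih_el_Op hO] h(2) by simp
      also have "cmp (bdry_el (Suc l)) (dih_el s l) = dih_avg s l (bdry_el (Suc l))"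
        by (simp add: natural_op_cmp[OF natural_op_dih_avg] cmp_idop_right[OF bdry_idop])
      finally have "eq (Suc l) (act (cmp (bdry_el (Suc l)) (h l)) x) (act (h l) (act (dih_avg s l (bdry_el (Suc l))) x))"
        using eq_sym[OF cmp_eq[OF eB hO xF']] by simp
      also have "eq (Suc l) \<dots> (act (h l) 0)" by (rule act_eq[OF hO x0])
      finally show ?thesis using Suc by (simp add: act_0)
    qed
    have "dih_el s n = (\<Sum>i\<in>I. cmp (ph i (m i)) (ps i (m i))) + dih_avg s n (bdry (h n)) + cmp (bdry_el n) (h (n - 1))"
      using h(4)[of n] unfolding I_def m_def by (simp add: algebra_simps)
    then have "act (dih_el s n) x = (\<Sum>i\<in>I. act (cmp (ph i (m i)) (ps i (m i))) x) + act (dih_avg s n (bdry (h n))) x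
       + act (cmp (bdry_el n) (h (n - 1))) x"
      by (metis act_uadd act_usum)
    also have "eq n \<dots> ((\<Sum>i\<in>I. act (dih_el s n) (bH (act (ps i (Suc (m i))) (g i)))) + act (dih_el s n) (bH (act (h n) x)) + 0)"
      by (intro eq_add eq_sum 1 2 3)
    also have "\<dots> = act (dih_el s n) ((\<Sum>i\<in>I. bH (act (ps i (Suc (m i))) (g i))) + bH (act (h n) x))"
    proof -
      have "bH (act (ps i (Suc (m i))) (g i)) \<in> F n" if "i \<in> I" for i
        using act_bH[OF pO(2)[OF that] g(1)[OF that]] by (rule eq_F)
      moreover have "bH (act (h n) x) \<in> F n" using act_bH[OF h(1) xF] by (rule eq_F)
      ultimately show ?thesis
        by (subst act_add[where n = n]) (auto intro: F_sum simp: act_sum[where n = n])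
    qed
    also have "eq n \<dots> (act (dih_el s n) (bH G))"
    proof (rule act_eq[OF dih_el_Op])
      let ?B = "act (bdry_el (Suc n))"
      have aF: "act (ps i (Suc (m i))) (g i) \<in> F (Suc n)" if "i \<in> I" for i
        by (rule act_F[OF pO(2)[OF that] g(1)[OF that]])
      have hF: "act (h n) x \<in> F (Suc n)" by (rule act_F[OF h(1) xF])
      have "eq n (bH G) (?B G)" by (rule bH_eq[OF GF])
      also have "?B G = (\<Sum>i\<in>I. ?B (act (ps i (Suc (m i))) (g i))) + ?B (act (h n) x)"
        unfolding G_def using aF hF
        by (subst act_add[where n = "Suc n"]) (auto intro: F_sum simp: act_sum[where n = "Suc n"])
      also have "eq n \<dots> ((\<Sum>i\<in>I. bH (act (ps i (Suc (m i))) (g i))) + bH (act (h n) x))"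
        by (intro eq_add eq_sum eq_sym[OF bH_eq] aF hF)
      finally show "eq n ((\<Sum>i\<in>I. bH (act (ps i (Suc (m i))) (g i))) + bH (act (h n) x)) (bH G)"
        by (rule eq_sym)
    qed
    finally have 4: "eq n (act (dih_el s n) x) (act (dih_el s n) (bH G))" .
    have bG: "bH G \<in> F n" using bH_eq[OF GF] by (rule eq_F)
    have "eq n (act (cyc_el n) (bH G)) (act (dih_avg s n (bdry_el (Suc n))) G)" by (rule eig_bdry[OF ss Ge])
    also have "eq n \<dots> (act (dih_el s n) (act (bdry_el (Suc n)) G))"
      by (rule eq_sym[OF act_natural_op[OF natural_op_dih_avg dih_el_Op bdry_idop GF]])
    also have "eq n \<dots> (act (dih_el s n) (bH G))" by (rule act_eq[OF dih_el_Op eq_sym[OF bH_eq[OF GF]]])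
    finally have "eq n (act (cyc_el n) (bH G)) (act (dih_el s n) (bH G))" .
    with xe 4 have "eq n (act (cyc_el n) x) (act (cyc_el n) (bH G))" by (metis eq_sym eq_trans)
    then have "x - bH G \<in> cyc n"
      by (simp add: cyc_iff F_diff xF bG act_diff[OF xF bG] eq_def)
    moreover have "x = bH G + (x - bH G)" by simp
    ultimately show ?thesis unfolding dbn_def using Ge by blast
  qed

  have surj: "\<exists>x\<in>dcy s n. \<forall>j\<in>I. z j - \<phi> x j \<in> hbn (m j)" if z: "\<And>i. i \<in> I \<Longrightarrow> z i \<in> hcy (m i)" for z
  proof -
    have zF: "z i \<in> F (m i)" if "i \<in> I" for i using z[OF that] by (simp add: hcy_def)
    \<comment> \<open>All sections land in degree \<open>n\<close>. The retraction with index
      \<open>j\<close> returns \<open>z j\<close> up to a boundary from the summand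
      \<open>i = j\<close>, and boundaries from the others.\<close>
    define x where "x = (\<Sum>i\<in>I. act (ps i (m i)) (z i))"
    have pO: "ps i (m i) \<in> Op (m i) n" "dih_avg s n (ps i (m i)) = ps i (m i)" "ph i (m i) \<in> Op n (m i)" if "i \<in> I" for i
      using psO[of i "m i"] pse[of "m i" i] phO[of i "m i"] n[OF that] by simp_all
    have x': "x = (\<Sum>i\<in>I. act (ps i (m i)) (z i)) + act 0 0" by (simp add: x_def act_0)
    have z0: "dih_avg s n 0 = 0" by simp
    note ME = mem_eig[OF ss, where I = I and u = "\<lambda>i. ps i (m i)" and k = m and z = z,
        OF pO(1,2) zF Op_closed(1)[of n n] z0 F0]
    have xe: "x \<in> eig s n" and xF: "x \<in> F n"
      unfolding x' by (rule ME(2), assumption+, rule ME(1), assumption+)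
    have aF: "act (ps i (m i)) (z i) \<in> F n" if "i \<in> I" for i by (rule act_F[OF pO(1)[OF that] zF[OF that]])
    have zb: "eq k (act (bdry_el (Suc k)) (z i)) 0" if "i \<in> I" "m i = Suc k" for i k
      using z[OF that(1)] that(2) bH_eq[of "z i" k] by (auto simp: hcy_def eq_0[symmetric] dest: eq_sym eq_trans)
    have "bH x \<in> cyc (n - 1)" if n0: "n \<noteq> 0"
    proof -
      obtain l where l: "n = Suc l" using n0 by (cases n) auto
      have eB: "dih_avg s l (bdry_el (Suc l)) \<in> Op (Suc l) l" by (intro dih_avg_Op bdry_idop)
      have "eq l (act (dih_avg s l (bdry_el (Suc l))) (act (ps i (m i)) (z i))) 0" if i: "i \<in> I" for i
      proof -
        have "eq l (act (dih_avg s l (bdry_el (Suc l))) (act (ps i (m i)) (z i))) (act (dih_avg s l (bdry (ps i (m i)))) (z i))"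
          by (rule act_natural_op[OF natural_op_comp[OF natural_op_dih_avg natural_op_ops(1)] eB _ zF[OF i]]) (use pO i l in auto)
        also have "eq l \<dots> 0"
        proof (cases "m i")
          case 0
          then have "l = \<kappa> i - 1" "\<kappa> i > 0" using n[OF i] l by auto
          then show ?thesis using ps0[of i] 0 by (simp add: act_u0 eq_refl F0)
        next
          case (Suc k)
          then have lk: "l = k + \<kappa> i" using n[OF i] l by simp
          have pk: "ps i k \<in> Op k l" using psO[of i k] lk by simp
          have zk: "z i \<in> F (Suc k)" using zF[OF i] Suc by simp
          have "act (dih_avg s l (bdry (ps i (m i)))) (z i) = act (cmp (bdry_el (Suc k)) (ps i k)) (z i)"
            using psb[of k i] Suc lk by simp
          also have "eq l \<dots> (act (ps i k) (act (bdry_el (Suc k)) (z i)))"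
            by (rule eq_sym[OF cmp_eq[OF bdry_idop pk zk]])
          also have "eq l \<dots> (act (ps i k) 0)" by (rule act_eq[OF pk zb[OF i Suc]])
          finally show ?thesis by (simp add: act_0)
        qed
        finally show ?thesis .
      qed
      then have "eq l (\<Sum>i\<in>I. act (dih_avg s l (bdry_el (Suc l))) (act (ps i (m i)) (z i))) (\<Sum>i\<in>I. 0)"
        by (rule eq_sum)
      then have "eq l (act (dih_avg s l (bdry_el (Suc l))) x) 0"
        using act_sum[where f = "\<lambda>i. act (ps i (m i)) (z i)", OF aF] by (simp add: x_def)
      then show ?thesis using eig_bdry'[OF ss, of x l] xe l by simp
    qed
    then have xd: "x \<in> dcy s n" using xe by (auto simp: dcy_def)
    have "z j - \<phi> x j \<in> hbn (m j)" if j: "j \<in> I" for j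
    proof -
      have "\<exists>H. H \<in> Op (m i) (Suc (m j)) \<and> eq (m j)
          (act (ph j (m j)) (act (ps i (m i)) (z i)) - (if i = j then z i else 0)) (bH (act H (z i)))"
        if i: "i \<in> I" for i
      proof -
        obtain H where H0: "\<And>k. k + 2 * (2 * i + d) < 2 * (2 * j + d) \<Longrightarrow> H k = 0"
          and H: "\<And>k l. k + 2 * (2 * i + d) = l + 2 * (2 * j + d) \<Longrightarrow> H k \<in> Op k (Suc l) \<and>
             cmp (ps i k) (ph j l) - (if 2 * i + d = 2 * j + d then idop k else 0) = bdry (H k) + cmp (bdry_el k) (H (k - 1))"
          using section_retraction_homotopy[OF ss ps ph, of i j] by metis
        have e: "m i + 2 * (2 * i + d) = m j + 2 * (2 * j + d)" using n[OF i] n[OF j] by (simp add: k2)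
        have HO: "H (m i) \<in> Op (m i) (Suc (m j))" using H[OF e] by simp
        have "cmp (ps i (m i)) (ph j (m j)) - (if i = j then idop (m i) else 0) = bdry (H (m i)) + cmp (bdry_el (m i)) (H (m i - 1))"
          using H[OF e] by simp
        from arg_cong[OF this, of "\<lambda>u. act u (z i)"]
        have 1: "act (cmp (ps i (m i)) (ph j (m j))) (z i) - (if i = j then act (idop (m i)) (z i) else 0)
          = act (bdry (H (m i))) (z i) + act (cmp (bdry_el (m i)) (H (m i - 1))) (z i)"
          by (simp add: act_uadd act_udiff act_u0 split: if_splits)
        have 2: "eq (m j) (act (cmp (bdry_el (m i)) (H (m i - 1))) (z i)) 0"
        proof (cases "m i")
          case 0 then show ?thesis by (simp add: bdry_idop_0 act_u0 eq_refl F0)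
        next
          case (Suc k)
          \<comment> \<open>If \<open>m j = 0\<close>, the composite in source degree
            \<open>k\<close> would end in degree -1; the homotopy is 0 there and has to be typed by
            hand.\<close>
          have Hk: "H k \<in> Op k (m j)"
          proof (cases "m j")
            case 0
            then have "H k = 0" using e Suc by (intro H0) simp
            then show ?thesis by (simp add: Op_closed)
          next
            case (Suc l)
            then show ?thesis using H[of k l] e \<open>m i = Suc k\<close> by simp
          qed
          have "eq (m j) (act (cmp (bdry_el (Suc k)) (H k)) (z i)) (act (H k) (act (bdry_el (Suc k)) (z i)))"
            by (rule eq_sym[OF cmp_eq[OF bdry_idop Hk]]) (use zF[OF i] Suc in simp)
          also have "eq (m j) \<dots> (act (H k) 0)" by (rule act_eq[OF Hk zb[OF i Suc]])
          finally show ?thesis using Suc by (simp add: act_0)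
        qed
        have "eq (m j) (act (ph j (m j)) (act (ps i (m i)) (z i)) - (if i = j then z i else 0))
           (act (cmp (ps i (m i)) (ph j (m j))) (z i) - (if i = j then act (idop (m i)) (z i) else 0))"
        proof (rule eq_diff)
          show "eq (m j) (act (ph j (m j)) (act (ps i (m i)) (z i))) (act (cmp (ps i (m i)) (ph j (m j))) (z i))"
            by (rule cmp_eq[OF pO(1)[OF i] pO(3)[OF j] zF[OF i]])
          show "eq (m j) (if i = j then z i else 0) (if i = j then act (idop (m i)) (z i) else 0)"
            using eq_sym[OF idop_eq[OF zF[OF i]]] by (auto simp: eq_refl F0)
        qed
        also note 1
        also have "eq (m j) (act (bdry (H (m i))) (z i) + act (cmp (bdry_el (m i)) (H (m i - 1))) (z i)) (bH (act (H (m i)) (z i)) + 0)"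
          by (intro eq_add 2 eq_sym[OF act_bH[OF HO zF[OF i]]])
        finally show ?thesis using HO by auto
      qed
      then obtain H where H: "\<And>i. i \<in> I \<Longrightarrow> H i \<in> Op (m i) (Suc (m j))"
        "\<And>i. i \<in> I \<Longrightarrow> eq (m j) (act (ph j (m j)) (act (ps i (m i)) (z i)) - (if i = j then z i else 0)) (bH (act (H i) (z i)))"
        by metis
      define G where "G = (\<Sum>i\<in>I. act (H i) (z i))"
      have HF: "act (H i) (z i) \<in> F (Suc (m j))" if "i \<in> I" for i by (rule act_F[OF H(1)[OF that] zF[OF that]])
      have GF: "G \<in> F (Suc (m j))" unfolding G_def by (intro F_sum HF)
      have px: "\<phi> x j = (\<Sum>i\<in>I. act (ph j (m j)) (act (ps i (m i)) (z i)))"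
        using j act_sum[where f = "\<lambda>i. act (ps i (m i)) (z i)", OF aF] by (simp add: \<phi>_def x_def)
      have "z j = (\<Sum>i\<in>I. if i = j then z i else 0)" using fin j by (simp add: sum.delta)
      then have "\<phi> x j - z j = (\<Sum>i\<in>I. act (ph j (m j)) (act (ps i (m i)) (z i)) - (if i = j then z i else 0))"
        unfolding px by (simp add: sum_subtractf)
      also have "eq (m j) \<dots> (\<Sum>i\<in>I. bH (act (H i) (z i)))" by (intro eq_sum H(2))
      also have "eq (m j) \<dots> (\<Sum>i\<in>I. act (bdry_el (Suc (m j))) (act (H i) (z i)))" by (intro eq_sum bH_eq HF)
      also have "\<dots> = act (bdry_el (Suc (m j))) G" unfolding G_def by (rule act_sum[where f = "\<lambda>i. act (H i) (z i)", OF HF, symmetric])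
      finally have "eq (m j) (sc (-1) (\<phi> x j - z j)) (sc (-1) (act (bdry_el (Suc (m j))) G))" by (rule eq_sc)
      also have "sc (-1) (act (bdry_el (Suc (m j))) G) = act (bdry_el (Suc (m j))) (sc (-1) G)"
        by (rule act_sc[OF GF, symmetric])
      also have "eq (m j) \<dots> (bH (sc (-1) G))" by (rule eq_sym[OF bH_eq[OF F_sc[OF GF]]])
      finally have "eq (m j) (z j - \<phi> x j) (bH (sc (-1) G))" by (simp add: sc_m1)
      then show ?thesis unfolding hbn_iff using F_sc[OF GF] by blast
    qed
    then show ?thesis using xd by blast
  qed

  have lin: "\<phi> (\<lambda>t. c * x t + e * y t) = (\<lambda>i t. c * \<phi> x i t + e * \<phi> y i t)"
    if "x \<in> dcy s n" "y \<in> dcy s n" for x y c e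
  proof -
    have "act u (\<lambda>t. c * x t + e * y t) = (\<lambda>t. c * act u x t + e * act u y t)" for u
    proof -
      have "act u (sc c x + sc e y) = sc c (act u x) + sc e (act u y)"
        unfolding act_add[OF F_sc[OF dF[OF that(1)]] F_sc[OF dF[OF that(2)]]]
          act_sc[OF dF[OF that(1)]] act_sc[OF dF[OF that(2)]] ..
      then show ?thesis by (simp add: sc_def plus_fun_def)
    qed
    then show ?thesis by (auto simp: \<phi>_def fun_eq_iff)
  qed

  have "subquot_iso (dcy s n) (dbn s n) I (\<lambda>i. hcy (m i)) (\<lambda>i. hbn (m i))"
    unfolding subquot_iso_def
  proof (intro exI[of _ \<phi>] conjI ballI allI impI)
    show "\<phi> (\<lambda>t. c * x t + d * y t) = (\<lambda>i t. c * \<phi> x i t + d * \<phi> y i t)"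
      if "x \<in> dcy s n" "y \<in> dcy s n" for x y c d by (rule lin[OF that])
    show "\<phi> x i \<in> hcy (m i)" if "x \<in> dcy s n" "i \<in> I" for x i by (rule sub1[OF that])
    show "\<phi> x i = (\<lambda>_. 0)" if "i \<notin> I" for x i using that by (simp add: \<phi>_def zero_fun_def)
    show "\<exists>x\<in>dcy s n. \<forall>i\<in>I. (\<lambda>t. z i t - \<phi> x i t) \<in> hbn (m i)" if "\<forall>i\<in>I. z i \<in> hcy (m i)" for z
      using surj[of z] that by (simp add: fun_diff_def)
    show "x \<in> dbn s n \<longleftrightarrow> (\<forall>i\<in>I. \<phi> x i \<in> hbn (m i))" if "x \<in> dcy s n" for x
      using inj[OF that] sub2 by blast
  qed
  then show ?thesis unfolding I_def m_def \<kappa>_def .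
qed

end

section \<open>Multilinear forms on tensor powers\<close>

lemma sum_list_apply: "(\<Sum>p\<leftarrow>L. f p) x = (\<Sum>p\<leftarrow>L. (f p x :: 'v::comm_monoid_add))"
  by (induction L) (auto simp: zero_fun_def plus_fun_def)

lemma sum_list_swap: "(\<Sum>p\<leftarrow>L. \<Sum>q\<leftarrow>M. f p q) = (\<Sum>q\<leftarrow>M. \<Sum>p\<leftarrow>L. (f p q :: 'v::comm_monoid_add))"
  by (induction L) (auto simp: sum_list_addf)

text \<open>Forms with values in arbitrary modules are needed because Sweedler identities are used
  under maps into \<open>H\<close> itself and not only under scalar forms.\<close>

definition pair :: "('k::comm_ring_1 \<Rightarrow> 'v \<Rightarrow> 'v) \<Rightarrow> ('a \<Rightarrow> 'v::ab_group_add) \<Rightarrow> ('a \<Rightarrow> 'k) \<Rightarrow> 'v" where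
  "pair s \<mu> f = (\<Sum>w | f w \<noteq> 0. s (f w) (\<mu> w))"

definition fin :: "('a \<Rightarrow> 'k::zero) \<Rightarrow> bool" where "fin f \<longleftrightarrow> finite {x. f x \<noteq> 0}"

lemma fin_0 [simp]: "fin 0" by (simp add: fin_def)

lemma fin_add: "fin f \<Longrightarrow> fin g \<Longrightarrow> fin (f + g :: 'a \<Rightarrow> 'k::comm_ring_1)"
  unfolding fin_def by (rule finite_subset[of _ "{x. f x \<noteq> 0} \<union> {x. g x \<noteq> 0}"]) auto

lemma fin_sc: "fin f \<Longrightarrow> fin (sc c f :: 'a \<Rightarrow> 'k::comm_ring_1)"
  unfolding fin_def sc_def by (rule finite_subset[of _ "{x. f x \<noteq> 0}"]) auto

lemma fin_diff: "fin f \<Longrightarrow> fin g \<Longrightarrow> fin (f - g :: 'a \<Rightarrow> 'k::comm_ring_1)"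
  unfolding fin_def by (rule finite_subset[of _ "{x. f x \<noteq> 0} \<union> {x. g x \<noteq> 0}"]) auto

lemma fin_gen [simp]: "fin (gen w :: 'h list \<Rightarrow> 'k::comm_ring_1)"
  unfolding fin_def gen_def by (rule finite_subset[of _ "{w}"]) auto

lemma fin_sum: "(\<And>i. i \<in> I \<Longrightarrow> fin (f i)) \<Longrightarrow> fin (sum f I :: 'a \<Rightarrow> 'k::comm_ring_1)"
  by (induction I rule: infinite_finite_induct) (auto intro: fin_add)

lemma fin_sum_list: "(\<And>i. i \<in> set L \<Longrightarrow> fin (f i)) \<Longrightarrow> fin (\<Sum>i\<leftarrow>L. f i :: 'a \<Rightarrow> 'k::comm_ring_1)"
  by (induction L) (auto intro: fin_add)

lemma pair_superset:
  assumes "module s" "finite A" "{w. f w \<noteq> 0} \<subseteq> A"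
  shows "pair s \<mu> f = (\<Sum>w\<in>A. s (f w) (\<mu> w))"
proof -
  interpret module s by fact
  show ?thesis unfolding pair_def by (rule sum.mono_neutral_left) (use assms in auto)
qed

context
  fixes s :: "'k::comm_ring_1 \<Rightarrow> 'v \<Rightarrow> 'v::ab_group_add"
  assumes m: "module s"
begin

interpretation s: module s by (rule m)

lemma pair_0: "pair s \<mu> 0 = 0" by (simp add: pair_def)

lemma pair_add: assumes "fin f" "fin g" shows "pair s \<mu> (f + g) = pair s \<mu> f + pair s \<mu> g"
proof -
  let ?A = "{w. f w \<noteq> 0} \<union> {w. g w \<noteq> 0}"
  have "finite ?A" using assms by (simp add: fin_def)
  then show ?thesis
    by (subst (1 2 3) pair_superset[OF m, of ?A]) (auto simp: s.scale_left_distrib sum.distrib)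
qed

lemma pair_sc: assumes "fin f" shows "pair s \<mu> (sc c f) = s c (pair s \<mu> f)"
  using assms by (subst (1 2) pair_superset[OF m, of "{w. f w \<noteq> 0}"])
    (auto simp: fin_def sc_def s.scale_sum_right)

lemma pair_gen: "pair s \<mu> (gen w) = \<mu> w"
  by (subst pair_superset[OF m, of "{w}"]) (auto simp: gen_def)

lemma pair_diff: assumes "fin f" "fin g" shows "pair s \<mu> (f - g) = pair s \<mu> f - pair s \<mu> g"
  using pair_add[OF fin_diff[OF assms] assms(2), of \<mu>] by simp

lemma pair_sum: "(\<And>i. i \<in> I \<Longrightarrow> fin (f i)) \<Longrightarrow> pair s \<mu> (sum f I) = (\<Sum>i\<in>I. pair s \<mu> (f i))"
  by (induction I rule: infinite_finite_induct) (auto simp: pair_0 pair_add fin_sum)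

lemma pair_sum_list: "(\<And>i. i \<in> set L \<Longrightarrow> fin (f i)) \<Longrightarrow> pair s \<mu> (\<Sum>i\<leftarrow>L. f i) = (\<Sum>i\<leftarrow>L. pair s \<mu> (f i))"
  by (induction L) (auto simp: pair_0 pair_add fin_sum_list)

lemma pair_cong: "(\<And>w. f w \<noteq> 0 \<Longrightarrow> \<mu> w = \<nu> w) \<Longrightarrow> pair s \<mu> f = pair s \<nu> f"
  unfolding pair_def by (rule sum.cong) auto

end

text \<open>Forms are required to be multilinear on words of every length; a form on words of one
  length is extended by zero.\<close>
definition ml :: "('k::comm_ring_1, 'h::plus) hopf_data \<Rightarrow> ('k \<Rightarrow> 'v \<Rightarrow> 'v) \<Rightarrow> ('h list \<Rightarrow> 'v::ab_group_add) \<Rightarrow> bool" where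
  "ml H s \<mu> \<longleftrightarrow> (\<forall>u v a b. \<mu> (u @ (a + b) # v) = \<mu> (u @ a # v) + \<mu> (u @ b # v))
     \<and> (\<forall>u v a c. \<mu> (u @ hscale H c a # v) = s c (\<mu> (u @ a # v)))"

definition lin :: "('k::comm_ring_1, 'h::plus) hopf_data \<Rightarrow> ('k \<Rightarrow> 'v \<Rightarrow> 'v) \<Rightarrow> ('h \<Rightarrow> 'v::ab_group_add) \<Rightarrow> bool" where
  "lin H s f \<longleftrightarrow> (\<forall>a b. f (a + b) = f a + f b) \<and> (\<forall>a c. f (hscale H c a) = s c (f a))"

text \<open>Separating the first slot allows multilinearity to be proved along the recursion of
  words.\<close>

lemma ml_Cons_iff: "ml H s \<mu> \<longleftrightarrow> (\<forall>x. lin H s (\<lambda>h. \<mu> (h # x))) \<and> (\<forall>h. ml H s (\<lambda>x. \<mu> (h # x)))"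
proof
  assume "ml H s \<mu>"
  then have 1: "\<mu> (u @ (a + b) # v) = \<mu> (u @ a # v) + \<mu> (u @ b # v)"
    "\<mu> (u @ hscale H c a # v) = s c (\<mu> (u @ a # v))" for u v a b c
    by (auto simp: ml_def)
  from 1[of "[]"] 1[of "h # u" for h u] show "(\<forall>x. lin H s (\<lambda>h. \<mu> (h # x))) \<and> (\<forall>h. ml H s (\<lambda>x. \<mu> (h # x)))"
    by (simp add: ml_def lin_def)
next
  assume 1: "(\<forall>x. lin H s (\<lambda>h. \<mu> (h # x))) \<and> (\<forall>h. ml H s (\<lambda>x. \<mu> (h # x)))"
  show "ml H s \<mu>"
    unfolding ml_def
  proof (intro conjI allI)
    fix u v a b show "\<mu> (u @ (a + b) # v) = \<mu> (u @ a # v) + \<mu> (u @ b # v)"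
      using 1 by (cases u) (auto simp: ml_def lin_def)
  next
    fix u v a c show "\<mu> (u @ hscale H c a # v) = s c (\<mu> (u @ a # v))"
      using 1 by (cases u) (auto simp: ml_def lin_def)
  qed
qed

lemma fspan_sum: "f \<in> fspan A \<longleftrightarrow> (\<exists>S c. finite S \<and> S \<subseteq> A \<and> f = (\<Sum>a\<in>S. sc (c a) a))"
proof -
  have "(\<lambda>x. \<Sum>a\<in>S. c a * a x) = (\<Sum>a\<in>S. sc (c a) a)" if "finite S" for S and c :: "('a \<Rightarrow> 'b) \<Rightarrow> 'b"
    using that by (induction S) (auto simp: sc_def fun_eq_iff)
  then show ?thesis unfolding fspan_def by (simp cong: conj_cong)
qed

lemma tensor_gen_cases:
  assumes "f \<in> tensor_rel H n"
  obtains S c where "finite S" "f = (\<Sum>a\<in>S. sc (c a) a)"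
    "\<And>a. a \<in> S \<Longrightarrow> (\<exists>u v x y. length u + length v + 1 = n \<and> a = gen (u @ (x + y) # v) - gen (u @ x # v) - gen (u @ y # v))
       \<or> (\<exists>u v x d. length u + length v + 1 = n \<and> a = gen (u @ hscale H d x # v) - sc d (gen (u @ x # v)))"
proof -
  obtain S c where 1: "finite S" "f = (\<Sum>a\<in>S. sc (c a) a)" "S \<subseteq> {\<lambda>x. gen (u @ [a + b] @ v) x - gen (u @ [a] @ v) x - gen (u @ [b] @ v) x
        | u v a b. length u + length v + 1 = n}
    \<union> {\<lambda>x. gen (u @ [hscale H c a] @ v) x - c * gen (u @ [a] @ v) x
        | u v a c. length u + length v + 1 = n}"
    using assms unfolding tensor_rel_def fspan_sum by blast
  show thesis
  proof (rule that[OF 1(1,2)])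
    fix a assume "a \<in> S"
    with 1(3) consider
      (add) u v x y where "length u + length v + 1 = n"
        "a = (\<lambda>t. gen (u @ [x + y] @ v) t - gen (u @ [x] @ v) t - gen (u @ [y] @ v) t)"
    | (scale) u v x d where "length u + length v + 1 = n"
        "a = (\<lambda>t. gen (u @ [hscale H d x] @ v) t - d * gen (u @ [x] @ v) t)"
      by blast
    then show "(\<exists>u v x y. length u + length v + 1 = n \<and> a = gen (u @ (x + y) # v) - gen (u @ x # v) - gen (u @ y # v))
       \<or> (\<exists>u v x d. length u + length v + 1 = n \<and> a = gen (u @ hscale H d x # v) - sc d (gen (u @ x # v)))"
    proof cases
      case add
      then have "a = gen (u @ (x + y) # v) - gen (u @ x # v) - gen (u @ y # v)" by (simp add: fun_eq_iff)
      then show ?thesis using add(1) by blast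
    next
      case scale
      then have "a = gen (u @ hscale H d x # v) - sc d (gen (u @ x # v))" by (simp add: fun_eq_iff sc_def)
      then show ?thesis using scale(1) by blast
    qed
  qed
qed

lemma FS_fin: "f \<in> FS n \<Longrightarrow> fin f" by (simp add: FS_def fin_def)

lemma FS_0 [simp]: "0 \<in> FS n" by (simp add: FS_def)
lemma FS_gen: "length w = n \<Longrightarrow> gen w \<in> (FS n :: ('h list \<Rightarrow> 'k::comm_ring_1) set)"
  using fin_gen[of w, where 'k = 'k] by (auto simp: FS_def fin_def gen_def)
lemma FS_add: "f \<in> FS n \<Longrightarrow> g \<in> FS n \<Longrightarrow> f + g \<in> (FS n :: ('h list \<Rightarrow> 'k::comm_ring_1) set)"
  using fin_add[of f g] by (simp add: FS_def fin_def) (metis add.right_neutral)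
lemma FS_sc: "f \<in> FS n \<Longrightarrow> sc c f \<in> (FS n :: ('h list \<Rightarrow> 'k::comm_ring_1) set)"
  using fin_sc[of f c] by (simp add: FS_def fin_def) (metis mult_zero_right sc_def)
lemma FS_diff: "f \<in> FS n \<Longrightarrow> g \<in> FS n \<Longrightarrow> f - g \<in> (FS n :: ('h list \<Rightarrow> 'k::comm_ring_1) set)"
  using fin_diff[of f g] by (simp add: FS_def fin_def) (metis diff_zero)
lemma FS_sum: "(\<And>i. i \<in> I \<Longrightarrow> f i \<in> FS n) \<Longrightarrow> sum f I \<in> (FS n :: ('h list \<Rightarrow> 'k::comm_ring_1) set)"
  by (induction I rule: infinite_finite_induct) (auto intro: FS_add)
lemma FS_sum_list: "(\<And>i. i \<in> set L \<Longrightarrow> f i \<in> FS n) \<Longrightarrow> (\<Sum>i\<leftarrow>L. f i) \<in> (FS n :: ('h list \<Rightarrow> 'k::comm_ring_1) set)"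
  by (induction L) (auto intro: FS_add)

lemma tensor_rel_FS: assumes "f \<in> tensor_rel H n" shows "f \<in> FS n"
proof -
  obtain S c where 1: "f = (\<Sum>a\<in>S. sc (c a) a)"
    "\<And>a. a \<in> S \<Longrightarrow> (\<exists>u v x y. length u + length v + 1 = n \<and> a = gen (u @ (x + y) # v) - gen (u @ x # v) - gen (u @ y # v))
       \<or> (\<exists>u v x d. length u + length v + 1 = n \<and> a = gen (u @ hscale H d x # v) - sc d (gen (u @ x # v)))"
    by (rule tensor_gen_cases[OF assms]) blast
  show ?thesis unfolding 1(1)
  proof (intro FS_sum FS_sc)
    fix a assume "a \<in> S"
    from 1(2)[OF this] show "a \<in> FS n" by (auto intro!: FS_diff FS_gen FS_sc)
  qed
qed

lemma pair_tensor_rel: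
  assumes m: "module s" and \<mu>: "ml H s \<mu>" and f: "f \<in> tensor_rel H n"
  shows "pair s \<mu> f = 0"
proof -
  interpret s: module s by (rule m)
  obtain S c where 1: "f = (\<Sum>a\<in>S. sc (c a) a)"
    "\<And>a. a \<in> S \<Longrightarrow> (\<exists>u v x y. length u + length v + 1 = n \<and> a = gen (u @ (x + y) # v) - gen (u @ x # v) - gen (u @ y # v))
       \<or> (\<exists>u v x d. length u + length v + 1 = n \<and> a = gen (u @ hscale H d x # v) - sc d (gen (u @ x # v)))"
    by (rule tensor_gen_cases[OF f]) blast
  have 2: "fin a \<and> pair s \<mu> a = 0" if "a \<in> S" for a
    using 1(2)[OF that] \<mu>
    by (auto simp: pair_diff[OF m] pair_gen[OF m] pair_sc[OF m] ml_def fin_diff fin_sc)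
  then show ?thesis unfolding 1(1)
    by (subst pair_sum[OF m]) (auto simp: fin_sc pair_sc[OF m])
qed

lemma tensor_rel_closed:
  fixes H :: "('k::comm_ring_1, 'h::plus) hopf_data"
  shows "0 \<in> tensor_rel H n" "f \<in> tensor_rel H n \<Longrightarrow> sc c f \<in> tensor_rel H n"
    "f \<in> tensor_rel H n \<Longrightarrow> g \<in> tensor_rel H n \<Longrightarrow> f + g \<in> tensor_rel H n"
proof -
  let ?span = "fspan :: ('h list \<Rightarrow> 'k) set \<Rightarrow> _"
  have sp: "0 \<in> ?span A" for A unfolding fspan_sum by (rule exI[of _ "{}"]) auto
  have sc: "sc c f \<in> ?span A" if f: "f \<in> ?span A" for A f
  proof -
    obtain S d where 1: "finite S" "S \<subseteq> A" "f = (\<Sum>a\<in>S. sc (d a) a)" using f unfolding fspan_sum by blast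
    have "sc c f = (\<Sum>a\<in>S. sc (c * d a) a)"
      unfolding 1(3) by (simp add: sc.scale_sum_right)
    then show ?thesis unfolding fspan_sum using 1(1,2)
      by (intro exI[of _ S] exI[of _ "\<lambda>a. c * d a"]) simp
  qed
  have ad: "f + g \<in> ?span A" if fg: "f \<in> ?span A" "g \<in> ?span A" for A f g
  proof -
    obtain S d S' d' where 1: "finite S" "S \<subseteq> A" "f = (\<Sum>a\<in>S. sc (d a) a)"
       "finite S'" "S' \<subseteq> A" "g = (\<Sum>a\<in>S'. sc (d' a) a)" using fg unfolding fspan_sum by blast
    let ?e = "\<lambda>a. (if a \<in> S then d a else 0) + (if a \<in> S' then d' a else 0)"
    have "f = (\<Sum>a\<in>S \<union> S'. sc (if a \<in> S then d a else 0) a)"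
      unfolding 1(3) by (rule sum.mono_neutral_cong_left) (use 1 in \<open>auto simp: sc_def zero_fun_def\<close>)
    moreover have "g = (\<Sum>a\<in>S \<union> S'. sc (if a \<in> S' then d' a else 0) a)"
      unfolding 1(6) by (rule sum.mono_neutral_cong_left) (use 1 in \<open>auto simp: sc_def zero_fun_def\<close>)
    moreover have "sc (?e a) a = sc (if a \<in> S then d a else 0) a + sc (if a \<in> S' then d' a else 0) a" for a :: "'h list \<Rightarrow> 'k"
      by (simp add: sc_def fun_eq_iff algebra_simps)
    ultimately have "f + g = (\<Sum>a\<in>S \<union> S'. sc (?e a) a)" by (simp add: sum.distrib)
    then show ?thesis unfolding fspan_sum using 1
      by (intro exI[of _ "S \<union> S'"] exI[of _ ?e]) auto
  qed
  show "0 \<in> tensor_rel H n" "f \<in> tensor_rel H n \<Longrightarrow> sc c f \<in> tensor_rel H n"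
    "f \<in> tensor_rel H n \<Longrightarrow> g \<in> tensor_rel H n \<Longrightarrow> f + g \<in> tensor_rel H n"
    unfolding tensor_rel_def by (fact sp, fact sc, fact ad)
qed

lemma vs_sc: "vector_space (sc :: 'k::field \<Rightarrow> ('a \<Rightarrow> 'k) \<Rightarrow> _)"
  by standard (auto simp: sc_def plus_fun_def algebra_simps)

lemma vs_times: "vector_space ((*) :: 'k::field \<Rightarrow> 'k \<Rightarrow> 'k)"
  by standard (auto simp: algebra_simps)

text \<open>Over a field a vector outside a subspace is separated from it by a functional, and a
  functional that kills the relations is a multilinear form on generators. Equality of tensors can
  therefore be tested on scalar forms.\<close>

lemma tensor_rel_separation:
  fixes H :: "('k::field, 'h::plus) hopf_data"
  assumes f: "f \<in> FS n" and z: "\<And>\<mu>. ml H (*) \<mu> \<Longrightarrow> pair (*) \<mu> f = 0"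
  shows "f \<in> tensor_rel H n"
proof (rule ccontr)
  assume nf: "f \<notin> tensor_rel H n"
  interpret V: vector_space "sc :: 'k \<Rightarrow> ('h list \<Rightarrow> 'k) \<Rightarrow> _" by (rule vs_sc)
  interpret K: vector_space "(*) :: 'k \<Rightarrow> 'k \<Rightarrow> 'k" by (rule vs_times)
  interpret VK: vector_space_pair "sc :: 'k \<Rightarrow> ('h list \<Rightarrow> 'k) \<Rightarrow> _" "(*) :: 'k \<Rightarrow> 'k \<Rightarrow> 'k" by unfold_locales
  have sub: "sc.subspace (tensor_rel H n)"
    unfolding sc.subspace_def using tensor_rel_closed by blast
  obtain B where B: "B \<subseteq> tensor_rel H n" "sc.independent B" "tensor_rel H n \<subseteq> sc.span B"
    using V.basis_exists by metis
  have "sc.span B = tensor_rel H n" using B sub by (metis sc.span_mono sc.span_eq_iff subset_antisym)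
  then have ind: "sc.independent (insert f B)" using nf B(2) by (simp add: V.independent_insert)
  \<comment> \<open>A basis \<open>B\<close> of the relations stays independent after adding
    \<open>f\<close>, so values on it can be prescribed.\<close>
  obtain L where L: "Vector_Spaces.linear sc (*) L" "\<And>x. x \<in> insert f B \<Longrightarrow> L x = (if x = f then 1 else 0)"
    using VK.linear_independent_extend[OF ind, of "\<lambda>x. if x = f then 1 else 0"] by blast
  have L0: "L r = 0" if "r \<in> tensor_rel H n" for r
  proof (rule VK.linear_eq_on[OF L(1) VK.linear_zero])
    show "r \<in> sc.span B" using that B by auto
    show "L b = 0" if "b \<in> B" for b using L(2)[of b] that nf B(1) by auto
  qed
  interpret L: Vector_Spaces.linear sc "(*)" L by (rule L(1))
  define \<mu> where "\<mu> w = (if length w = n then L (gen w) else 0)" for w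
  have gens: "gen (u @ (a + b) # v) - gen (u @ a # v) - gen (u @ b # v) \<in> tensor_rel H n"
    "gen (u @ hscale H c a # v) - sc c (gen (u @ a # v)) \<in> tensor_rel H n"
    if "length u + length v + 1 = n" for u v a b c
  proof -
    have base: "x \<in> fspan A" if "x \<in> A" for x and A :: "('h list \<Rightarrow> 'k) set"
      unfolding fspan_sum using that by (intro exI[of _ "{x}"] exI[of _ "\<lambda>_. 1"]) (auto simp: sc_def)
    show "gen (u @ (a + b) # v) - gen (u @ a # v) - gen (u @ b # v) \<in> tensor_rel H n"
      unfolding tensor_rel_def
      by (intro base UnI1 CollectI exI[of _ u] exI[of _ v] exI[of _ a] exI[of _ b] conjI that)
         (simp add: fun_eq_iff)
    show "gen (u @ hscale H c a # v) - sc c (gen (u @ a # v)) \<in> tensor_rel H n"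
      unfolding tensor_rel_def
      by (intro base UnI2 CollectI exI[of _ u] exI[of _ v] exI[of _ a] exI[of _ c] conjI that)
         (simp add: fun_eq_iff sc_def)
  qed
  have "ml H (*) \<mu>"
    unfolding ml_def \<mu>_def
    using L0[OF gens(1)] L0[OF gens(2)] by (auto simp: L.diff L.scale L.add diff_diff_eq)
  then have 1: "pair (*) \<mu> f = 0" by (rule z)
  have "pair (*) \<mu> f = (\<Sum>w | f w \<noteq> 0. f w * L (gen w))"
    unfolding pair_def by (rule sum.cong) (use f in \<open>auto simp: FS_def \<mu>_def\<close>)
  also have "\<dots> = L (\<Sum>w | f w \<noteq> 0. sc (f w) (gen w))" by (simp add: L.sum L.scale)
  also have "(\<Sum>w | f w \<noteq> 0. sc (f w) (gen w)) = f"
  proof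
    fix x
    have fA: "finite {w. f w \<noteq> 0}" using f by (simp add: FS_def)
    have "(\<Sum>w\<in>A. sc (f w) (gen w)) x = (\<Sum>w\<in>A. f w * (if x = w then 1 else 0))" for A
      by (induction A rule: infinite_finite_induct) (auto simp: sc_def gen_def)
    then show "(\<Sum>w | f w \<noteq> 0. sc (f w) (gen w)) x = f x"
      using fA by (simp add: if_distrib cong: if_cong)
  qed
  finally show False using 1 L(2)[of f] by simp
qed

section \<open>Sweedler sums\<close>

lemma sum_list_sum_list_apply:
  "(\<lambda>x. \<Sum>p\<leftarrow>L. \<Sum>q\<leftarrow>M p. f p q x) = (\<Sum>p\<leftarrow>L. \<Sum>q\<leftarrow>M p. (f p q :: 'a \<Rightarrow> 'v::comm_monoid_add))"
  by (simp add: fun_eq_iff sum_list_apply)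

locale hopf =
  fixes H :: "('k::field, 'h::ab_group_add) hopf_data"
  assumes hopf: "cocomm_hopf_algebra H"
begin

abbreviation smul :: "'k \<Rightarrow> 'h \<Rightarrow> 'h" where "smul \<equiv> hscale H"
abbreviation mul :: "'h \<Rightarrow> 'h \<Rightarrow> 'h" (infixl "\<odot>" 70) where "a \<odot> b \<equiv> hmult H a b"
abbreviation one :: 'h where "one \<equiv> hone H"
abbreviation cou :: "'h \<Rightarrow> 'k" where "cou \<equiv> heps H"
abbreviation S :: "'h \<Rightarrow> 'h" where "S \<equiv> hS H"

text \<open>The Sweedler sum over one representative of the coproduct. The Hopf axioms speak about
  the represented tensor, so they transfer to \<open>dsum F\<close> for bilinear \<open>F\<close>,
  and coassociativity for trilinear ones.\<close>

definition dsum :: "('h \<Rightarrow> 'h \<Rightarrow> 'v) \<Rightarrow> 'h \<Rightarrow> 'v::ab_group_add" where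
  "dsum F h = (\<Sum>p\<leftarrow>hDelta H h. F (fst p) (snd p))"

lemma mod_smul: "module smul"
  using hopf unfolding cocomm_hopf_algebra_def by unfold_locales auto

sublocale H: module smul by (rule mod_smul)

lemma mul_simps:
  "(a + b) \<odot> c = a \<odot> c + b \<odot> c" "a \<odot> (b + c) = a \<odot> b + a \<odot> c"
  "smul r a \<odot> b = smul r (a \<odot> b)" "a \<odot> smul r b = smul r (a \<odot> b)"
  using hopf unfolding cocomm_hopf_algebra_def by auto

lemma mul_assoc: "a \<odot> b \<odot> c = a \<odot> (b \<odot> c)"
  using hopf unfolding cocomm_hopf_algebra_def by auto

lemma mul_one [simp]: "one \<odot> a = a" "a \<odot> one = a"
  using hopf unfolding cocomm_hopf_algebra_def by auto

lemma cou_simps: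
  "cou (a + b) = cou a + cou b" "cou (smul r a) = r * cou a" "cou (a \<odot> b) = cou a * cou b" "cou one = 1"
  using hopf unfolding cocomm_hopf_algebra_def by auto

lemma S_simps: "S (a + b) = S a + S b" "S (smul r a) = smul r (S a)"
  using hopf unfolding cocomm_hopf_algebra_def by auto

lemma dsum_swap: "dsum (\<lambda>a b. dsum (\<lambda>c d. F a b c d) h) g = dsum (\<lambda>c d. dsum (\<lambda>a b. F a b c d) g) h"
  unfolding dsum_def by (rule sum_list_swap)

lemma dsum_add: "dsum (\<lambda>a b. F a b + G a b) h = dsum F h + dsum G h"
  by (simp add: dsum_def sum_list_addf)

lemma dsum_hom:
  fixes f :: "'v::ab_group_add \<Rightarrow> 'w::ab_group_add"
  assumes "f 0 = 0" "\<And>x y. f (x + y) = f x + f y" shows "f (dsum F h) = dsum (\<lambda>a b. f (F a b)) h"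
proof -
  have "f (\<Sum>p\<leftarrow>L. g p) = (\<Sum>p\<leftarrow>L. f (g p))" for L and g :: "'h \<times> 'h \<Rightarrow> 'v"
    using assms by (induction L) auto
  then show ?thesis unfolding dsum_def .
qed

definition blin :: "('k \<Rightarrow> 'v \<Rightarrow> 'v) \<Rightarrow> ('h \<Rightarrow> 'h \<Rightarrow> 'v::ab_group_add) \<Rightarrow> bool" where
  "blin s F \<longleftrightarrow> (\<forall>b. lin H s (\<lambda>a. F a b)) \<and> (\<forall>a. lin H s (F a))"

definition tlin :: "('k \<Rightarrow> 'v \<Rightarrow> 'v) \<Rightarrow> ('h \<Rightarrow> 'h \<Rightarrow> 'h \<Rightarrow> 'v::ab_group_add) \<Rightarrow> bool" where
  "tlin s F \<longleftrightarrow> (\<forall>b c. lin H s (\<lambda>a. F a b c)) \<and> (\<forall>a c. lin H s (\<lambda>b. F a b c)) \<and> (\<forall>a b. lin H s (F a b))"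

lemma lin_0: "module s \<Longrightarrow> lin H s (\<lambda>_. 0)"
  by (simp add: lin_def module.scale_zero_right)

lemma ml_0: "module s \<Longrightarrow> ml H s (\<lambda>_. 0)"
  by (simp add: ml_def module.scale_zero_right)

lemma linD: "lin H s f \<Longrightarrow> f (a + b) = f a + f b" "lin H s f \<Longrightarrow> f (smul c a) = s c (f a)"
  by (auto simp: lin_def)

lemma lin_zero: "lin H s f \<Longrightarrow> f 0 = 0"
  using linD(1)[of s f 0 0] by simp

lemma teq_pair:
  assumes "module s" "teq H n f g" "fin f" "fin g" "ml H s \<mu>"
  shows "pair s \<mu> f = pair s \<mu> g"
proof -
  have "pair s \<mu> (f - g) = 0"
    using pair_tensor_rel[OF assms(1,5)] assms(2) unfolding teq_def fun_diff_def .
  then show ?thesis using pair_diff[OF assms(1,3,4)] by simp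
qed

lemma ml_2:
  assumes "module s" "blin s F"
  shows "ml H s (\<lambda>w. if length w = 2 then F (w ! 0) (w ! 1) else 0)"
proof -
  note Z = lin_0[OF assms(1)] ml_0[OF assms(1)]
  have l1: "lin H s (\<lambda>h. if length x = Suc 0 then F h (x ! 0) else 0)" for x
    by (cases "length x = Suc 0") (use assms(2) Z in \<open>simp_all add: blin_def\<close>)
  have l2: "lin H s (\<lambda>h'. if x = [] then F h h' else 0)" for x h
    by (cases "x = []") (use assms(2) Z in \<open>simp_all add: blin_def\<close>)
  have m0: "ml H s (\<lambda>x. if x = [] then F h h' else 0)" for h h'
    unfolding ml_Cons_iff[of H s "\<lambda>x. if x = [] then F h h' else 0"] using Z by simp
  have m1: "ml H s (\<lambda>x. if length x = Suc 0 then F h (x ! 0) else 0)" for h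
    unfolding ml_Cons_iff[of H s "\<lambda>x. if length x = Suc 0 then F h (x ! 0) else 0"]
    by (simp cong: if_cong) (use l2 m0 in blast)
  show ?thesis
    unfolding ml_Cons_iff[of H s "\<lambda>w. if length w = 2 then F (w ! 0) (w ! 1) else 0"]
    by (simp add: numeral_2_eq_2 cong: if_cong) (use l1 m1 in simp)
qed

lemma ml_3:
  assumes "module s" "tlin s F"
  shows "ml H s (\<lambda>w. if length w = 3 then F (w ! 0) (w ! 1) (w ! 2) else 0)"
proof -
  note Z = lin_0[OF assms(1)] ml_0[OF assms(1)]
  have "lin H s (\<lambda>h. if length x = 2 then F h (x ! 0) (x ! 1) else 0)" for x
    by (cases "length x = 2") (use assms(2) Z in \<open>simp_all add: tlin_def\<close>)
  moreover have "ml H s (\<lambda>w. if length w = 2 then F h (w ! 0) (w ! 1) else 0)" for h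
    by (rule ml_2[OF assms(1)]) (use assms(2) in \<open>auto simp: tlin_def blin_def\<close>)
  ultimately show ?thesis
    unfolding ml_Cons_iff[of H s "\<lambda>w. if length w = 3 then F (w ! 0) (w ! 1) (w ! 2) else 0"]
    by (simp add: numeral_3_eq_3 numeral_2_eq_2 cong: if_cong)
qed

lemma tens2_sum: "tens2 L = (\<Sum>p\<leftarrow>L. gen [fst p, snd p])"
  by (simp add: tens2_def fun_eq_iff sum_list_apply)

lemma pair_gens: assumes "module s" shows "pair s \<mu> (\<Sum>p\<leftarrow>L. gen (g p)) = (\<Sum>p\<leftarrow>L. \<mu> (g p))"
  by (simp add: pair_sum_list[OF assms] pair_gen[OF assms])

lemma pair_gens2: assumes "module s"
  shows "pair s \<mu> (\<Sum>p\<leftarrow>L. \<Sum>q\<leftarrow>M p. gen (g p q)) = (\<Sum>p\<leftarrow>L. \<Sum>q\<leftarrow>M p. \<mu> (g p q))"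
  by (simp add: pair_sum_list[OF assms] pair_gens[OF assms] fin_sum_list)

lemma fin_gens: "fin (\<Sum>p\<leftarrow>L. gen (g p) :: 'a list \<Rightarrow> 'b::comm_ring_1)" "fin (\<Sum>p\<leftarrow>L. \<Sum>q\<leftarrow>M p. gen (g' p q) :: 'a list \<Rightarrow> 'b::comm_ring_1)"
  by (intro fin_sum_list fin_gen)+

context
  fixes s :: "'k \<Rightarrow> 'v \<Rightarrow> 'v::ab_group_add"
  assumes m: "module s"
begin

interpretation s: module s by (rule m)

lemma dsum_scale: "dsum (\<lambda>a b. s c (F a b)) h = s c (dsum F h)"
  by (rule dsum_hom[symmetric]) (auto simp: s.scale_right_distrib)

lemma pair_D: assumes "blin s F"
  shows "pair s (\<lambda>w. if length w = 2 then F (w ! 0) (w ! 1) else 0) (tens2 (hDelta H h)) = dsum F h"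
  by (simp add: tens2_sum pair_gens[OF m] dsum_def)

lemma dsum_lin: assumes F: "blin s F" shows "lin H s (dsum F)"
proof -
  let ?\<mu> = "\<lambda>w. if length w = 2 then F (w ! 0) (w ! 1) else 0"
  note \<mu> = ml_2[OF m F] and P = pair_D[OF F]
  have T: "teq H 2 (tens2 (hDelta H (a + b))) (tens2 (hDelta H a) + tens2 (hDelta H b))"
    "teq H 2 (tens2 (hDelta H (smul r a))) (sc r (tens2 (hDelta H a)))" for a b r
    using hopf unfolding cocomm_hopf_algebra_def plus_fun_def by auto
  have f: "fin (tens2 L :: 'h list \<Rightarrow> 'k)" for L unfolding tens2_sum by (rule fin_gens)
  show ?thesis unfolding lin_def
  proof (intro conjI allI)
    fix a b
    have "pair s ?\<mu> (tens2 (hDelta H (a + b))) = pair s ?\<mu> (tens2 (hDelta H a) + tens2 (hDelta H b))"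
      by (rule teq_pair[OF m T(1) f fin_add[OF f f] \<mu>])
    then show "dsum F (a + b) = dsum F a + dsum F b" by (simp only: pair_add[OF m f f] P)
  next
    fix a c
    have "pair s ?\<mu> (tens2 (hDelta H (smul c a))) = pair s ?\<mu> (sc c (tens2 (hDelta H a)))"
      by (rule teq_pair[OF m T(2) f fin_sc[OF f] \<mu>])
    then show "dsum F (smul c a) = s c (dsum F a)" by (simp only: pair_sc[OF m f] P)
  qed
qed

lemma dsum_cocomm: assumes F: "blin s F" shows "dsum F h = dsum (\<lambda>a b. F b a) h"
proof -
  let ?\<mu> = "\<lambda>w. if length w = 2 then F (w ! 0) (w ! 1) else 0"
  have T: "teq H 2 (tens2 (hDelta H h)) (tens2 (map (\<lambda>p. (snd p, fst p)) (hDelta H h)))"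
    using hopf unfolding cocomm_hopf_algebra_def by auto
  have f: "fin (tens2 L :: 'h list \<Rightarrow> 'k)" for L unfolding tens2_sum by (rule fin_gens)
  from teq_pair[OF m T f f ml_2[OF m F]] show ?thesis
    by (simp add: tens2_sum pair_gens[OF m] dsum_def o_def)
qed

lemma dsum_coassoc: assumes F: "tlin s F"
  shows "dsum (\<lambda>a b. dsum (\<lambda>a1 a2. F a1 a2 b) a) h = dsum (\<lambda>a b. dsum (\<lambda>b1 b2. F a b1 b2) b) h"
proof -
  let ?\<mu> = "\<lambda>w. if length w = 3 then F (w ! 0) (w ! 1) (w ! 2) else 0"
  have T: "teq H 3
       (\<lambda>x. \<Sum>p\<leftarrow>hDelta H h. \<Sum>q\<leftarrow>hDelta H (fst p). gen [fst q, snd q, snd p] x)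
       (\<lambda>x. \<Sum>p\<leftarrow>hDelta H h. \<Sum>q\<leftarrow>hDelta H (snd p). gen [fst p, fst q, snd q] x)"
    using hopf unfolding cocomm_hopf_algebra_def by auto
  then have "teq H 3
       (\<Sum>p\<leftarrow>hDelta H h. \<Sum>q\<leftarrow>hDelta H (fst p). gen [fst q, snd q, snd p])
       (\<Sum>p\<leftarrow>hDelta H h. \<Sum>q\<leftarrow>hDelta H (snd p). gen [fst p, fst q, snd q])"
    by (simp only: sum_list_sum_list_apply)
  from teq_pair[OF m this fin_gens(2) fin_gens(2) ml_3[OF m F]] show ?thesis
    by (simp add: pair_gens2[OF m] dsum_def)
qed

lemma dsum_mult: assumes F: "blin s F"
  shows "dsum F (a \<odot> b) = dsum (\<lambda>a1 a2. dsum (\<lambda>b1 b2. F (a1 \<odot> b1) (a2 \<odot> b2)) b) a"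
proof -
  have T: "teq H 2 (tens2 (hDelta H (a \<odot> b)))
       (\<lambda>x. \<Sum>p\<leftarrow>hDelta H a. \<Sum>q\<leftarrow>hDelta H b. gen [fst p \<odot> fst q, snd p \<odot> snd q] x)"
    using hopf unfolding cocomm_hopf_algebra_def by auto
  then have "teq H 2 (tens2 (hDelta H (a \<odot> b)))
       (\<Sum>p\<leftarrow>hDelta H a. \<Sum>q\<leftarrow>hDelta H b. gen [fst p \<odot> fst q, snd p \<odot> snd q])"
    by (simp only: sum_list_sum_list_apply)
  from teq_pair[OF m this[unfolded tens2_sum] fin_gens(1) fin_gens(2) ml_2[OF m F]] show ?thesis
    by (simp add: pair_gens[OF m] pair_gens2[OF m] dsum_def)
qed

lemma dsum_one: assumes F: "blin s F" shows "dsum F one = F one one"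
proof -
  have T: "teq H 2 (tens2 (hDelta H one)) (gen [one, one])"
    using hopf unfolding cocomm_hopf_algebra_def by auto
  from teq_pair[OF m this[unfolded tens2_sum] fin_gens(1) fin_gen ml_2[OF m F]] show ?thesis
    by (simp add: pair_gens[OF m] pair_gen[OF m] dsum_def)
qed

lemma dsum_counit: assumes f: "lin H s f"
  shows "dsum (\<lambda>a b. s (cou a) (f b)) h = f h" "dsum (\<lambda>a b. s (cou b) (f a)) h = f h"
proof -
  have 1: "dsum (\<lambda>a b. smul (cou a) b) h = h" "dsum (\<lambda>a b. smul (cou b) a) h = h"
    using hopf unfolding cocomm_hopf_algebra_def dsum_def by auto
  have "f (dsum F h) = dsum (\<lambda>a b. f (F a b)) h" for F h
    by (rule dsum_hom) (use f lin_zero in \<open>auto simp: lin_def\<close>)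
  from this[of "\<lambda>a b. smul (cou a) b" h] this[of "\<lambda>a b. smul (cou b) a" h]
  show "dsum (\<lambda>a b. s (cou a) (f b)) h = f h" "dsum (\<lambda>a b. s (cou b) (f a)) h = f h"
    using f unfolding 1 by (simp_all add: linD)
qed

end

lemma antipode: "dsum (\<lambda>a b. S a \<odot> b) h = smul (cou h) one" "dsum (\<lambda>a b. a \<odot> S b) h = smul (cou h) one"
  using hopf unfolding cocomm_hopf_algebra_def dsum_def by auto

section \<open>Comultiplication in all tensor factors at once\<close>

primrec lsum :: "'h list \<Rightarrow> ('h list \<Rightarrow> 'h list \<Rightarrow> 'v::ab_group_add) \<Rightarrow> 'v" where
  "lsum [] = (\<lambda>F. F [] [])"
| "lsum (h # x) = (\<lambda>F. dsum (\<lambda>a b. lsum x (\<lambda>u v. F (a # u) (b # v))) h)"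

definition bml :: "('k \<Rightarrow> 'v \<Rightarrow> 'v) \<Rightarrow> ('h list \<Rightarrow> 'h list \<Rightarrow> 'v::ab_group_add) \<Rightarrow> bool" where
  "bml s F \<longleftrightarrow> (\<forall>v. ml H s (\<lambda>u. F u v)) \<and> (\<forall>u. ml H s (F u))"

definition tml :: "('k \<Rightarrow> 'v \<Rightarrow> 'v) \<Rightarrow> ('h list \<Rightarrow> 'h list \<Rightarrow> 'h list \<Rightarrow> 'v::ab_group_add) \<Rightarrow> bool" where
  "tml s F \<longleftrightarrow> (\<forall>v w. ml H s (\<lambda>u. F u v w)) \<and> (\<forall>u w. ml H s (\<lambda>v. F u v w)) \<and> (\<forall>u v. ml H s (F u v))"

primrec lcou :: "'h list \<Rightarrow> 'k" where
  "lcou [] = 1" | "lcou (h # x) = cou h * lcou x"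

lemma lsum_add: "lsum x (\<lambda>u v. F u v + G u v) = lsum x F + lsum x G"
  by (induction x arbitrary: F G) (simp_all add: dsum_add)

lemma lsum_0: "lsum x (\<lambda>u v. 0) = 0"
  by (induction x) (simp_all add: dsum_def)

lemma lsum_sum_list: "lsum x (\<lambda>u v. \<Sum>p\<leftarrow>L. F p u v) = (\<Sum>p\<leftarrow>L. lsum x (F p))"
  by (induction L) (simp_all add: lsum_add lsum_0)

lemma lsum_dsum: "lsum x (\<lambda>u v. dsum (\<lambda>a b. F a b u v) h) = dsum (\<lambda>a b. lsum x (F a b)) h"
  unfolding dsum_def by (rule lsum_sum_list)

lemma lsum_hom: assumes "f 0 = 0" "\<And>x y. f (x + y) = f x + f y" shows "f (lsum x F) = lsum x (\<lambda>u v. f (F u v))"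
  using assms by (induction x arbitrary: F) (simp_all add: dsum_hom)

text \<open>Connects the recursion with the choices of summands by which the cyclic operator is
  given.\<close>

lemma lsum_choices: "(\<Sum>p\<leftarrow>choices (map (hDelta H) w). F (map fst p) (map snd p)) = lsum w F"
proof (induction w arbitrary: F)
  case (Cons h w)
  have "(\<Sum>p\<leftarrow>concat (map (\<lambda>x. map (\<lambda>r. x # r) C) L). F (map fst p) (map snd p))
      = (\<Sum>x\<leftarrow>L. \<Sum>r\<leftarrow>C. F (fst x # map fst r) (snd x # map snd r))" for L C
    by (induction L) (simp_all add: o_def)
  then show ?case using Cons[of "\<lambda>u v. F (fst x # u) (snd x # v)" for x] by (simp add: dsum_def)
qed simp

context
  fixes s :: "'k \<Rightarrow> 'v \<Rightarrow> 'v::ab_group_add"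
  assumes m: "module s"
begin

interpretation s: module s by (rule m)

lemma lsum_scale: "lsum x (\<lambda>u v. s c (F u v)) = s c (lsum x F)"
  by (rule lsum_hom[symmetric]) (auto simp: s.scale_right_distrib)

lemma lin_dsum_param: "(\<And>a b. lin H s (\<lambda>g. F a b g)) \<Longrightarrow> lin H s (\<lambda>g. dsum (\<lambda>a b. F a b g) h)"
  by (simp add: lin_def dsum_add dsum_scale[OF m])

lemma lin_lsum_param: "(\<And>u v. lin H s (\<lambda>g. F u v g)) \<Longrightarrow> lin H s (\<lambda>g. lsum x (\<lambda>u v. F u v g))"
  by (simp add: lin_def lsum_add lsum_scale)

lemma ml_lsum_param: "(\<And>u v. ml H s (\<lambda>g. F u v g)) \<Longrightarrow> ml H s (\<lambda>g. lsum x (\<lambda>u v. F u v g))"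
  by (simp add: ml_def lsum_add lsum_scale)

lemma ml_ConsD: "ml H s \<mu> \<Longrightarrow> ml H s (\<lambda>x. \<mu> (h # x))" "ml H s \<mu> \<Longrightarrow> lin H s (\<lambda>h. \<mu> (h # x))"
  by (simp_all add: ml_Cons_iff[of H s \<mu>])

lemma bml_Cons: assumes "bml s F"
  shows "bml s (\<lambda>u v. F (a # u) (b # v))" "lin H s (\<lambda>a. F (a # u) v)" "lin H s (\<lambda>b. F u (b # v))"
proof -
  have F: "ml H s (\<lambda>u. F u v)" "ml H s (F u)" for u v using assms by (simp_all add: bml_def)
  show "bml s (\<lambda>u v. F (a # u) (b # v))"
    unfolding bml_def using ml_ConsD(1)[OF F(1)] ml_ConsD(1)[OF F(2)] by simp
  show "lin H s (\<lambda>a. F (a # u) v)" "lin H s (\<lambda>b. F u (b # v))"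
    using ml_ConsD(2)[OF F(1)] ml_ConsD(2)[OF F(2)] by simp_all
qed

lemma lsum_ml: "bml s F \<Longrightarrow> ml H s (\<lambda>x. lsum x F)"
proof -
  have "bml s F \<Longrightarrow> lsum (u @ (a + b) # v) F = lsum (u @ a # v) F + lsum (u @ b # v) F
     \<and> lsum (u @ smul c a # v) F = s c (lsum (u @ a # v) F)" for u v a b c
  proof (induction u arbitrary: F)
    case Nil
    have "blin s (\<lambda>a b. lsum v (\<lambda>u v. F (a # u) (b # v)))"
      unfolding blin_def by (intro conjI allI lin_lsum_param bml_Cons Nil)
    from dsum_lin[OF m this] show ?case by (simp add: lin_def)
  next
    case (Cons h u)
    from Cons.IH[OF bml_Cons(1)[OF Cons.prems]] show ?case
      by (simp add: dsum_add dsum_scale[OF m])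
  qed
  then show "bml s F \<Longrightarrow> ml H s (\<lambda>x. lsum x F)" by (simp add: ml_def)
qed

lemma lsum_cocomm: "bml s F \<Longrightarrow> lsum x F = lsum x (\<lambda>u v. F v u)"
proof (induction x arbitrary: F)
  case (Cons h x)
  have "blin s (\<lambda>a b. lsum x (\<lambda>u v. F (a # u) (b # v)))"
    unfolding blin_def by (intro conjI allI lin_lsum_param bml_Cons Cons.prems)
  from dsum_cocomm[OF m this] Cons.IH[OF bml_Cons(1)[OF Cons.prems]] show ?case by simp
qed simp

lemma lsum_coassoc: "tml s F \<Longrightarrow>
  lsum x (\<lambda>u v. lsum u (\<lambda>u1 u2. F u1 u2 v)) = lsum x (\<lambda>u v. lsum v (\<lambda>v1 v2. F u v1 v2))"
proof (induction x arbitrary: F)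
  case (Cons h x)
  have F: "ml H s (\<lambda>u. F u v w)" "ml H s (\<lambda>v. F u v w)" "ml H s (F u v)" for u v w
    using Cons.prems by (simp_all add: tml_def)
  have T: "tml s (\<lambda>u v w. F (a # u) (b # v) (c # w))" for a b c
    unfolding tml_def using ml_ConsD(1)[OF F(1)] ml_ConsD(1)[OF F(2)] ml_ConsD(1)[OF F(3)] by simp
  note L = ml_ConsD(2)[OF F(1)] ml_ConsD(2)[OF F(2)] ml_ConsD(2)[OF F(3)]
  have t: "tlin s (\<lambda>a b c. lsum x (\<lambda>u v. lsum v (\<lambda>v1 v2. F (a # u) (b # v1) (c # v2))))"
    unfolding tlin_def by (intro conjI allI lin_lsum_param L)
  have "lsum (h # x) (\<lambda>u v. lsum u (\<lambda>u1 u2. F u1 u2 v))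
    = dsum (\<lambda>a b. dsum (\<lambda>a1 a2. lsum x (\<lambda>u v. lsum u (\<lambda>u1 u2. F (a1 # u1) (a2 # u2) (b # v)))) a) h"
    by (simp add: lsum_dsum)
  also have "\<dots> = dsum (\<lambda>a b. dsum (\<lambda>a1 a2. lsum x (\<lambda>u v. lsum v (\<lambda>v1 v2. F (a1 # u) (a2 # v1) (b # v2)))) a) h"
    by (simp add: Cons.IH[OF T])
  also have "\<dots> = dsum (\<lambda>a b. dsum (\<lambda>b1 b2. lsum x (\<lambda>u v. lsum v (\<lambda>v1 v2. F (a # u) (b1 # v1) (b2 # v2)))) b) h"
    by (rule dsum_coassoc[OF m t])
  finally show ?case by (simp add: lsum_dsum)
qed simp

lemma lsum_counit: "ml H s f \<Longrightarrow> lsum x (\<lambda>u v. s (lcou u) (f v)) = f x"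
proof (induction x arbitrary: f)
  case (Cons h x)
  note f = ml_ConsD(2)[OF Cons.prems] ml_ConsD(1)[OF Cons.prems]
  have "lsum (h # x) (\<lambda>u v. s (lcou u) (f v)) = dsum (\<lambda>a b. lsum x (\<lambda>u v. s (cou a) (s (lcou u) (f (b # v))))) h"
    by simp
  also have "\<dots> = dsum (\<lambda>a b. s (cou a) (f (b # x))) h"
    by (simp only: lsum_scale Cons.IH[OF f(2)])
  finally show ?case using dsum_counit(1)[OF m f(1)] by simp
qed simp

lemma ml_lcou: "ml H s (\<lambda>x. s (lcou x) c)"
proof -
  have "lcou (u @ (a + b) # v) = lcou (u @ a # v) + lcou (u @ b # v)" "lcou (u @ smul r a # v) = r * lcou (u @ a # v)" for u v a b r
    by (induction u) (auto simp: cou_simps algebra_simps)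
  then show ?thesis by (simp add: ml_def s.scale_left_distrib)
qed

lemma ml_scaled: "ml H s f \<Longrightarrow> ml H s (\<lambda>x. s c (f x))"
  by (simp add: ml_def s.scale_right_distrib mult.commute)

lemma lsum_counit': assumes "ml H s f" shows "lsum x (\<lambda>u v. s (lcou v) (f u)) = f x"
proof -
  have b: "bml s (\<lambda>u v. s (lcou u) (f v))" unfolding bml_def by (intro conjI allI ml_lcou ml_scaled assms)
  show ?thesis by (rule trans[OF lsum_cocomm[OF b, symmetric] lsum_counit[OF assms]])
qed

text \<open>Coassociativity regroups the four copies so that the middle two come from one
  comultiplication, and cocommutativity exchanges them. On this rests the fact that convolution
  preserves coalgebra morphisms.\<close>

lemma lsum_interchange:
  assumes "\<And>b c d. ml H s (\<lambda>a. G a b c d)" "\<And>a c d. ml H s (\<lambda>b. G a b c d)"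
    "\<And>a b d. ml H s (\<lambda>c. G a b c d)" "\<And>a b c. ml H s (\<lambda>d. G a b c d)"
  shows "lsum x (\<lambda>u v. lsum u (\<lambda>u1 u2. lsum v (\<lambda>v1 v2. G u1 u2 v1 v2)))
    = lsum x (\<lambda>u v. lsum u (\<lambda>u1 u2. lsum v (\<lambda>v1 v2. G u1 v1 u2 v2)))"
proof -
  have A: "lsum x (\<lambda>u v. lsum u (\<lambda>u1 u2. lsum v (\<lambda>v1 v2. K u1 u2 v1 v2)))
    = lsum x (\<lambda>u w. lsum w (\<lambda>p v2. lsum p (\<lambda>u2 v1. K u u2 v1 v2)))"
    if K: "\<And>b c d. ml H s (\<lambda>a. K a b c d)" "\<And>a c d. ml H s (\<lambda>b. K a b c d)"
    "\<And>a b d. ml H s (\<lambda>c. K a b c d)" "\<And>a b c. ml H s (\<lambda>d. K a b c d)" for K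
  proof -
    have "tml s (\<lambda>u1 u2 v. lsum v (\<lambda>v1 v2. K u1 u2 v1 v2))"
      unfolding tml_def by (intro conjI allI ml_lsum_param K lsum_ml) (auto simp: bml_def K)
    from lsum_coassoc[OF this]
    have 1: "lsum x (\<lambda>u v. lsum u (\<lambda>u1 u2. lsum v (\<lambda>v1 v2. K u1 u2 v1 v2)))
      = lsum x (\<lambda>u w. lsum w (\<lambda>u2 v. lsum v (\<lambda>v1 v2. K u u2 v1 v2)))" .
    have 2: "lsum w (\<lambda>u2 v. lsum v (\<lambda>v1 v2. K u u2 v1 v2)) = lsum w (\<lambda>p v2. lsum p (\<lambda>u2 v1. K u u2 v1 v2))" for u w
      by (rule lsum_coassoc[symmetric]) (auto simp: tml_def K)
    show ?thesis unfolding 1 2 ..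
  qed
  have C: "lsum p (\<lambda>u2 v1. G u u2 v1 v2) = lsum p (\<lambda>u2 v1. G u v1 u2 v2)" for p u v2
    by (rule lsum_cocomm) (auto simp: bml_def assms)
  show ?thesis unfolding A[of G, OF assms] A[of "\<lambda>a b c d. G a c b d", OF assms(1,3,2,4)] C ..
qed

end

end

section \<open>The group of coalgebra morphisms\<close>

context hopf begin

lemma dsum_interchange:
  fixes s :: "'k \<Rightarrow> 'v \<Rightarrow> 'v::ab_group_add"
  assumes m: "module s" and G: "\<And>b c d. lin H s (\<lambda>a. G a b c d)" "\<And>a c d. lin H s (\<lambda>b. G a b c d)"
    "\<And>a b d. lin H s (\<lambda>c. G a b c d)" "\<And>a b c. lin H s (\<lambda>d. G a b c d)"
  shows "dsum (\<lambda>u v. dsum (\<lambda>u1 u2. dsum (\<lambda>v1 v2. G u1 u2 v1 v2) v) u) h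
    = dsum (\<lambda>u v. dsum (\<lambda>u1 u2. dsum (\<lambda>v1 v2. G u1 v1 u2 v2) v) u) h"
proof -
  have A: "dsum (\<lambda>u v. dsum (\<lambda>u1 u2. dsum (\<lambda>v1 v2. K u1 u2 v1 v2) v) u) h
    = dsum (\<lambda>u w. dsum (\<lambda>p v2. dsum (\<lambda>u2 v1. K u u2 v1 v2) p) w) h"
    if K: "\<And>b c d. lin H s (\<lambda>a. K a b c d)" "\<And>a c d. lin H s (\<lambda>b. K a b c d)"
    "\<And>a b d. lin H s (\<lambda>c. K a b c d)" "\<And>a b c. lin H s (\<lambda>d. K a b c d)" for K
  proof -
    have "tlin s (\<lambda>u1 u2 v. dsum (\<lambda>v1 v2. K u1 u2 v1 v2) v)"
      unfolding tlin_def by (intro conjI allI lin_dsum_param[OF m] K dsum_lin[OF m]) (auto simp: blin_def K)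
    from dsum_coassoc[OF m this]
    have 1: "dsum (\<lambda>u v. dsum (\<lambda>u1 u2. dsum (\<lambda>v1 v2. K u1 u2 v1 v2) v) u) h
      = dsum (\<lambda>u w. dsum (\<lambda>u2 v. dsum (\<lambda>v1 v2. K u u2 v1 v2) v) w) h" .
    have 2: "dsum (\<lambda>u2 v. dsum (\<lambda>v1 v2. K u u2 v1 v2) v) w = dsum (\<lambda>p v2. dsum (\<lambda>u2 v1. K u u2 v1 v2) p) w" for u w
      by (rule dsum_coassoc[OF m, symmetric]) (auto simp: tlin_def K)
    show ?thesis unfolding 1 2 ..
  qed
  have C: "dsum (\<lambda>u2 v1. G u u2 v1 v2) p = dsum (\<lambda>u2 v1. G u v1 u2 v2) p" for p u v2
    by (rule dsum_cocomm[OF m]) (auto simp: blin_def G)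
  show ?thesis unfolding A[of G, OF G] A[of "\<lambda>a b c d. G a c b d", OF G(1,3,2,4)] C ..
qed

lemma lin_comp_mul:
  assumes "lin H s f"
  shows "lin H s (\<lambda>a. f (a \<odot> c))" "lin H s (\<lambda>a. f (c \<odot> a))" "lin H s (\<lambda>a. f (S a))"
  using assms by (simp_all add: lin_def mul_simps S_simps)

lemma lin_cou: "module s \<Longrightarrow> lin H s (\<lambda>a. s (cou a) c)"
  by (simp add: lin_def cou_simps module.scale_left_distrib module.scale_scale)

lemma dsum_smul: "lin H s f \<Longrightarrow> dsum (\<lambda>a b. f (F a b)) h = f (dsum F h)"
  by (rule dsum_hom[symmetric]) (auto simp: lin_zero linD)

text \<open>Uniqueness of convolution inverses: comultiplication after the antipode is a left
  inverse of comultiplication, and the antipode on both factors after comultiplication is a right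
  inverse. \<open>X\<close> is the triple product of the three maps, contracted in two ways.\<close>

lemma dsum_S:
  fixes s :: "'k \<Rightarrow> 'v \<Rightarrow> 'v::ab_group_add"
  assumes m: "module s" and F: "blin s F"
  shows "dsum F (S h) = dsum (\<lambda>a b. F (S a) (S b)) h"
proof -
  have F1: "lin H s (\<lambda>a. F a b)" and F2: "lin H s (F a)" for a b using F by (auto simp: blin_def)
  note L = lin_comp_mul[OF F1] lin_comp_mul[OF F2]
  define X where "X a1 a2 a3 = dsum (\<lambda>u v. dsum (\<lambda>p q. dsum (\<lambda>r t. F (u \<odot> p \<odot> S r) (v \<odot> q \<odot> S t)) a3) a2) (S a1)" for a1 a2 a3
  have LL: "lin H s (\<lambda>p. F (u \<odot> p \<odot> S r) w)" "lin H s (\<lambda>u. F (u \<odot> p \<odot> S r) w)" "lin H s (\<lambda>r. F (u \<odot> p \<odot> S r) w)"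
    "lin H s (\<lambda>p. F w (u \<odot> p \<odot> S r))" "lin H s (\<lambda>u. F w (u \<odot> p \<odot> S r))" "lin H s (\<lambda>r. F w (u \<odot> p \<odot> S r))" for u p r w
    using F1 F2 by (simp_all add: lin_def mul_simps S_simps)
  have t: "tlin s X"
    unfolding tlin_def
  proof (intro conjI allI)
    fix a2 a3
    have "lin H s (\<lambda>b. dsum (\<lambda>u v. dsum (\<lambda>p q. dsum (\<lambda>r t. F (u \<odot> p \<odot> S r) (v \<odot> q \<odot> S t)) a3) a2) b)"
      by (rule dsum_lin[OF m]) (auto simp: blin_def intro!: lin_dsum_param[OF m] LL)
    then show "lin H s (\<lambda>a1. X a1 a2 a3)" unfolding X_def by (rule lin_comp_mul(3))
  next
    fix a1 a3 show "lin H s (\<lambda>a2. X a1 a2 a3)" unfolding X_def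
      by (intro lin_dsum_param[OF m] dsum_lin[OF m]) (auto simp: blin_def intro!: lin_dsum_param[OF m] LL)
  next
    fix a1 a2 show "lin H s (X a1 a2)" unfolding X_def
      by (intro lin_dsum_param[OF m] dsum_lin[OF m]) (auto simp: blin_def intro!: lin_dsum_param[OF m] LL)
  qed
  have 1: "dsum (\<lambda>a1 a2. X a1 a2 a3) b = s (cou b) (dsum (\<lambda>r t. F (S r) (S t)) a3)" for a3 b
  proof -
    have bl: "blin s (\<lambda>x y. dsum (\<lambda>r t. F (x \<odot> S r) (y \<odot> S t)) a3)"
      unfolding blin_def by (intro conjI allI lin_dsum_param[OF m] L)
    have "dsum (\<lambda>a1 a2. X a1 a2 a3) b = dsum (\<lambda>a1 a2. dsum (\<lambda>x y. dsum (\<lambda>r t. F (x \<odot> S r) (y \<odot> S t)) a3) (S a1 \<odot> a2)) b"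
      unfolding dsum_mult[OF m bl] X_def ..
    also have "\<dots> = dsum (\<lambda>x y. dsum (\<lambda>r t. F (x \<odot> S r) (y \<odot> S t)) a3) (dsum (\<lambda>a1 a2. S a1 \<odot> a2) b)"
      by (rule dsum_smul[OF dsum_lin[OF m bl]])
    also have "\<dots> = s (cou b) (dsum (\<lambda>r t. F (S r) (S t)) a3)"
      unfolding antipode linD(2)[OF dsum_lin[OF m bl]] dsum_one[OF m bl] by simp
    finally show ?thesis .
  qed
  \<comment> \<open>Cocommutativity enters here: the middle exchange brings each factor of
    \<open>a2\<close> next to the antipode that cancels it.\<close>
  have 2: "dsum (\<lambda>a2 a3. X a1 a2 a3) b = s (cou b) (dsum F (S a1))" for a1 b
  proof -
    have "dsum (\<lambda>a2 a3. dsum (\<lambda>p q. dsum (\<lambda>r t. F (u \<odot> p \<odot> S r) (v \<odot> q \<odot> S t)) a3) a2) b = s (cou b) (F u v)" for u v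
    proof -
      have "dsum (\<lambda>a2 a3. dsum (\<lambda>p q. dsum (\<lambda>r t. F (u \<odot> p \<odot> S r) (v \<odot> q \<odot> S t)) a3) a2) b
         = dsum (\<lambda>a2 a3. dsum (\<lambda>p q. dsum (\<lambda>r t. F (u \<odot> p \<odot> S q) (v \<odot> r \<odot> S t)) a3) a2) b"
        by (rule dsum_interchange[OF m]) (intro LL)+
      also have "\<dots> = dsum (\<lambda>a2 a3. F (u \<odot> dsum (\<lambda>p q. p \<odot> S q) a2) (v \<odot> dsum (\<lambda>r t. r \<odot> S t) a3)) b"
        unfolding mul_assoc
        by (simp only: dsum_smul[OF lin_comp_mul(2)[OF F2]] dsum_smul[OF lin_comp_mul(2)[OF F1]])
      also have "\<dots> = dsum (\<lambda>a2 a3. s (cou a2) (s (cou a3) (F u v))) b"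
        unfolding antipode
        by (simp add: mul_simps linD(2)[OF F1] linD(2)[OF F2] module.scale_scale[OF m] mult.commute)
      also have "\<dots> = s (cou b) (F u v)"
        by (rule dsum_counit(1)[OF m lin_cou[OF m]])
      finally show ?thesis .
    qed
    then have "dsum (\<lambda>u v. dsum (\<lambda>a2 a3. dsum (\<lambda>p q. dsum (\<lambda>r t. F (u \<odot> p \<odot> S r) (v \<odot> q \<odot> S t)) a3) a2) b) (S a1)
      = s (cou b) (dsum F (S a1))" by (simp add: dsum_scale[OF m])
    then show ?thesis unfolding X_def by (subst dsum_swap)
  qed
  have "dsum (\<lambda>a b. F (S a) (S b)) h = dsum (\<lambda>b a3. s (cou b) (dsum (\<lambda>r t. F (S r) (S t)) a3)) h"
    by (rule dsum_counit(1)[OF m, symmetric], rule dsum_lin[OF m]) (auto simp: blin_def intro!: lin_comp_mul F1 F2)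
  also have "\<dots> = dsum (\<lambda>b a3. dsum (\<lambda>a1 a2. X a1 a2 a3) b) h" unfolding 1 ..
  also have "\<dots> = dsum (\<lambda>a1 b. dsum (\<lambda>a2 a3. X a1 a2 a3) b) h" by (rule dsum_coassoc[OF m t])
  also have "\<dots> = dsum (\<lambda>a1 b. s (cou b) (dsum F (S a1))) h" unfolding 2 ..
  also have "\<dots> = dsum F (S h)"
    by (rule dsum_counit(2)[OF m]) (rule lin_comp_mul(3)[OF dsum_lin[OF m F]])
  finally show ?thesis by simp
qed

lemma cou_S: "cou (S h) = cou h"
proof -
  have l: "lin H (*) cou" by (simp add: lin_def cou_simps)
  have "cou h = cou (dsum (\<lambda>a b. S a \<odot> b) h)" by (simp add: antipode cou_simps)
  also have "\<dots> = dsum (\<lambda>a b. cou (S a \<odot> b)) h" by (rule dsum_smul[OF l, symmetric])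
  also have "\<dots> = dsum (\<lambda>a b. cou b * cou (S a)) h" by (simp add: cou_simps mult.commute)
  also have "\<dots> = cou (S h)" by (rule dsum_counit(2)[OF module_times lin_comp_mul(3)[OF l]])
  finally show ?thesis by simp
qed

text \<open>Coalgebra morphisms from a tensor power of H to H. Cocommutativity makes them a group
  under convolution, so that identities between them are identities between group words.\<close>
definition mor :: "('h list \<Rightarrow> 'h) \<Rightarrow> bool" where
  "mor p \<longleftrightarrow> ml H smul p \<and> (\<forall>x. cou (p x) = lcou x)
    \<and> (\<forall>F x. blin (*) F \<longrightarrow> dsum F (p x) = lsum x (\<lambda>u v. F (p u) (p v) :: 'k))"

lemma morD: assumes "mor p" shows "ml H smul p" "cou (p x) = lcou x"
  using assms by (auto simp: mor_def)

text \<open>\<open>mor\<close> asks for this identity under scalar forms only. By separation the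
  difference \<open>D\<close> of the two tensors then lies in \<open>tensor_rel\<close>, where
  bilinear maps into any module vanish.\<close>

lemma mor_dsum:
  fixes s :: "'k \<Rightarrow> 'v \<Rightarrow> 'v::ab_group_add"
  assumes m: "module s" and p: "mor p" and F: "blin s F"
  shows "dsum F (p x) = lsum x (\<lambda>u v. F (p u) (p v))"
proof -
  let ?C = "choices (map (hDelta H) x)"
  define D :: "'h list \<Rightarrow> 'k" where
    "D = (\<Sum>q\<leftarrow>hDelta H (p x). gen [fst q, snd q]) - (\<Sum>q\<leftarrow>?C. gen [p (map fst q), p (map snd q)])"
  have pD: "pair s' \<mu> D = dsum (\<lambda>a b. \<mu> [a, b]) (p x) - lsum x (\<lambda>u v. \<mu> [p u, p v])"
    if "module s'" for s' :: "'k \<Rightarrow> 'w \<Rightarrow> 'w::ab_group_add" and \<mu>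
    unfolding D_def using that
    by (simp add: pair_diff fin_gens pair_gens dsum_def lsum_choices[symmetric])
  have "D \<in> FS 2" unfolding D_def by (intro FS_diff FS_sum_list FS_gen) auto
  then have "D \<in> tensor_rel H 2"
  proof (rule tensor_rel_separation)
    fix \<mu> assume \<mu>: "ml H (*) \<mu>"
    have "blin (*) (\<lambda>a b. \<mu> [a, b])"
      unfolding blin_def using ml_ConsD(2)[OF module_times \<mu>] ml_ConsD(2)[OF module_times ml_ConsD(1)[OF module_times \<mu>]] by blast
    then show "pair (*) \<mu> D = 0" using p by (simp add: pD[OF module_times] mor_def)
  qed
  from pair_tensor_rel[OF m ml_2[OF m F] this] show ?thesis by (simp add: pD[OF m])
qed

lemma ml_comp: "lin H s f \<Longrightarrow> ml H smul p \<Longrightarrow> ml H s (\<lambda>u. f (p u))"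
  by (simp add: ml_def lin_def)

lemma ml_mul: "ml H smul p \<Longrightarrow> ml H smul (\<lambda>x. p x \<odot> c)" "ml H smul p \<Longrightarrow> ml H smul (\<lambda>x. c \<odot> p x)"
  by (simp_all add: ml_def mul_simps)

definition unitm :: "'h list \<Rightarrow> 'h" where "unitm x = smul (lcou x) one"
definition conv :: "('h list \<Rightarrow> 'h) \<Rightarrow> ('h list \<Rightarrow> 'h) \<Rightarrow> 'h list \<Rightarrow> 'h" where
  "conv p q x = lsum x (\<lambda>u v. p u \<odot> q v)"
definition invm :: "('h list \<Rightarrow> 'h) \<Rightarrow> 'h list \<Rightarrow> 'h" where "invm p x = S (p x)"

text \<open>The factor with index \<open>i\<close>, the others being sent through the counit.
  Missing factors of a short word count as 1, which keeps the laws of a coalgebra morphism valid on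
  words of every length.\<close>

fun proj :: "nat \<Rightarrow> 'h list \<Rightarrow> 'h" where
  "proj i [] = one"
| "proj 0 (h # x) = smul (lcou x) h"
| "proj (Suc i) (h # x) = smul (cou h) (proj i x)"

lemma lin_cou1: "lin H (*) cou" by (simp add: lin_def cou_simps)

lemma lsum_lcou: "module s \<Longrightarrow> lsum x (\<lambda>u v. s (lcou u) (s (lcou v) c)) = s (lcou x) c"
  by (rule lsum_counit) (auto intro: ml_lcou)

lemma mor_unit: "mor unitm"
  unfolding mor_def
proof (intro conjI allI impI)
  show "ml H smul unitm" unfolding unitm_def by (rule ml_lcou[OF mod_smul])
  show "cou (unitm x) = lcou x" for x by (simp add: unitm_def cou_simps)
  fix F :: "'h \<Rightarrow> 'h \<Rightarrow> 'k" and x assume F: "blin (*) F"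
  have F1: "lin H (*) (\<lambda>a. F a b)" "lin H (*) (F a)" for a b using F by (auto simp: blin_def)
  show "dsum F (unitm x) = lsum x (\<lambda>u v. F (unitm u) (unitm v))"
    using lsum_lcou[OF module_times, of x "F one one"]
    by (simp add: unitm_def linD(2)[OF dsum_lin[OF module_times F]] dsum_one[OF module_times F] linD(2)[OF F1(1)] linD(2)[OF F1(2)] mult_ac)
qed

lemma mor_inv: assumes p: "mor p" shows "mor (invm p)"
  unfolding mor_def
proof (intro conjI allI impI)
  show "ml H smul (invm p)" using morD(1)[OF p] by (simp add: invm_def ml_def S_simps)
  show "cou (invm p x) = lcou x" for x by (simp add: invm_def cou_S morD(2)[OF p])
  fix F :: "'h \<Rightarrow> 'h \<Rightarrow> 'k" and x assume F: "blin (*) F"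
  then have F': "blin (*) (\<lambda>a b. F (S a) (S b))" by (auto simp: blin_def intro: lin_comp_mul)
  show "dsum F (invm p x) = lsum x (\<lambda>u v. F (invm p u) (invm p v))"
    unfolding invm_def dsum_S[OF module_times F] by (rule mor_dsum[OF module_times p F'])
qed

lemma lsum_lin: "lin H s f \<Longrightarrow> f (lsum x F) = lsum x (\<lambda>u v. f (F u v))"
  by (rule lsum_hom) (auto simp: lin_zero linD)

lemma mor_conv: assumes p: "mor p" and q: "mor q" shows "mor (conv p q)"
  unfolding mor_def
proof (intro conjI allI impI)
  note pq = morD(1)[OF p] morD(1)[OF q]
  show "ml H smul (conv p q)" unfolding conv_def
    by (rule lsum_ml[OF mod_smul]) (auto simp: bml_def intro: ml_mul pq)
  show "cou (conv p q x) = lcou x" for x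
  proof -
    have "cou (conv p q x) = lsum x (\<lambda>u v. lcou u * (lcou v * 1))"
      unfolding conv_def lsum_lin[OF lin_cou1] by (simp add: cou_simps morD(2)[OF p] morD(2)[OF q])
    then show ?thesis using lsum_lcou[OF module_times, of x 1] by simp
  qed
  fix F :: "'h \<Rightarrow> 'h \<Rightarrow> 'k" and x assume F: "blin (*) F"
  have F1: "lin H (*) (\<lambda>a. F a b)" "lin H (*) (F a)" for a b using F by (auto simp: blin_def)
  have b1: "blin (*) (\<lambda>a1 a2. dsum (\<lambda>b1 b2. F (a1 \<odot> b1) (a2 \<odot> b2)) c)" for c
    unfolding blin_def by (intro conjI allI lin_dsum_param[OF module_times] lin_comp_mul(1) F1)
  have b2: "blin (*) (\<lambda>b1 b2. F (a1 \<odot> b1) (a2 \<odot> b2))" for a1 a2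
    unfolding blin_def by (intro conjI allI lin_comp_mul(2) F1)
  have "dsum F (conv p q x) = lsum x (\<lambda>u v. dsum F (p u \<odot> q v))"
    unfolding conv_def by (rule lsum_lin[OF dsum_lin[OF module_times F]])
  also have "\<dots> = lsum x (\<lambda>u v. lsum u (\<lambda>u1 u2. lsum v (\<lambda>v1 v2. F (p u1 \<odot> q v1) (p u2 \<odot> q v2))))"
    unfolding dsum_mult[OF module_times F] mor_dsum[OF module_times p b1]
    unfolding mor_dsum[OF module_times q b2] ..
  also have "\<dots> = lsum x (\<lambda>u v. lsum u (\<lambda>u1 u2. lsum v (\<lambda>v1 v2. F (p u1 \<odot> q u2) (p v1 \<odot> q v2))))"
    by (rule lsum_interchange[OF module_times]) (intro ml_comp[OF _ pq(1)] ml_comp[OF _ pq(2)] lin_comp_mul(1,2) F1)+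
  also have "\<dots> = lsum x (\<lambda>u v. F (conv p q u) (conv p q v))"
    unfolding conv_def lsum_lin[OF F1(1)] unfolding lsum_lin[OF F1(2)] ..
  finally show "dsum F (conv p q x) = lsum x (\<lambda>u v. F (conv p q u) (conv p q v))" .
qed

lemma mor_proj: "mor (proj i)"
  unfolding mor_def
proof (intro conjI allI impI)
  show "ml H smul (proj i)"
  proof (induction i)
    case 0
    show ?case unfolding ml_Cons_iff[of H smul "proj 0"]
      using ml_lcou[OF mod_smul] by (auto simp: lin_def H.scale_right_distrib mult.commute)
  next
    case (Suc i)
    show ?case unfolding ml_Cons_iff[of H smul "proj (Suc i)"]
      using ml_scaled[OF mod_smul Suc] lin_cou[OF mod_smul] by simp
  qed
  show "cou (proj i x) = lcou x" for x by (induction i x rule: proj.induct) (auto simp: cou_simps mult.commute)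
  fix F :: "'h \<Rightarrow> 'h \<Rightarrow> 'k" and x assume F: "blin (*) F"
  have F1: "lin H (*) (\<lambda>a. F a b)" "lin H (*) (F a)" for a b using F by (auto simp: blin_def)
  note D = linD(2)[OF dsum_lin[OF module_times F]] and FS = linD(2)[OF F1(1)] linD(2)[OF F1(2)]
  show "dsum F (proj i x) = lsum x (\<lambda>u v. F (proj i u) (proj i v))"
  proof (induction i x rule: proj.induct)
    case (1 i) show ?case by (simp add: dsum_one[OF module_times F])
  next
    case (2 h x)
    show ?case by (simp add: D FS lsum_lcou[OF module_times] dsum_scale[OF module_times])
  next
    case (3 i h x)
    have "lsum (h # x) (\<lambda>u v. F (proj (Suc i) u) (proj (Suc i) v))
      = dsum (\<lambda>a b. cou a * (cou b * lsum x (\<lambda>u v. F (proj i u) (proj i v)))) h"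
      by (simp add: FS lsum_scale[OF module_times])
    also have "\<dots> = cou h * lsum x (\<lambda>u v. F (proj i u) (proj i v))"
      by (rule dsum_counit(1)[OF module_times lin_cou[OF module_times]])
    finally show ?case by (simp add: D 3)
  qed
qed

lemma conv_assoc: assumes "mor p" "mor q" "mor r" shows "conv (conv p q) r = conv p (conv q r)"
proof
  fix x
  note M = assms[THEN morD(1)]
  have "tml smul (\<lambda>u v w. p u \<odot> q v \<odot> r w)"
    unfolding tml_def by (intro conjI allI ml_mul M)
  from lsum_coassoc[OF mod_smul this]
  have "lsum x (\<lambda>u v. lsum u (\<lambda>u1 u2. p u1 \<odot> q u2 \<odot> r v)) = lsum x (\<lambda>u v. lsum v (\<lambda>v1 v2. p u \<odot> q v1 \<odot> r v2))" .
  moreover have "lsum u (\<lambda>u1 u2. p u1 \<odot> q u2) \<odot> c = lsum u (\<lambda>u1 u2. p u1 \<odot> q u2 \<odot> c)" for u c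
    by (rule lsum_lin[where s = smul]) (simp add: lin_def mul_simps)
  moreover have "c \<odot> lsum u (\<lambda>u1 u2. q u1 \<odot> r u2) = lsum u (\<lambda>u1 u2. c \<odot> (q u1 \<odot> r u2))" for u c
    by (rule lsum_lin[where s = smul]) (simp add: lin_def mul_simps)
  ultimately show "conv (conv p q) r x = conv p (conv q r) x"
    unfolding conv_def by (simp add: mul_assoc)
qed

lemma conv_unit: assumes "mor p" shows "conv unitm p = p" "conv p unitm = p"
  using lsum_counit[OF mod_smul morD(1)[OF assms]] lsum_counit'[OF mod_smul morD(1)[OF assms]]
  by (auto simp: conv_def unitm_def mul_simps fun_eq_iff)

lemma conv_inv: assumes p: "mor p" shows "conv (invm p) p = unitm" "conv p (invm p) = unitm"
proof -
  have "blin smul (\<lambda>a b. S a \<odot> b)" "blin smul (\<lambda>a b. a \<odot> S b)"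
    by (auto simp: blin_def lin_def mul_simps S_simps)
  from this[THEN mor_dsum[OF mod_smul p]] show "conv (invm p) p = unitm" "conv p (invm p) = unitm"
    by (auto simp: conv_def invm_def unitm_def antipode morD(2)[OF p] fun_eq_iff)
qed

end

section \<open>Operators given by tuples of coalgebra morphisms\<close>

context hopf begin

abbreviation "mors ps \<equiv> \<forall>p\<in>set ps. mor p"

text \<open>In Sweedler notation, the value of \<open>\<mu>\<close> on the word of all
  \<open>p\<^sub>j\<close> applied to the successive copies of \<open>x\<close>. Passing
  \<open>\<mu>\<close> along as a continuation avoids tensors as intermediate results.\<close>

primrec ev :: "('k \<Rightarrow> 'v \<Rightarrow> 'v) \<Rightarrow> ('h list \<Rightarrow> 'h) list \<Rightarrow> ('h list \<Rightarrow> 'v) \<Rightarrow> 'h list \<Rightarrow> 'v::ab_group_add" where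
  "ev s [] = (\<lambda>\<mu> x. s (lcou x) (\<mu> []))"
| "ev s (p # ps) = (\<lambda>\<mu> x. lsum x (\<lambda>u v. ev s ps (\<lambda>r. \<mu> (p u # r)) v))"

context
  fixes s :: "'k \<Rightarrow> 'v \<Rightarrow> 'v::ab_group_add"
  assumes m: "module s"
begin

interpretation s: module s by (rule m)

lemma ev_add': "ev s ps (\<lambda>r. \<mu> r + \<nu> r) = (\<lambda>x. ev s ps \<mu> x + ev s ps \<nu> x)"
  by (induction ps arbitrary: \<mu> \<nu>) (simp_all add: s.scale_right_distrib lsum_add)

lemma ev_scale': "ev s ps (\<lambda>r. s c (\<mu> r)) = (\<lambda>x. s c (ev s ps \<mu> x))"
  by (induction ps arbitrary: \<mu>) (simp_all add: lsum_scale[OF m] mult.commute)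

lemma ev_add: "ev s ps (\<lambda>r. \<mu> r + \<nu> r) x = ev s ps \<mu> x + ev s ps \<nu> x"
  by (simp add: ev_add')

lemma ev_scale: "ev s ps (\<lambda>r. s c (\<mu> r)) x = s c (ev s ps \<mu> x)"
  by (simp add: ev_scale')

lemma ev_0: "ev s ps (\<lambda>r. 0) x = 0"
  using ev_scale[of ps 0 "\<lambda>_. 0" x] by simp

lemma ev_sum_list: "ev s ps (\<lambda>r. \<Sum>p\<leftarrow>L. \<mu> p r) x = (\<Sum>p\<leftarrow>L. ev s ps (\<mu> p) x)"
  by (induction L) (simp_all add: ev_add ev_0)

lemma ev_dsum: "ev s ps (\<lambda>r. dsum (\<lambda>a b. F a b r) h) x = dsum (\<lambda>a b. ev s ps (F a b) x) h"
  unfolding dsum_def by (rule ev_sum_list)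

lemma ev_lsum: "ev s ps (\<lambda>r. lsum y (\<lambda>a b. F a b r)) x = lsum y (\<lambda>a b. ev s ps (F a b) x)"
  by (induction y arbitrary: F) (simp_all add: ev_dsum)

lemma lin_ev_param: assumes "\<And>r. lin H s (\<lambda>g. \<mu> g r)" shows "lin H s (\<lambda>g. ev s ps (\<mu> g) x)"
proof -
  have "\<mu> (a + b) = (\<lambda>r. \<mu> a r + \<mu> b r)" "\<mu> (smul c a) = (\<lambda>r. s c (\<mu> a r))" for a b c
    using assms by (auto simp: lin_def)
  then show ?thesis by (simp add: lin_def ev_add ev_scale)
qed

lemma ml_ev_param: assumes "\<And>r. ml H s (\<lambda>g. \<mu> g r)" shows "ml H s (\<lambda>g. ev s ps (\<mu> g) x)"
proof -
  have "\<mu> (u @ (a + b) # v) = (\<lambda>r. \<mu> (u @ a # v) r + \<mu> (u @ b # v) r)"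
    "\<mu> (u @ smul c a # v) = (\<lambda>r. s c (\<mu> (u @ a # v) r))" for u v a b c
    using assms by (auto simp: ml_def)
  then show ?thesis by (simp add: ml_def ev_add ev_scale)
qed

lemma ev_ml: "(\<And>p. p \<in> set ps \<Longrightarrow> ml H smul p) \<Longrightarrow> ml H s \<mu> \<Longrightarrow> ml H s (ev s ps \<mu>)"
proof (induction ps arbitrary: \<mu>)
  case Nil
  show ?case using ml_lcou[OF m] by simp
next
  case (Cons p ps)
  have "bml s (\<lambda>u v. ev s ps (\<lambda>r. \<mu> (p u # r)) v)"
    unfolding bml_def
  proof (intro conjI allI)
    show "ml H s (\<lambda>u. ev s ps (\<lambda>r. \<mu> (p u # r)) v)" for v
      by (intro ml_ev_param ml_comp[of s "\<lambda>h. \<mu> (h # _)" p] ml_ConsD(2)[OF m Cons.prems(2)] Cons.prems(1)) simp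
    show "ml H s (ev s ps (\<lambda>r. \<mu> (p u # r)))" for u
      by (intro Cons.IH ml_ConsD(1)[OF m Cons.prems(2)] Cons.prems(1)) simp
  qed
  from lsum_ml[OF m this] show ?case by simp
qed

lemma ev_cong: "(\<And>r. length r = length ps \<Longrightarrow> \<mu> r = \<nu> r) \<Longrightarrow> ev s ps \<mu> = ev s ps \<nu>"
proof (induction ps arbitrary: \<mu> \<nu>)
  case (Cons p ps)
  have "ev s ps (\<lambda>r. \<mu> (p u # r)) = ev s ps (\<lambda>r. \<nu> (p u # r))" for u
    by (rule Cons.IH) (simp add: Cons.prems)
  then show ?case by simp
qed simp

lemma ev_lcou: "mors ps \<Longrightarrow> ev s ps (\<lambda>y. s (lcou y) c) x = s (lcou x) c"
proof (induction ps arbitrary: x)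
  case (Cons p ps)
  have "ev s (p # ps) (\<lambda>y. s (lcou y) c) x = lsum x (\<lambda>u v. ev s ps (\<lambda>r. s (lcou u) (s (lcou r) c)) v)"
    using Cons.prems by (simp add: morD(2))
  also have "\<dots> = lsum x (\<lambda>u v. s (lcou u) (s (lcou v) c))"
  proof -
    have ih: "ev s ps (\<lambda>y. s (lcou y) c) = (\<lambda>x. s (lcou x) c)" using Cons by auto
    show ?thesis by (simp only: ev_scale' ih)
  qed
  finally show ?case by (simp only: lsum_lcou[OF m])
qed simp

text \<open>A tuple of coalgebra morphisms is again one: comultiplying its output amounts to
  applying it to two copies of the input. The step uses the middle exchange to pair the first
  entries apart from the rest.\<close>

lemma ev_dup: "mors ps \<Longrightarrow> bml s G \<Longrightarrow>
  ev s ps (\<lambda>y. lsum y G) x = lsum x (\<lambda>u v. ev s ps (\<lambda>y. ev s ps (\<lambda>z. G y z) v) u)"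
proof (induction ps arbitrary: G x)
  case Nil
  show ?case using lsum_lcou[OF m, of x "G [] []"] by simp
next
  case (Cons p ps)
  have p: "mor p" and ps: "mors ps" using Cons.prems(1) by auto
  note mp = morD(1)[OF p]
  have pml: "ml H smul q" if "q \<in> set ps" for q using morD(1) ps that by blast
  note G = Cons.prems(2)
  have bl: "blin s (\<lambda>a b. lsum v (\<lambda>v1 v2. ev s ps (\<lambda>y. ev s ps (\<lambda>z. G (a # y) (b # z)) v2) v1))" for v
    unfolding blin_def
    by (intro conjI allI lin_lsum_param[OF m] lin_ev_param bml_Cons(2,3)[OF m G])
  have "ev s (p # ps) (\<lambda>y. lsum y G) x
     = lsum x (\<lambda>u v. ev s ps (\<lambda>r. dsum (\<lambda>a b. lsum r (\<lambda>c d. G (a # c) (b # d))) (p u)) v)" by simp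
  also have "\<dots> = lsum x (\<lambda>u v. dsum (\<lambda>a b. lsum v (\<lambda>v1 v2. ev s ps (\<lambda>y. ev s ps (\<lambda>z. G (a # y) (b # z)) v2) v1)) (p u))"
    by (simp only: ev_dsum Cons.IH[OF ps bml_Cons(1)[OF m G]])
  also have "\<dots> = lsum x (\<lambda>u v. lsum u (\<lambda>u1 u2. lsum v (\<lambda>v1 v2. ev s ps (\<lambda>y. ev s ps (\<lambda>z. G (p u1 # y) (p u2 # z)) v2) v1)))"
    unfolding mor_dsum[OF m p bl] ..
  also have "\<dots> = lsum x (\<lambda>u v. lsum u (\<lambda>u1 u2. lsum v (\<lambda>v1 v2. ev s ps (\<lambda>y. ev s ps (\<lambda>z. G (p u1 # y) (p v1 # z)) v2) u2)))"
  proof (rule lsum_interchange[OF m])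
    show "ml H s (\<lambda>a. ev s ps (\<lambda>y. ev s ps (\<lambda>z. G (p a # y) (p b # z)) d) c)" for b c d
      by (intro ml_ev_param ml_comp[OF _ mp] bml_Cons(2)[OF m G])
    show "ml H s (\<lambda>b. ev s ps (\<lambda>y. ev s ps (\<lambda>z. G (p a # y) (p b # z)) d) c)" for a c d
      by (intro ml_ev_param ml_comp[OF _ mp] bml_Cons(3)[OF m G])
    have B: "bml s (\<lambda>y z. G (p a # y) (p b # z))" for a b by (rule bml_Cons(1)[OF m G])
    show "ml H s (\<lambda>c. ev s ps (\<lambda>y. ev s ps (\<lambda>z. G (p a # y) (p b # z)) d) c)" for a b d
      by (intro ev_ml pml ml_ev_param) (use B in \<open>simp_all add: bml_def\<close>)
    show "ml H s (\<lambda>d. ev s ps (\<lambda>y. ev s ps (\<lambda>z. G (p a # y) (p b # z)) d) c)" for a b c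
    proof -
      have "ml H s (ev s ps (\<lambda>z. G (p a # y) (p b # z)))" for y
        by (intro ev_ml pml) (use B in \<open>simp_all add: bml_def\<close>)
      then show ?thesis by (intro ml_ev_param)
    qed
  qed
  also have "\<dots> = lsum x (\<lambda>u v. lsum u (\<lambda>u1 u2. ev s ps (\<lambda>y. lsum v (\<lambda>v1 v2. ev s ps (\<lambda>z. G (p u1 # y) (p v1 # z)) v2)) u2))"
    unfolding ev_lsum ..
  finally show ?case by simp
qed

end

lemma ev_push:
  fixes s :: "'k \<Rightarrow> 'v \<Rightarrow> 'v::ab_group_add" and t :: "'k \<Rightarrow> 'w \<Rightarrow> 'w::ab_group_add"
  assumes M: "M 0 = 0" "\<And>a b. M (a + b) = M a + M b" "\<And>c a. M (s c a) = t c (M a)"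
  shows "M (ev s ps q x) = ev t ps (\<lambda>y. M (q y)) x"
  by (induction ps arbitrary: q x) (simp_all add: M lsum_hom[of M])

definition cmp_ev :: "('h list \<Rightarrow> 'h) list \<Rightarrow> ('h list \<Rightarrow> 'h) \<Rightarrow> 'h list \<Rightarrow> 'h" where
  "cmp_ev ps q = ev smul ps q"

lemma ev_push_lin: "lin H s M \<Longrightarrow> M (cmp_ev ps q x) = ev s ps (\<lambda>y. M (q y)) x"
  unfolding cmp_ev_def by (rule ev_push) (auto simp: lin_zero linD)

text \<open>Every entry of the second tuple needs its own copy of the intermediate word.
  \<open>ev_dup\<close> replaces these by copies of the input, so that each entry absorbs the first
  tuple separately.\<close>

lemma ev_comp:
  fixes s :: "'k \<Rightarrow> 'v \<Rightarrow> 'v::ab_group_add"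
  assumes m: "module s" and ps: "mors ps"
  shows "(\<And>q. q \<in> set qs \<Longrightarrow> ml H smul q) \<Longrightarrow> ml H s \<mu> \<Longrightarrow>
    ev s ps (ev s qs \<mu>) x = ev s (map (cmp_ev ps) qs) \<mu> x"
proof (induction qs arbitrary: \<mu> x)
  case Nil
  show ?case using ev_lcou[OF m ps] by simp
next
  case (Cons q qs)
  have q: "ml H smul q" and qs: "\<And>q. q \<in> set qs \<Longrightarrow> ml H smul q" using Cons.prems by auto
  have l: "lin H s (\<lambda>h. \<mu> (h # r))" and t: "ml H s (\<lambda>r. \<mu> (h # r))" for h r
    using ml_ConsD[OF m Cons.prems(2)] by auto
  have b: "bml s (\<lambda>u v. ev s qs (\<lambda>r. \<mu> (q u # r)) v)"
    unfolding bml_def by (intro conjI allI ev_ml[OF m] qs t ml_ev_param[OF m] ml_comp[OF l q])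
  have "ev s ps (ev s (q # qs) \<mu>) x = lsum x (\<lambda>u v. ev s ps (\<lambda>y. ev s ps (ev s qs (\<lambda>r. \<mu> (q y # r))) v) u)"
    using ev_dup[OF m ps b] by simp
  also have "\<dots> = lsum x (\<lambda>u v. ev s ps (\<lambda>y. ev s (map (cmp_ev ps) qs) (\<lambda>r. \<mu> (q y # r)) v) u)"
    using Cons.IH[OF qs t] by simp
  also have "\<dots> = lsum x (\<lambda>u v. ev s (map (cmp_ev ps) qs) (\<lambda>r. \<mu> (cmp_ev ps q u # r)) v)"
    using ev_push_lin[where M = "\<lambda>h. ev s (map (cmp_ev ps) qs) (\<lambda>r. \<mu> (h # r)) v" and s = s and ps = ps and q = q for v]
      lin_ev_param[OF m l] by simp
  finally show ?case by simp
qed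

lemma cmp_ev_unit: assumes "mors ps" shows "cmp_ev ps unitm = unitm"
proof -
  have u: "unitm = (\<lambda>x. smul (lcou x) one)" by (simp add: unitm_def fun_eq_iff)
  show ?thesis unfolding cmp_ev_def u using ev_lcou[OF mod_smul assms] by auto
qed

lemma cmp_ev_inv: "cmp_ev ps (invm q) = invm (cmp_ev ps q)"
proof
  fix x
  have "lin H smul S" by (simp add: lin_def S_simps)
  moreover have "invm q = (\<lambda>x. S (q x))" by (simp add: invm_def fun_eq_iff)
  ultimately show "cmp_ev ps (invm q) x = invm (cmp_ev ps q) x"
    using ev_push_lin[of smul S ps q x] by (simp add: invm_def cmp_ev_def)
qed

text \<open>With units and inverses this makes substitution a homomorphism of convolution groups, so
  group words in the projections can be evaluated formally.\<close>

lemma cmp_ev_conv: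
  assumes ps: "mors ps" and q: "mor q" "mor q'"
  shows "cmp_ev ps (conv q q') = conv (cmp_ev ps q) (cmp_ev ps q')"
proof
  fix x
  have b: "bml smul (\<lambda>u v. q u \<odot> q' v)"
    unfolding bml_def by (intro conjI allI ml_mul morD q)
  have l: "lin H smul (\<lambda>h. h \<odot> c)" "lin H smul (\<lambda>h. c \<odot> h)" for c by (simp_all add: lin_def mul_simps)
  have "cmp_ev ps (conv q q') x = lsum x (\<lambda>u v. ev smul ps (\<lambda>y. ev smul ps (\<lambda>z. q y \<odot> q' z) v) u)"
  proof -
    have c: "conv q q' = (\<lambda>y. lsum y (\<lambda>u v. q u \<odot> q' v))" by (simp add: conv_def fun_eq_iff)
    show ?thesis unfolding cmp_ev_def c by (rule ev_dup[OF mod_smul ps b])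
  qed
  also have "\<dots> = conv (cmp_ev ps q) (cmp_ev ps q') x"
    unfolding conv_def ev_push_lin[OF l(1)] unfolding ev_push_lin[OF l(2)] ..
  finally show "cmp_ev ps (conv q q') x = conv (cmp_ev ps q) (cmp_ev ps q') x" .
qed

lemma cmp_ev_proj:
  assumes "mors ps" "j < length ps"
  shows "cmp_ev ps (proj j) = ps ! j"
proof
  fix x
  show "cmp_ev ps (proj j) x = (ps ! j) x"
    using assms
  proof (induction ps arbitrary: j x)
    case (Cons p ps)
    have p: "mor p" and ps: "mors ps" using Cons.prems by auto
    show ?case
    proof (cases j)
      case 0
      have "cmp_ev (p # ps) (proj 0) x = lsum x (\<lambda>u v. smul (lcou v) (p u))"
      proof -
        have "ev smul ps (\<lambda>r. smul (lcou r) c) = (\<lambda>v. smul (lcou v) c)" for c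
          using ev_lcou[OF mod_smul ps] by auto
        then show ?thesis by (simp add: cmp_ev_def)
      qed
      then show ?thesis using lsum_counit'[OF mod_smul morD(1)[OF p]] 0 by simp
    next
      case (Suc i)
      then have i: "i < length ps" using Cons.prems by simp
      have "cmp_ev (p # ps) (proj j) x = lsum x (\<lambda>u v. smul (lcou u) (cmp_ev ps (proj i) v))"
        by (simp add: Suc cmp_ev_def ev_scale'[OF mod_smul] morD(2)[OF p])
      also have "\<dots> = lsum x (\<lambda>u v. smul (lcou u) ((ps ! i) v))" using Cons.IH[OF ps i] by simp
      also have "\<dots> = (ps ! i) x" by (rule lsum_counit[OF mod_smul morD(1)]) (use ps i in simp)
      finally show ?thesis using Suc by simp
    qed
  qed simp
qed

text \<open>In a group, for inputs \<open>h\<^sub>1, \<dots>, h\<^sub>n\<close>, \<open>pprod j\<close> is the partial product \<open>h\<^sub>1 \<cdots> h\<^sub>j\<close>, and \<open>edge a b\<close> is the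
  inverse of \<open>pprod a\<close> times \<open>pprod b\<close>.\<close>
primrec pprod :: "nat \<Rightarrow> 'h list \<Rightarrow> 'h" where
  "pprod 0 = unitm" | "pprod (Suc n) = conv (pprod n) (proj n)"

definition edge :: "nat \<Rightarrow> nat \<Rightarrow> 'h list \<Rightarrow> 'h" where "edge a b = conv (invm (pprod a)) (pprod b)"

fun edges :: "nat list \<Rightarrow> ('h list \<Rightarrow> 'h) list" where
  "edges (a # b # f) = edge a b # edges (b # f)"
| "edges _ = []"

lemma mor_pprod: "mor (pprod n)" by (induction n) (auto intro: mor_unit mor_conv mor_proj)
lemma mor_edge: "mor (edge a b)" unfolding edge_def by (intro mor_conv mor_inv mor_pprod)
lemma mor_edges: "mors (edges f)" by (induction f rule: edges.induct) (auto intro: mor_edge)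

lemma length_edges: "length (edges f) = length f - 1" by (induction f rule: edges.induct) auto

lemma edges_nth: "Suc j < length f \<Longrightarrow> edges f ! j = edge (f ! j) (f ! Suc j)"
proof (induction f arbitrary: j rule: edges.induct)
  case (1 a b f) then show ?case by (cases j) auto
qed auto

lemma inv_conv_cancel: "mor p \<Longrightarrow> mor q \<Longrightarrow> conv p (conv (invm p) q) = q"
  by (simp add: conv_assoc[symmetric] mor_inv conv_inv conv_unit)

lemma edge_trans: "conv (edge a b) (edge b c) = edge a c"
  unfolding edge_def by (simp add: conv_assoc mor_inv mor_pprod mor_conv inv_conv_cancel)

lemma inv_unique: assumes "mor p" "mor q" "conv p q = unitm" shows "q = invm p"
proof -
  have "conv (invm p) (conv p q) = q" using assms(1,2)
    by (simp add: conv_assoc[symmetric] mor_inv conv_inv conv_unit)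
  then show ?thesis using assms by (simp add: conv_unit mor_inv)
qed

lemma edge_inv: "invm (edge a b) = edge b a"
proof (rule inv_unique[symmetric, OF mor_edge mor_edge])
  have "edge a a = unitm" by (simp add: edge_def conv_inv mor_pprod)
  then show "conv (edge a b) (edge b a) = unitm" by (simp add: edge_trans)
qed

text \<open>The substituted partial product is a product of consecutive edges, which
  telescopes.\<close>

lemma cmp_ev_pprod: assumes "j < length f" shows "cmp_ev (edges f) (pprod j) = edge (f ! 0) (f ! j)"
  using assms
proof (induction j)
  case 0
  then show ?case by (simp add: cmp_ev_unit[OF mor_edges] edge_def conv_inv mor_pprod)
next
  case (Suc j)
  have "cmp_ev (edges f) (pprod (Suc j)) = conv (cmp_ev (edges f) (pprod j)) (cmp_ev (edges f) (proj j))"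
    by (simp add: cmp_ev_conv[OF mor_edges mor_pprod mor_proj])
  also have "cmp_ev (edges f) (proj j) = edge (f ! j) (f ! Suc j)"
    using Suc.prems cmp_ev_proj[OF mor_edges[of f], of j] by (simp add: length_edges edges_nth)
  finally show ?case using Suc by (simp add: edge_trans)
qed

lemma cmp_ev_edge: assumes "a < length f" "b < length f" shows "cmp_ev (edges f) (edge a b) = edge (f ! a) (f ! b)"
  unfolding edge_def[of a b] using assms
  by (simp add: cmp_ev_conv[OF mor_edges mor_inv[OF mor_pprod] mor_pprod] cmp_ev_inv cmp_ev_pprod edge_inv edge_trans)

lemma cmp_ev_edges: assumes "set g \<subseteq> {..<length f}" shows "map (cmp_ev (edges f)) (edges g) = edges (map ((!) f) g)"
  using assms by (induction g rule: edges.induct) (auto simp: cmp_ev_edge)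

text \<open>Functoriality of the nerve of a group, expressed in vertices: the edges of the composite
  word are obtained by substituting the edges of \<open>f\<close> into those of
  \<open>g\<close>.\<close>

lemma ev_functor:
  fixes s :: "'k \<Rightarrow> 'v \<Rightarrow> 'v::ab_group_add"
  assumes "module s" "set g \<subseteq> {..<length f}" "ml H s \<mu>"
  shows "ev s (edges f) (ev s (edges g) \<mu>) x = ev s (edges (map ((!) f) g)) \<mu> x"
  using ev_comp[OF assms(1) mor_edges[of f] _ assms(3), of "edges g" x] mor_edges[of g] morD(1)
  by (simp add: cmp_ev_edges[OF assms(2)])

end

section \<open>Faces, cyclic operators and involutions\<close>

context hopf begin

text \<open>A morphism made to ignore a new first factor by means of the counit; it carries the
  inductions along words.\<close>

definition lift :: "('h list \<Rightarrow> 'h) \<Rightarrow> 'h list \<Rightarrow> 'h" where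
  "lift p x = (case x of [] \<Rightarrow> one | h # x \<Rightarrow> smul (cou h) (p x))"

lemma lift_simps [simp]: "lift p [] = one" "lift p (h # x) = smul (cou h) (p x)"
  by (simp_all add: lift_def)

lemma proj_Suc: "proj (Suc i) = lift (proj i)"
  by (rule ext) (simp add: lift_def split: list.split)

lemma map_proj: "map proj [Suc a..<Suc b] = map lift (map proj [a..<b])"
proof -
  have "map proj [Suc a..<Suc b] = map proj (map Suc [a..<b])" by (simp only: map_Suc_upt)
  also have "\<dots> = map lift (map proj [a..<b])" by (simp only: map_map o_def proj_Suc)
  finally show ?thesis .
qed

lemma map_proj_0: "map proj [0..<Suc b] = proj 0 # map lift (map proj [0..<b])"
  by (simp add: map_proj upt_conv_Cons del: upt_Suc)

lemma conv_lift: "conv (lift p) (lift q) = lift (conv p q)"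
proof
  fix x show "conv (lift p) (lift q) x = lift (conv p q) x"
  proof (cases x)
    case Nil then show ?thesis by (simp add: conv_def)
  next
    case (Cons h y)
    have "conv (lift p) (lift q) x = dsum (\<lambda>a b. smul (cou a) (smul (cou b) (conv p q y))) h"
      by (simp add: Cons conv_def mul_simps lsum_scale[OF mod_smul])
    also have "\<dots> = smul (cou h) (conv p q y)" by (rule dsum_counit(1)[OF mod_smul lin_cou[OF mod_smul]])
    finally show ?thesis by (simp add: Cons)
  qed
qed

lemma lift_unit: "lift unitm = unitm"
  by (rule ext) (simp add: lift_def unitm_def split: list.split)

lemma mor_lift_pprod: "mor (lift (pprod n))"
proof (induction n)
  case 0 then show ?case by (simp add: lift_unit mor_unit)
next
  case (Suc n) then show ?case by (simp add: conv_lift[symmetric] proj_Suc[symmetric] mor_conv mor_proj)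
qed

lemma pprod_Suc': "pprod (Suc n) = conv (proj 0) (lift (pprod n))"
proof (induction n)
  case 0 then show ?case by (simp add: lift_unit conv_unit mor_proj)
next
  case (Suc n)
  have "pprod (Suc (Suc n)) = conv (conv (proj 0) (lift (pprod n))) (lift (proj n))"
    using Suc by (simp add: proj_Suc)
  also have "\<dots> = conv (proj 0) (lift (pprod (Suc n)))"
    using mor_proj[of "Suc n"] by (simp add: conv_assoc mor_proj mor_lift_pprod proj_Suc conv_lift)
  finally show ?case .
qed

lemma lsum_cong: "(\<And>u v. length u = length x \<Longrightarrow> length v = length x \<Longrightarrow> F u v = G u v) \<Longrightarrow> lsum x F = lsum x G"
proof (induction x arbitrary: F G)
  case (Cons h x)
  have "lsum x (\<lambda>u v. F (a # u) (b # v)) = lsum x (\<lambda>u v. G (a # u) (b # v))" for a b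
    by (rule Cons.IH) (simp add: Cons.prems)
  then show ?case by simp
qed simp

lemma lsum_lcou_scale:
  assumes m: "module s"
  shows "lsum x (\<lambda>u v. s (lcou u * c) (F u v)) = s c (lsum x (\<lambda>u v. s (lcou u) (F u v)))"
  unfolding lsum_scale[OF m, symmetric] module.scale_scale[OF m] by (simp add: mult.commute)

lemma lsum_lcou_mult: "lsum x (\<lambda>u v. lcou u * (c * F u v)) = c * lsum x (\<lambda>u v. lcou u * F u v)"
  using lsum_lcou_scale[OF module_times, of x c F] by (simp add: mult.assoc)

lemma conv_proj0_lift: assumes "ml H smul p" shows "conv (proj 0) (lift p) (h # x) = h \<odot> p x"
proof -
  have l: "ml H smul (\<lambda>v. a \<odot> p v)" for a by (rule ml_mul[OF assms])
  have "conv (proj 0) (lift p) (h # x) = dsum (\<lambda>a b. smul (cou b) (lsum x (\<lambda>u v. smul (lcou u) (a \<odot> p v)))) h"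
    by (simp add: conv_def mul_simps lsum_lcou_scale[OF mod_smul])
  also have "\<dots> = dsum (\<lambda>a b. smul (cou b) (a \<odot> p x)) h" by (simp only: lsum_counit[OF mod_smul l])
  also have "\<dots> = h \<odot> p x"
    by (rule dsum_counit(2)[OF mod_smul]) (simp add: lin_def mul_simps)
  finally show ?thesis .
qed

lemma pprod_eval: "length x = n \<Longrightarrow> pprod n x = foldr (hmult H) x one"
proof (induction x arbitrary: n)
  case Nil then show ?case by (simp add: unitm_def)
next
  case (Cons h x)
  then obtain k where k: "n = Suc k" "length x = k" by auto
  show ?case unfolding k(1) pprod_Suc' conv_proj0_lift[OF morD(1)[OF mor_pprod]]
    using Cons.IH[OF k(2)] by simp
qed

abbreviation "evk \<equiv> ev ((*) :: 'k \<Rightarrow> 'k \<Rightarrow> 'k)"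
abbreviation "mlk \<equiv> ml H ((*) :: 'k \<Rightarrow> 'k \<Rightarrow> 'k)"

lemma mlk_Cons_smul: "mlk \<mu> \<Longrightarrow> \<mu> (smul c h # r) = c * \<mu> (h # r)"
  using linD(2)[OF ml_ConsD(2)[OF module_times]] .

lemma ev_lift0: "mlk \<mu> \<Longrightarrow> evk (map lift ps) \<mu> (h # x) = cou h * evk ps \<mu> x"
proof (induction ps arbitrary: \<mu> h x)
  case (Cons p ps)
  let ?K = "lsum x (\<lambda>u v. evk ps (\<lambda>r. \<mu> (p u # r)) v)"
  have "evk (map lift (p # ps)) \<mu> (h # x)
    = dsum (\<lambda>a b. lsum x (\<lambda>u v. cou b * evk ps (\<lambda>r. \<mu> (smul (cou a) (p u) # r)) v)) h"
    using Cons.IH[OF ml_ConsD(1)[OF module_times Cons.prems]] by simp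
  also have "\<dots> = dsum (\<lambda>a b. cou b * (cou a * ?K)) h"
    by (simp add: mlk_Cons_smul[OF Cons.prems] ev_scale'[OF module_times] lsum_scale[OF module_times])
  also have "\<dots> = cou h * ?K" by (rule dsum_counit(2)[OF module_times lin_cou[OF module_times]])
  finally show ?case by simp
qed simp

text \<open>All entries but \<open>q\<close> ignore the first input, so counitality collapses its
  comultiplication and \<open>g h\<close> appears in the slot of \<open>q\<close>. The slot is left
  free because the involution moves the first input to the end.\<close>

lemma ev_insert:
  assumes q: "\<And>h x. q (h # x) = smul (lcou x) (g h)" and g: "lin H smul g" and qs: "mors qs"
  shows "mlk \<mu> \<Longrightarrow> mors ps \<Longrightarrow> evk (map lift ps @ q # map lift qs) \<mu> (h # x)
    = evk (ps @ qs) (\<lambda>r. \<mu> (take (length ps) r @ g h # drop (length ps) r)) x"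
proof (induction ps arbitrary: \<mu> h x)
  case Nil
  have mc: "mlk (\<lambda>r. \<mu> (h # r))" for h by (rule ml_ConsD(1)[OF module_times Nil(1)])
  have me: "mlk (evk qs (\<lambda>r. \<mu> (h # r)))" for h
    by (rule ev_ml[OF module_times _ mc]) (use qs morD in blast)
  have le: "lin H (*) (\<lambda>h. evk qs (\<lambda>r. \<mu> (g h # r)) x)"
  proof (rule lin_ev_param[OF module_times])
    show "lin H (*) (\<lambda>h. \<mu> (g h # r))" for r
      using ml_ConsD(2)[OF module_times Nil(1), of r] g by (simp add: lin_def)
  qed
  have "evk (map lift [] @ q # map lift qs) \<mu> (h # x)
    = dsum (\<lambda>a b. cou b * lsum x (\<lambda>u v. lcou u * evk qs (\<lambda>r. \<mu> (g a # r)) v)) h"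
    by (simp add: q ev_lift0[OF mc] mlk_Cons_smul[OF Nil(1)] ev_scale'[OF module_times] lsum_lcou_mult mult.left_commute[of "cou _" "lcou _"])
  also have "\<dots> = dsum (\<lambda>a b. cou b * evk qs (\<lambda>r. \<mu> (g a # r)) x) h"
    by (simp only: lsum_counit[OF module_times me])
  also have "\<dots> = evk qs (\<lambda>r. \<mu> (g h # r)) x" by (rule dsum_counit(2)[OF module_times le])
  finally show ?case by simp
next
  case (Cons p ps)
  let ?n = "length ps"
  have mc: "mlk (\<lambda>r. \<mu> (h # r))" for h by (rule ml_ConsD(1)[OF module_times Cons.prems(1)])
  have ps: "mors ps" using Cons.prems by simp
  let ?K = "\<lambda>b. lsum x (\<lambda>u v. evk (ps @ qs) (\<lambda>r. \<mu> (p u # take ?n r @ g b # drop ?n r)) v)"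
  have l: "lin H (*) (\<lambda>b. \<mu> (w @ g b # r))" for w r
    using Cons.prems(1) g by (simp add: ml_def lin_def)
  have lK: "lin H (*) ?K"
    using l[of "p u # take ?n r" "drop ?n r" for u r]
    by (intro lin_lsum_param[OF module_times] lin_ev_param[OF module_times]) simp
  have "evk (map lift (p # ps) @ q # map lift qs) \<mu> (h # x)
    = dsum (\<lambda>a b. lsum x (\<lambda>u v. evk (ps @ qs) (\<lambda>r. \<mu> (smul (cou a) (p u) # take ?n r @ g b # drop ?n r)) v)) h"
    using Cons.IH[OF mc ps] by simp
  also have "\<dots> = dsum (\<lambda>a b. cou a * ?K b) h"
    by (simp add: mlk_Cons_smul[OF Cons.prems(1)] ev_scale'[OF module_times] lsum_scale[OF module_times])
  also have "\<dots> = ?K h" by (rule dsum_counit(1)[OF module_times lK])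
  finally show ?case by simp
qed

lemma ev_proj0: assumes "mors qs" "mlk \<mu>"
  shows "evk (proj 0 # map lift qs) \<mu> (h # x) = evk qs (\<lambda>r. \<mu> (h # r)) x"
  using ev_insert[of "proj 0" "\<lambda>h. h" qs \<mu> "[]" h x] assms by (simp add: lin_def)

lemma mors_proj: "mors (map proj I)" by (auto intro: mor_proj)

lemma ev_idop: "mlk \<mu> \<Longrightarrow> length w = n \<Longrightarrow> evk (map proj [0..<n]) \<mu> w = \<mu> w"
proof (induction n arbitrary: \<mu> w)
  case (Suc n)
  then obtain h x where w: "w = h # x" "length x = n" by (cases w) auto
  show ?case unfolding map_proj_0 w(1) ev_proj0[OF mors_proj Suc.prems(1)]
    by (rule Suc.IH[OF ml_ConsD(1)[OF module_times Suc.prems(1)] w(2)])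
qed simp

lemma ev_tail: "mlk \<mu> \<Longrightarrow> length w = Suc n \<Longrightarrow> evk (map proj [Suc 0..<Suc n]) \<mu> w = cou (hd w) * \<mu> (tl w)"
  by (cases w) (simp_all only: map_proj ev_lift0 ev_idop length_Cons list.sel nat.inject, simp_all)

lemma ev_butlast: "mlk \<mu> \<Longrightarrow> length w = Suc n \<Longrightarrow> evk (map proj [0..<n]) \<mu> w = cou (last w) * \<mu> (butlast w)"
proof (induction n arbitrary: \<mu> w)
  case 0 then show ?case by (cases w) auto
next
  case (Suc n)
  then obtain h x where w: "w = h # x" "length x = Suc n" by (cases w) auto
  show ?case unfolding map_proj_0 w(1) ev_proj0[OF mors_proj Suc.prems(1)]
    using Suc.IH[OF ml_ConsD(1)[OF module_times Suc.prems(1)] w(2)] w(2) by auto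
qed

lemma ev_mult0: assumes qs: "mors qs" and \<mu>: "mlk \<mu>"
  shows "evk (conv (proj 0) (proj (Suc 0)) # map lift (map lift qs)) \<mu> (h # h' # x) = evk qs (\<lambda>r. \<mu> (h \<odot> h' # r)) x"
proof -
  have mc: "mlk (\<lambda>r. \<mu> (h # r))" for h by (rule ml_ConsD(1)[OF module_times \<mu>])
  have me: "mlk (evk qs (\<lambda>r. \<mu> (h # r)))" for h
    by (rule ev_ml[OF module_times _ mc]) (use qs morD in blast)
  have le: "lin H (*) (\<lambda>h. evk qs (\<lambda>r. \<mu> (h # r)) x)"
    by (rule lin_ev_param[OF module_times]) (rule ml_ConsD(2)[OF module_times \<mu>])
  have c: "conv (proj 0) (proj (Suc 0)) (h # h' # x) = smul (lcou x) (h \<odot> h')" for h h' x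
    unfolding proj_Suc conv_proj0_lift[OF morD(1)[OF mor_proj]] by (simp add: mul_simps)
  have "evk (conv (proj 0) (proj (Suc 0)) # map lift (map lift qs)) \<mu> (h # h' # x)
    = dsum (\<lambda>a b. cou b * dsum (\<lambda>a' b'. cou b' * lsum x (\<lambda>u v. lcou u * evk qs (\<lambda>r. \<mu> (a \<odot> a' # r)) v)) h') h"
    by (simp add: c ev_lift0[OF mc] mlk_Cons_smul[OF \<mu>] ev_scale'[OF module_times] lsum_lcou_mult mult.left_commute[of "cou _" "lcou _"] dsum_scale[OF module_times] del: map_map)
  also have "\<dots> = dsum (\<lambda>a b. cou b * dsum (\<lambda>a' b'. cou b' * evk qs (\<lambda>r. \<mu> (a \<odot> a' # r)) x) h') h"
    by (simp only: lsum_counit[OF module_times me])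
  also have "\<dots> = dsum (\<lambda>a b. cou b * evk qs (\<lambda>r. \<mu> (a \<odot> h' # r)) x) h"
    by (simp only: dsum_counit(2)[OF module_times lin_comp_mul(2)[OF le]])
  also have "\<dots> = evk qs (\<lambda>r. \<mu> (h \<odot> h' # r)) x"
    by (rule dsum_counit(2)[OF module_times lin_comp_mul(1)[OF le]])
  finally show ?thesis .
qed

lemma ev_mult: "mlk \<mu> \<Longrightarrow> length w = Suc n \<Longrightarrow> i < n \<Longrightarrow>
  evk (map proj [0..<i] @ conv (proj i) (proj (Suc i)) # map proj [Suc (Suc i)..<Suc n]) \<mu> w
    = \<mu> (take i w @ [w ! i \<odot> w ! Suc i] @ drop (Suc (Suc i)) w)"
proof (induction i arbitrary: \<mu> w n)
  case 0
  then obtain k where k: "n = Suc k" by (cases n) auto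
  then obtain h h' x where w: "w = h # h' # x" "length x = k"
    using 0 by (cases w; cases "tl w") auto
  have mc: "mlk (\<lambda>r. \<mu> (h # r))" for h by (rule ml_ConsD(1)[OF module_times 0(1)])
  have "map proj [Suc (Suc 0)..<Suc n] = map lift (map lift (map proj [0..<k]))"
    unfolding k map_proj ..
  then show ?case unfolding w(1)
    using ev_mult0[OF mors_proj 0(1), of "[0..<k]" h h' x] ev_idop[OF mc w(2), of "h \<odot> h'"]
    by (simp del: map_map upt_Suc)
next
  case (Suc i)
  then obtain k where k: "n = Suc k" by (cases n) auto
  then obtain h x where w: "w = h # x" "length x = Suc k" using Suc.prems by (cases w) auto
  let ?q = "map proj [0..<i] @ conv (proj i) (proj (Suc i)) # map proj [Suc (Suc i)..<Suc k]"
  have eq: "map proj [0..<Suc i] @ conv (proj (Suc i)) (proj (Suc (Suc i))) # map proj [Suc (Suc (Suc i))..<Suc n]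
    = proj 0 # map lift ?q"
    unfolding map_proj_0 k proj_Suc[of i] proj_Suc[of "Suc i"] conv_lift map_proj[of "Suc (Suc i)" "Suc k"] by simp
  have mq: "mors ?q" by (auto intro: mor_proj mor_conv)
  have "evk (map proj [0..<Suc i] @ conv (proj (Suc i)) (proj (Suc (Suc i))) # map proj [Suc (Suc (Suc i))..<Suc n]) \<mu> w
    = evk ?q (\<lambda>r. \<mu> (h # r)) x"
    unfolding w(1) eq by (rule ev_proj0[OF mq Suc.prems(1)])
  also have "\<dots> = \<mu> (h # take i x @ [x ! i \<odot> x ! Suc i] @ drop (Suc (Suc i)) x)"
    by (rule Suc.IH[OF ml_ConsD(1)[OF module_times Suc.prems(1)] w(2)]) (use Suc.prems k in simp)
  finally show ?case by (simp add: w)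
qed

section \<open>Edge tuples of the words behind faces, cyclic operators and involutions\<close>

lemma edge_Suc: "edge j (Suc j) = proj j"
  unfolding edge_def pprod.simps conv_assoc[OF mor_inv[OF mor_pprod] mor_pprod mor_proj, symmetric]
  by (simp add: conv_inv mor_pprod conv_unit mor_proj)

lemma edges_upt: "a \<le> b \<Longrightarrow> edges [a..<Suc b] = map proj [a..<b]"
proof (induction "b - a" arbitrary: a)
  case 0 then show ?case by simp
next
  case (Suc k)
  then have "[a..<Suc b] = a # Suc a # [Suc (Suc a)..<Suc b]" "[Suc a..<Suc b] = Suc a # [Suc (Suc a)..<Suc b]"
    "[a..<b] = a # [Suc a..<b]" by (simp_all add: upt_conv_Cons del: upt_Suc)
  then show ?case using Suc(1)[of "Suc a"] Suc(2) by (simp add: edge_Suc del: upt_Suc)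
qed

lemma edges_append: "f \<noteq> [] \<Longrightarrow> g \<noteq> [] \<Longrightarrow> edges (f @ g) = edges f @ edge (last f) (hd g) # edges g"
proof (induction f rule: edges.induct)
  case (1 a b f) then show ?case by simp
next
  case ("2_2" a) then show ?case by (cases g) auto
qed simp

lemma S_one: "S one = one"
proof -
  have "invm unitm = unitm"
    by (rule inv_unique[symmetric]) (simp_all add: mor_unit conv_unit)
  from fun_cong[OF this, of "[]"] show ?thesis by (simp add: invm_def unitm_def)
qed

text \<open>Inverting twice in the convolution group gives back the first projection, which on
  one-letter words is the identity. Consequently the inverse antipode in the involution is the
  antipode.\<close>

lemma S_S: "S (S a) = a"
proof -
  have "invm (invm (proj 0)) = proj 0"
    by (rule inv_unique[symmetric]) (simp_all add: mor_inv mor_proj conv_inv)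
  from fun_cong[OF this, of "[a]"] show ?thesis by (simp add: invm_def)
qed

lemma inv_S: "inv S = S"
  by (rule inv_equality) (auto simp: S_S)

lemma invm_lift: "invm (lift p) = lift (invm p)"
  by (rule ext) (simp add: lift_def invm_def S_one S_simps split: list.split)

lemma edges_rev: "edges (rev [0..<Suc n]) = map (\<lambda>i. invm (proj i)) (rev [0..<n])"
proof (induction n)
  case (Suc n)
  have "rev [0..<Suc (Suc n)] = Suc n # n # rev [0..<n]" "rev [0..<Suc n] = n # rev [0..<n]" by simp_all
  then show ?case using Suc edge_inv[of n "Suc n"] by (simp add: edge_Suc)
qed simp

lemma ev_rev: "mlk \<mu> \<Longrightarrow> length w = n \<Longrightarrow>
  evk (map (\<lambda>i. invm (proj i)) (rev [0..<n])) \<mu> w = \<mu> (rev (map S w))"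
proof (induction n arbitrary: \<mu> w)
  case (Suc n)
  then obtain h x where w: "w = h # x" "length x = n" by (cases w) auto
  let ?ps = "map (\<lambda>i. invm (proj i)) (rev [0..<n])"
  have "rev [0..<Suc n] = map Suc (rev [0..<n]) @ [0]"
    by (simp add: rev_map[symmetric] map_Suc_upt upt_conv_Cons del: upt_Suc)
  then have eq: "map (\<lambda>i. invm (proj i)) (rev [0..<Suc n]) = map lift ?ps @ invm (proj 0) # map lift []"
    by (simp add: proj_Suc invm_lift del: upt_Suc)
  have m: "mlk (\<lambda>r. \<mu> (r @ [S h]))"
    using Suc.prems(1) by (simp add: ml_def)
  have "evk (map (\<lambda>i. invm (proj i)) (rev [0..<Suc n])) \<mu> w
    = evk (?ps @ []) (\<lambda>r. \<mu> (take (length ?ps) r @ S h # drop (length ?ps) r)) x"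
    unfolding eq w(1)
    by (rule ev_insert[OF _ _ _ Suc.prems(1)]) (auto simp: invm_def S_simps lin_def intro: mor_inv mor_proj)
  also have "\<dots> = evk ?ps (\<lambda>r. \<mu> (r @ [S h])) x"
  proof -
    have "evk ?ps (\<lambda>r. \<mu> (take (length ?ps) r @ S h # drop (length ?ps) r)) = evk ?ps (\<lambda>r. \<mu> (r @ [S h]))"
      by (rule ev_cong[OF module_times]) simp
    then show ?thesis by simp
  qed
  also have "\<dots> = \<mu> (rev (map S x) @ [S h])" by (rule Suc.IH[OF m w(2)])
  finally show ?case by (simp add: w)
qed simp

text \<open>The edge from the last vertex back to the first is the inverse of the full product; the
  remaining edges are the inputs but the last, which the counit removes.\<close>

lemma ev_tau: assumes \<mu>: "mlk \<mu>" and w: "length w = Suc n"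
  shows "evk (edges (Suc n # [0..<Suc n])) \<mu> w
    = lsum w (\<lambda>u v. cou (last v) * \<mu> (S (foldr (hmult H) u one) # butlast v))"
proof -
  have "edges (Suc n # [0..<Suc n]) = edge (Suc n) 0 # edges [0..<Suc n]"
    by (simp add: upt_conv_Cons del: upt_Suc)
  also have "edge (Suc n) 0 = invm (pprod (Suc n))" by (simp add: edge_def conv_unit mor_inv mor_pprod del: pprod.simps(2)) 
  finally have "evk (edges (Suc n # [0..<Suc n])) \<mu> w
    = lsum w (\<lambda>u v. evk (map proj [0..<n]) (\<lambda>r. \<mu> (S (pprod (Suc n) u) # r)) v)"
    by (simp add: edges_upt invm_def del: upt_Suc pprod.simps)
  also have "\<dots> = lsum w (\<lambda>u v. cou (last v) * \<mu> (S (foldr (hmult H) u one) # butlast v))"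
    by (rule lsum_cong) (simp add: w pprod_eval ev_butlast[OF ml_ConsD(1)[OF module_times \<mu>]] del: pprod.simps)
  finally show ?thesis .
qed

text \<open>Deleting a vertex merges the two edges that meet there: at an end one input disappears
  under the counit, inside two inputs are multiplied.\<close>

lemma pair_face:
  assumes \<mu>: "mlk \<mu>" and w: "length w = Suc n" and i: "i \<le> Suc n"
  shows "evk (edges ([0..<i] @ [Suc i..<Suc (Suc n)])) \<mu> w = pair (*) \<mu> (face H i w)"
proof -
  consider "i = 0" | "i = Suc n" | j where "i = Suc j" "j < n" using i by (cases i) force+
  then show ?thesis
  proof cases
    case 1
    then show ?thesis using w ev_tail[OF \<mu> w] edges_upt[of 1 "Suc n"]
      by (simp add: face_def pair_sc[OF module_times] pair_gen[OF module_times] del: upt_Suc)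
  next
    case 2
    then show ?thesis using w ev_butlast[OF \<mu> w] edges_upt[of 0 n]
      by (simp add: face_def pair_sc[OF module_times] pair_gen[OF module_times] del: upt_Suc)
  next
    case 3
    have "edges ([0..<i] @ [Suc i..<Suc (Suc n)]) = edges [0..<Suc j] @ edge j (Suc (Suc j)) # edges [Suc (Suc j)..<Suc (Suc n)]"
      using 3 edges_append[of "[0..<Suc j]" "[Suc (Suc j)..<Suc (Suc n)]"] by (simp add: hd_upt last_upt del: upt_Suc)
    also have "edge j (Suc (Suc j)) = conv (proj j) (proj (Suc j))"
      using edge_trans[of j "Suc j" "Suc (Suc j)"] by (simp add: edge_Suc)
    finally show ?thesis
      using ev_mult[OF \<mu> w 3(2)] edges_upt[of 0 j] edges_upt[of "Suc (Suc j)" "Suc n"] 3 w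
      by (simp add: face_def pair_gen[OF module_times] del: upt_Suc)
  qed
qed

end

section \<open>The tensor powers as a symmetric system\<close>

context hopf begin

lemma mod_sc: "module (sc :: 'k \<Rightarrow> ('a \<Rightarrow> 'k) \<Rightarrow> _)" by (rule sc.module_axioms)

lemma sum_apply_fun: "(\<Sum>w\<in>A. f w) x = (\<Sum>w\<in>A. f w x :: 'v::comm_monoid_add)"
  by (induction A rule: infinite_finite_induct) (auto simp: zero_fun_def plus_fun_def)

lemma lext_pair: "lext G f = pair sc G (f :: 'h list \<Rightarrow> 'k)"
  by (simp add: lext_def pair_def sc_def sum_apply_fun fun_eq_iff)

lemma lext_FS:
  fixes f :: "'h list \<Rightarrow> 'k" and G :: "'h list \<Rightarrow> 'h list \<Rightarrow> 'k"
  assumes "f \<in> FS n" "\<And>w. length w = n \<Longrightarrow> G w \<in> FS m" shows "lext G f \<in> FS m"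
  unfolding lext_pair pair_def
proof (rule FS_sum)
  fix w assume "w \<in> {w. f w \<noteq> 0}"
  then have "length w = n" using assms(1) by (simp add: FS_def)
  then show "sc (f w) (G w) \<in> FS m" by (intro FS_sc assms(2))
qed

lemma pair_lext:
  assumes f: "f \<in> FS n" and G: "\<And>w. length w = n \<Longrightarrow> G w \<in> FS m"
  shows "pair (*) \<mu> (lext G f) = pair (*) (\<lambda>w. pair (*) \<mu> (G w)) (f :: 'h list \<Rightarrow> 'k)"
proof -
  have fin: "fin (G w)" if "f w \<noteq> 0" for w
    using that f by (intro FS_fin[OF G]) (simp add: FS_def)
  have "pair (*) \<mu> (lext G f) = (\<Sum>w | f w \<noteq> 0. pair (*) \<mu> (sc (f w) (G w)))"
    unfolding lext_pair pair_def[of sc] by (rule pair_sum[OF module_times]) (simp add: fin_sc fin)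
  also have "\<dots> = (\<Sum>w | f w \<noteq> 0. f w * pair (*) \<mu> (G w))"
    by (rule sum.cong) (simp_all add: pair_sc[OF module_times fin])
  finally show ?thesis by (simp add: pair_def[of "(*)" "\<lambda>w. pair (*) \<mu> (G w)"])
qed

lemma tensor_eqI:
  assumes "f \<in> FS n" "g \<in> FS n" "\<And>\<mu>. mlk \<mu> \<Longrightarrow> pair (*) \<mu> f = pair (*) \<mu> g"
  shows "f - g \<in> tensor_rel H n"
  using assms by (intro tensor_rel_separation FS_diff) (simp_all add: pair_diff[OF module_times FS_fin FS_fin])

lemma lsum_FS: assumes "\<And>u v. F u v \<in> (FS n :: ('h list \<Rightarrow> 'k) set)" shows "lsum x F \<in> FS n"
  unfolding lsum_choices[symmetric] by (intro FS_sum_list assms)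

lemma pair_lsum: assumes "\<And>u v. F u v \<in> (FS n :: ('h list \<Rightarrow> 'k) set)"
  shows "pair (*) \<mu> (lsum x F) = lsum x (\<lambda>u v. pair (*) \<mu> (F u v))"
  unfolding lsum_choices[symmetric] by (rule pair_sum_list[OF module_times]) (rule FS_fin[OF assms])

lemma ev_FS: "(\<And>r. length r = length ps \<Longrightarrow> G r \<in> (FS n :: ('h list \<Rightarrow> 'k) set)) \<Longrightarrow> ev sc ps G x \<in> FS n"
proof (induction ps arbitrary: G x)
  case Nil then show ?case by (simp add: FS_sc)
next
  case (Cons p ps)
  have "ev sc ps (\<lambda>r. G (p u # r)) v \<in> FS n" for u v by (rule Cons.IH) (simp add: Cons.prems)
  then show ?case by (simp add: lsum_FS)
qed

lemma pair_ev: "(\<And>r. length r = length ps \<Longrightarrow> G r \<in> (FS n :: ('h list \<Rightarrow> 'k) set)) \<Longrightarrow>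
  pair (*) \<mu> (ev sc ps G x) = evk ps (\<lambda>r. pair (*) \<mu> (G r)) x"
proof (induction ps arbitrary: G x)
  case Nil
  show ?case using pair_sc[OF module_times FS_fin[OF Nil]] by simp
next
  case (Cons p ps)
  have 1: "ev sc ps (\<lambda>r. G (p u # r)) v \<in> FS n" for u v
    by (rule ev_FS) (simp add: Cons.prems)
  have 2: "pair (*) \<mu> (ev sc ps (\<lambda>r. G (p u # r)) v) = evk ps (\<lambda>r. pair (*) \<mu> (G (p u # r))) v" for u v
    by (rule Cons.IH) (simp add: Cons.prems)
  show ?case by (simp add: pair_lsum[OF 1] 2)
qed

definition actgen :: "nat list \<Rightarrow> 'h list \<Rightarrow> 'h list \<Rightarrow> 'k" where
  "actgen f w = ev sc (edges f) gen w"

definition act :: "'k chain \<Rightarrow> ('h list \<Rightarrow> 'k) \<Rightarrow> 'h list \<Rightarrow> 'k" where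
  "act u f = pext sc (\<lambda>x. lext (actgen x) f) u"

text \<open>The dual action on forms. On multilinear forms composition is respected exactly, and
  pairing carries this over to tensors modulo relations.\<close>

definition dact :: "'k chain \<Rightarrow> ('h list \<Rightarrow> 'k) \<Rightarrow> 'h list \<Rightarrow> 'k" where
  "dact u \<mu> w = pext (*) (\<lambda>x. evk (edges x) \<mu> w) u"

lemma actgen_FS: "length f = Suc m \<Longrightarrow> actgen f w \<in> FS m"
  unfolding actgen_def by (rule ev_FS) (simp add: length_edges FS_gen)

lemma pair_actgen: "pair (*) \<mu> (actgen f w) = evk (edges f) \<mu> w"
  unfolding actgen_def
  by (subst pair_ev[where n = "length (edges f)"]) (simp_all add: FS_gen pair_gen[OF module_times])

lemma act_FS: assumes "u \<in> Op n m" "f \<in> FS l" shows "act u f \<in> FS m"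
  unfolding act_def pext_def
proof (intro FS_sum FS_sc)
  fix x assume "x \<in> keys u"
  then have "length x = Suc m" using assms(1) by (auto simp: Op_def supp_def)
  then show "lext (actgen x) f \<in> FS m" by (intro lext_FS[OF assms(2)] actgen_FS)
qed

lemma pair_sum_form: "pair (*) (\<lambda>w. \<Sum>x\<in>A. c x * \<nu> x w) f = (\<Sum>x\<in>A. c x * pair (*) (\<nu> x) (f :: 'h list \<Rightarrow> 'k))"
  unfolding pair_def sum_distrib_left by (subst sum.swap) (simp add: mult.left_commute)

lemma pair_act: assumes u: "u \<in> Op n m" and f: "f \<in> FS l"
  shows "pair (*) \<mu> (act u f) = pair (*) (dact u \<mu>) f"
proof -
  have x: "length x = Suc m" if "x \<in> keys u" for x using u that by (auto simp: Op_def supp_def)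
  have F: "lext (actgen x) f \<in> FS m" if "x \<in> keys u" for x
    by (intro lext_FS[OF f] actgen_FS x that)
  have "pair (*) \<mu> (act u f) = (\<Sum>x\<in>keys u. pair (*) \<mu> (sc (lookup u x) (lext (actgen x) f)))"
    unfolding act_def pext_def by (rule pair_sum[OF module_times]) (intro fin_sc FS_fin[OF F])
  also have "\<dots> = (\<Sum>x\<in>keys u. lookup u x * pair (*) (\<lambda>w. evk (edges x) \<mu> w) f)"
  proof (rule sum.cong)
    fix x assume k: "x \<in> keys u"
    show "pair (*) \<mu> (sc (lookup u x) (lext (actgen x) f)) = lookup u x * pair (*) (\<lambda>w. evk (edges x) \<mu> w) f"
      using pair_lext[OF f actgen_FS[OF x[OF k]], of \<mu>] by (simp add: pair_sc[OF module_times FS_fin[OF F[OF k]]] pair_actgen)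
  qed simp
  also have "\<dots> = pair (*) (dact u \<mu>) f"
    unfolding dact_def pext_def by (rule pair_sum_form[symmetric])
  finally show ?thesis .
qed

lemma ml_sum: "(\<And>x. x \<in> A \<Longrightarrow> mlk (\<nu> x)) \<Longrightarrow> mlk (\<lambda>w. \<Sum>x\<in>A. c x * \<nu> x w)"
  by (simp add: ml_def algebra_simps sum.distrib sum_distrib_left)

lemma dact_ml: "mlk \<mu> \<Longrightarrow> mlk (dact u \<mu>)"
  unfolding dact_def pext_def
  by (intro ml_sum ev_ml[OF module_times]) (use mor_edges morD in blast)

lemma hom_dact: "module_hom pscale (*) (\<lambda>u. dact u \<mu> w)"
  unfolding dact_def by (rule module_hom_pext[OF module_times])

lemma dact_bas: "dact (bas x) \<mu> w = evk (edges x) \<mu> w"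
  unfolding dact_def by (rule pext_bas[OF module_times])

lemma dact_simps: "dact (u + v) \<mu> w = dact u \<mu> w + dact v \<mu> w" "dact (pscale c u) \<mu> w = c * dact u \<mu> w"
  "dact (sum g I) \<mu> w = (\<Sum>i\<in>I. dact (g i) \<mu> w)"
  using module_hom.add[OF hom_dact] module_hom.scale[OF hom_dact] module_hom.sum[OF hom_dact] by auto

lemma dact_cmp:
  assumes u: "u \<in> Op n m" and v: "v \<in> Op m l" and \<mu>: "mlk \<mu>"
  shows "dact (cmp u v) \<mu> w = dact u (dact v \<mu>) w"
proof (rule hom_eqI[OF _ hom_dact u[unfolded Op_def]])
  show "module_hom pscale (*) (\<lambda>u. dact (cmp u v) \<mu> w)"
    by (simp add: module_hom_iff pscale.module_axioms module_times dact_simps)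
  fix x assume x: "x \<in> {x. length x = Suc m \<and> set x \<subseteq> {..n}}"
  show "dact (cmp (bas x) v) \<mu> w = dact (bas x) (dact v \<mu>) w"
    unfolding basic_bas dact_bas
  proof (rule hom_eqI[OF _ _ v[unfolded Op_def]])
    show "module_hom pscale (*) (\<lambda>v. dact (pmap ((!) x) v) \<mu> w)"
      by (simp add: module_hom_iff pscale.module_axioms module_times dact_simps)
    show "module_hom pscale (*) (\<lambda>v. evk (edges x) (dact v \<mu>) w)"
    proof -
      have "dact (a + b) \<mu> = (\<lambda>w. dact a \<mu> w + dact b \<mu> w)" "dact (pscale c a) \<mu> = (\<lambda>w. c * dact a \<mu> w)" for a b c
        by (auto simp: dact_simps)
      then show ?thesis
        by (simp add: module_hom_iff pscale.module_axioms module_times ev_add[OF module_times] ev_scale[OF module_times])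
    qed
    fix y assume "y \<in> {x. length x = Suc l \<and> set x \<subseteq> {..m}}"
    then have "set y \<subseteq> {..<length x}" using x by auto
    from ev_functor[OF module_times this \<mu>, of w]
    have "evk (edges x) (evk (edges y) \<mu>) w = evk (edges (map ((!) x) y)) \<mu> w" .
    moreover have "dact (bas y) \<mu> = evk (edges y) \<mu>" by (simp add: dact_bas fun_eq_iff)
    ultimately show "dact (pmap ((!) x) (bas y)) \<mu> w = evk (edges x) (dact (bas y) \<mu>) w"
      by (simp add: dact_bas)
  qed
qed

text \<open>Separation by forms and linearity reduce the comparison of an explicitly given operator
  with the action of a chain to single generators.\<close>

lemma act_eqI:
  assumes f: "f \<in> FS n" and u: "u \<in> Op n m" and G: "\<And>w. length w = n \<Longrightarrow> G w \<in> FS m"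
    and eq: "\<And>\<mu> w. mlk \<mu> \<Longrightarrow> length w = n \<Longrightarrow> pair (*) \<mu> (G w) = dact u \<mu> w"
  shows "lext G f - act u f \<in> tensor_rel H m"
proof (rule tensor_eqI[OF lext_FS[OF f G] act_FS[OF u f]])
  fix \<mu> assume \<mu>: "mlk \<mu>"
  have "pair (*) \<mu> (lext G f) = pair (*) (\<lambda>w. pair (*) \<mu> (G w)) f" by (rule pair_lext[OF f G])
  also have "\<dots> = pair (*) (dact u \<mu>) f"
    by (rule pair_cong[OF module_times]) (use f eq[OF \<mu>] in \<open>auto simp: FS_def\<close>)
  finally show "pair (*) \<mu> (lext G f) = pair (*) \<mu> (act u f)" by (simp add: pair_act[OF u f])
qed

section \<open>The given boundary, cyclic operator and involution as actions of words\<close>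

lemma bdry_word_delete: "bdry_word x = (\<Sum>i<length x. pscale ((-1) ^ i) (bas (take i x @ drop (Suc i) x)))"
proof (induction x)
  case (Cons a x)
  show ?case by (simp add: Cons sum.lessThan_Suc_shift sum_negf del: sum.lessThan_Suc)
qed simp

lemma face_FS: "length w = Suc n \<Longrightarrow> i \<le> Suc n \<Longrightarrow> face H i w \<in> FS n"
  by (auto simp: face_def intro!: FS_gen FS_sc)

lemma bgen_sum: "w \<noteq> [] \<Longrightarrow> bgen H w = (\<Sum>i\<le>length w. sc ((-1) ^ i) (face H i w))"
  by (simp add: bgen_def fun_eq_iff sum_apply_fun sc_def atLeast0AtMost)

text \<open>The face with index \<open>i\<close> acts as the identity word without its letter
  \<open>i\<close>, and these words with alternating signs make up the boundary of the identity
  word.\<close>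

lemma bnd_act: assumes "f \<in> FS (Suc n)" shows "bnd H f - act (bdry (idop (Suc n))) f \<in> tensor_rel H n"
  unfolding bnd_def
proof (rule act_eqI[OF assms bdry_idop])
  fix w :: "'h list" assume w: "length w = Suc n"
  have w': "w \<noteq> []" using w by auto
  show "bgen H w \<in> FS n" unfolding bgen_sum[OF w'] by (intro FS_sum FS_sc face_FS) (use w in auto)
  fix \<mu> assume \<mu>: "mlk \<mu>"
  have t: "take i [0..<Suc (Suc n)] = [0..<i]" "drop (Suc i) [0..<Suc (Suc n)] = [Suc i..<Suc (Suc n)]"
    if "i < Suc (Suc n)" for i using that by (simp_all add: take_upt drop_upt del: upt_Suc)
  have "pair (*) \<mu> (bgen H w) = (\<Sum>i\<le>Suc n. (-1) ^ i * pair (*) \<mu> (face H i w))"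
  proof -
    have ff: "fin (face H i w)" if "i \<le> Suc n" for i by (rule FS_fin[OF face_FS[OF w that]])
    have "pair (*) \<mu> (bgen H w) = (\<Sum>i\<le>Suc n. pair (*) \<mu> (sc ((-1) ^ i) (face H i w)))"
      unfolding bgen_sum[OF w'] w by (rule pair_sum[OF module_times]) (simp add: fin_sc ff)
    also have "\<dots> = (\<Sum>i\<le>Suc n. (-1) ^ i * pair (*) \<mu> (face H i w))"
      by (rule sum.cong) (simp_all add: pair_sc[OF module_times ff])
    finally show ?thesis .
  qed
  also have "\<dots> = (\<Sum>i<Suc (Suc n). (-1) ^ i * evk (edges (take i [0..<Suc (Suc n)] @ drop (Suc i) [0..<Suc (Suc n)])) \<mu> w)"
    unfolding lessThan_Suc_atMost[symmetric]
    by (rule sum.cong) (simp_all add: t pair_face[OF \<mu> w] del: upt_Suc)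
  also have "\<dots> = dact (bdry (idop (Suc n))) \<mu> w"
    unfolding idop_def ops_bas bdry_word_delete by (simp add: dact_simps dact_bas del: upt_Suc sum.lessThan_Suc)
  finally show "pair (*) \<mu> (bgen H w) = dact (bdry (idop (Suc n))) \<mu> w" .
qed

lemma choices_length: "p \<in> set (choices l) \<Longrightarrow> length p = length l"
  by (induction l arbitrary: p) auto

lemma taugen_sum: "w \<noteq> [] \<Longrightarrow> taugen H w = (\<Sum>p\<leftarrow>choices (map (hDelta H) w).
    sc (cou (snd (last p))) (gen (S (foldr (hmult H) (map fst p) one) # map snd (butlast p))))"
  by (simp add: taugen_def fun_eq_iff sum_list_apply sc_def)

lemma taugen_lsum: assumes w: "w \<noteq> []"
  shows "taugen H w = lsum w (\<lambda>u v. sc (cou (last v)) (gen (S (foldr (hmult H) u one) # butlast v)))"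
proof -
  have ne: "p \<noteq> []" if "p \<in> set (choices (map (hDelta H) w))" for p
    using choices_length[OF that] w by auto
  have "taugen H w = (\<Sum>p\<leftarrow>choices (map (hDelta H) w).
        sc (cou (last (map snd p))) (gen (S (foldr (hmult H) (map fst p) one) # butlast (map snd p))))"
    unfolding taugen_sum[OF w]
    by (rule arg_cong[where f = sum_list], rule map_cong) (simp_all add: ne last_map map_butlast)
  then show ?thesis by (simp only: lsum_choices[where F = "\<lambda>u v. sc (cou (last v)) (gen (S (foldr (hmult H) u one) # butlast v))"])
qed

lemma tgen_FS: assumes "length w = n" shows "tgen H w \<in> FS n"
proof -
  have "taugen H w \<in> FS n"
  proof (cases "w = []")
    case True then show ?thesis using assms FS_gen[of "[]" n] by (simp add: taugen_def)
  next
    case False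
    show ?thesis unfolding taugen_sum[OF False]
    proof (intro FS_sum_list FS_sc FS_gen)
      fix p assume "p \<in> set (choices (map (hDelta H) w))"
      from choices_length[OF this] show "length (S (foldr (hmult H) (map fst p) one) # map snd (butlast p)) = n"
        using assms False by (cases w) auto
    qed
  qed
  moreover have "tgen H w = sc ((-1) ^ length w) (taugen H w)" by (simp add: tgen_def sc_def)
  ultimately show ?thesis by (simp add: FS_sc)
qed

lemma pair_tgen: assumes \<mu>: "mlk \<mu>" and w: "length w = n" shows "pair (*) \<mu> (tgen H w) = dact (cyc_op n) \<mu> w"
proof -
  have f: "fin (taugen H w)"
  proof -
    have "taugen H w = sc ((-1) ^ length w) (tgen H w)"
      by (simp add: tgen_def sc_def fun_eq_iff mult.assoc[symmetric] power_mult_distrib[symmetric])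
    then show ?thesis using fin_sc[OF FS_fin[OF tgen_FS[OF refl]]] by metis
  qed
  have t: "tgen H w = sc ((-1) ^ length w) (taugen H w)" by (simp add: tgen_def sc_def)
  have "pair (*) \<mu> (taugen H w) = evk (edges (n # [0..<n])) \<mu> w"
  proof (cases n)
    case 0
    then show ?thesis using w by (simp add: taugen_def pair_gen[OF module_times])
  next
    case (Suc k)
    then have w': "w \<noteq> []" using w by auto
    have "pair (*) \<mu> (lsum w (\<lambda>u v. sc (cou (last v)) (gen (S (foldr (hmult H) u one) # butlast v))))
      = lsum w (\<lambda>u v. cou (last v) * \<mu> (S (foldr (hmult H) u one) # butlast v))"
      unfolding lsum_choices[symmetric]
      by (subst pair_sum_list[OF module_times]) (simp_all add: fin_sc pair_sc[OF module_times] pair_gen[OF module_times])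
    then show ?thesis using ev_tau[OF \<mu>, of w k] w Suc by (simp add: taugen_lsum[OF w'] del: upt_Suc)
  qed
  then show ?thesis by (simp add: t pair_sc[OF module_times f] cyc_op_def dact_simps dact_bas w del: upt_Suc)
qed

lemma ygen_sc: "ygen H w = sc ((-1) ^ (length w * (length w + 1) div 2)) (gen (rev (map S w)))"
  by (simp add: ygen_def omegagen_def inv_S sc_def)

lemma ygen_FS: "length w = n \<Longrightarrow> ygen H w \<in> FS n"
  unfolding ygen_sc by (intro FS_sc FS_gen) simp

lemma pair_ygen: assumes \<mu>: "mlk \<mu>" and w: "length w = n" shows "pair (*) \<mu> (ygen H w) = dact (flip (idop n)) \<mu> w"
  unfolding ygen_sc idop_def ops_bas
  by (simp add: pair_sc[OF module_times] pair_gen[OF module_times] dact_simps dact_bas edges_rev ev_rev[OF \<mu> w] w mult.commute del: upt_Suc)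

lemma act_tensor_rel: assumes "u \<in> Op n m" "f \<in> tensor_rel H n" shows "act u f \<in> tensor_rel H m"
proof (rule tensor_rel_separation)
  note f = tensor_rel_FS[OF assms(2)]
  show "act u f \<in> FS m" by (rule act_FS[OF assms(1) f])
  fix \<mu> assume "mlk \<mu>"
  then show "pair (*) \<mu> (act u f) = 0"
    unfolding pair_act[OF assms(1) f] by (intro pair_tensor_rel[OF module_times _ assms(2)] dact_ml)
qed

lemma act_cmp: assumes "u \<in> Op n m" "v \<in> Op m l" "f \<in> FS n"
  shows "act (cmp u v) f - act v (act u f) \<in> tensor_rel H l"
proof (rule tensor_eqI)
  show "act (cmp u v) f \<in> FS l" by (rule act_FS[OF cmp_Op[OF assms(1,2)] assms(3)])
  show "act v (act u f) \<in> FS l" by (rule act_FS[OF assms(2) act_FS[OF assms(1,3)]])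
  fix \<mu> assume \<mu>: "mlk \<mu>"
  have "dact (cmp u v) \<mu> = dact u (dact v \<mu>)" using dact_cmp[OF assms(1,2) \<mu>] by blast
  then show "pair (*) \<mu> (act (cmp u v) f) = pair (*) \<mu> (act v (act u f))"
    by (simp add: pair_act[OF cmp_Op[OF assms(1,2)] assms(3)] pair_act[OF assms(2) act_FS[OF assms(1,3)]] pair_act[OF assms(1,3)])
qed

lemma lext_gen: "f \<in> FS n \<Longrightarrow> lext gen f = (f :: 'h list \<Rightarrow> 'k)"
  by (auto simp: lext_def gen_def FS_def fun_eq_iff if_distrib cong: if_cong)

lemma act_idop: assumes "f \<in> FS n" shows "act (idop n) f - f \<in> tensor_rel H n"
proof -
  have "lext gen f - act (idop n) f \<in> tensor_rel H n"
    by (rule act_eqI[OF assms idop_Op])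
       (simp_all add: FS_gen pair_gen[OF module_times] idop_def dact_bas edges_upt ev_idop del: upt_Suc)
  from tensor_rel_closed(2)[OF this, of "-1"] show ?thesis
    by (simp add: lext_gen[OF assms] sc_def fun_diff_def)
qed

lemma act_hom: "act (u + v) f = act u f + act v f" "act (pscale c u) f = sc c (act u f)"
  unfolding act_def
  using module_hom.add[OF module_hom_pext[OF mod_sc]] module_hom.scale[OF module_hom_pext[OF mod_sc]] by auto

lemma lext_diff: "f \<in> FS n \<Longrightarrow> lext (\<lambda>w y. gen w y - tgen H w y) f = f - lext (tgen H) (f :: 'h list \<Rightarrow> 'k)"
  using lext_gen[of f n] by (simp add: lext_def fun_eq_iff right_diff_distrib sum_subtractf)

lemma act_lin:
  assumes "f \<in> FS n" "g \<in> FS n"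
  shows "act u (f + g) = act u f + act u g" "act u (sc c f) = sc c (act u f)"
  using assms[THEN FS_fin]
  by (simp_all add: act_def pext_def lext_pair pair_add[OF mod_sc] pair_sc[OF mod_sc] sc.scale_right_distrib
      sum.distrib sc.scale_sum_right mult.commute)

end

theorem theorem5p5:
  fixes H :: "('k::field_char_0, 'h::ab_group_add) hopf_data" and n :: nat
  assumes "cocomm_hopf_algebra H"
  shows "subquot_iso (dcyc H 1 n) (dbnd H 1 n) {i. 4 * i \<le> n}
           (\<lambda>i. hcyc H (n - 4 * i)) (\<lambda>i. hbnd H (n - 4 * i))
       \<and> subquot_iso (dcyc H (-1) n) (dbnd H (-1) n) {i. 4 * i + 2 \<le> n}
           (\<lambda>i. hcyc H (n - 4 * i - 2)) (\<lambda>i. hbnd H (n - 4 * i - 2))"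
proof -
  interpret hopf H by unfold_locales (rule assms)
  interpret symmetric_system FS "tensor_rel H" act "bnd H" "lext (tgen H)" "lext (ygen H)"
  proof
    fix f g :: "'h list \<Rightarrow> 'k" and n m l :: nat and u v :: "'k chain" and c :: 'k
    show "tensor_rel H n \<subseteq> FS n" using tensor_rel_FS by blast
    show "f \<in> FS n \<Longrightarrow> lext (tgen H) f - act (cyc_op n) f \<in> tensor_rel H n"
      by (rule act_eqI[OF _ cyc_op_Op]) (auto intro: tgen_FS pair_tgen)
    show "f \<in> FS n \<Longrightarrow> lext (ygen H) f - act (flip (idop n)) f \<in> tensor_rel H n"
      by (rule act_eqI[OF _ flip_Op[OF idop_Op]]) (auto intro: ygen_FS pair_ygen)
  qed (auto intro: FS_add FS_sc tensor_rel_closed act_FS act_tensor_rel act_lin act_hom act_cmp act_idop bnd_act)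
  \<comment> \<open>The difference \<open>1 - t\<close> is formed on generators here and on vectors
    in the locale; linear extension identifies the two.\<close>
  have c: "cyc_rel H m = cyc m" for m
    unfolding cyc_rel_def cyc_def using lext_diff by (force simp: plus_fun_def)
  have e: "eigen H s m = eig s m" for s m
    unfolding eigen_def eig_def c by (simp add: fun_diff_def sc_def)
  have d: "dcyc H s m = dcy s m" "dbnd H s m = dbn s m" "hcyc H m = hcy m" "hbnd H m = hbn m" for s m
    unfolding dcyc_def dcy_def dbnd_def dbn_def hcyc_def hcy_def hbnd_def hbn_def e c plus_fun_def by simp_all
  \<comment> \<open>The value \<open>d = 0\<close> gives the sign 1 and the shifts 4i, the value
    \<open>d = 1\<close> the sign -1 and the shifts 4i + 2.\<close>
  have "subquot_iso (dcy 1 n) (dbn 1 n) {i. 4 * i \<le> n} (\<lambda>i. hcy (n - 4 * i)) (\<lambda>i. hbn (n - 4 * i))"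
    using splitting[of 1 0 n] by simp
  moreover have "subquot_iso (dcy (-1) n) (dbn (-1) n) {i. 4 * i + 2 \<le> n}
      (\<lambda>i. hcy (n - 4 * i - 2)) (\<lambda>i. hbn (n - 4 * i - 2))"
    using splitting[of "-1" 1 n] by simp
  ultimately show ?thesis unfolding d by simp
qed

end
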